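(* Suppose that for the random design matrix $\mathbf{X}$ described in the context there are positive constants $c_2$ and $c_3\le 1$ (not depending on $n$ or $p$) such that: (1) the density $\exp\{-U_p(\mathbf{v})\}$, $\mathbf{v}\in\mathbb{R}^p$, of the $p$-variate log-concave spherical distribution $\mu_p$ satisfies $\nabla^2 U_p(\mathbf{v}) \ge c_2 I_p$ for all $\mathbf{v}\in\mathbb{R}^p$; (2) $E|Z_1| \ge c_3$. Then $\mathbf{X}$ satisfies the concentration property: there exist a constant $c>1$ and positive constants $c_1, C_1$ (not depending on $n$ or $p$) such that $$P\left\{\lambda_{\max}\left(\widetilde{p}^{-1}\widetilde{\mathbf{Z}}\widetilde{\mathbf{Z}}^T\right) > c_1 \ \text{ or }\ \lambda_{\min}\left(\widetilde{p}^{-1}\widetilde{\mathbf{Z}}\widetilde{\mathbf{Z}}^T\right) < c_1^{-1}\right\} \le \exp(-C_1 n)$$ holds for each $n\times\widetilde{p}$ submatrix $\widetilde{\mathbf{Z}}$ of $\mathbf{Z}$ (formed by $\widetilde p$ of its columns) with $cn<\widetilde{p}\le p$.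
   Context: $\mathbf{x}=(X_1,\ldots,X_p)^T$ is a $p$-dimensional random vector having an elliptical distribution $\nu_p$ with mean $\mathbf{0}$ and nonsingular covariance matrix $\boldsymbol{\Sigma}$, and $\mathbf{x}_1,\ldots,\mathbf{x}_n$ are i.i.d. copies of $\mathbf{x}$. The random design matrix is the $n\times p$ matrix $\mathbf{X}=(\mathbf{x}_1,\ldots,\mathbf{x}_n)^T$. The transformed vector $\mathbf{z}=(Z_1,\ldots,Z_p)^T=\boldsymbol{\Sigma}^{-1/2}\mathbf{x}$ then has a spherical (orthogonally invariant) distribution $\mu_p$ with mean $\mathbf{0}$ and covariance matrix $I_p$; it is assumed that $P(\mathbf{z}=\mathbf{0})=0$, and that $\mu_p$ has a spherically symmetric, log-concave density $\exp\{-U_p\}$ with respect to Lebesgue measure on $\mathbb{R}^p$. The transformed random design matrix is $\mathbf{Z}=\mathbf{X}\boldsymbol{\Sigma}^{-1/2}$, whose rows are i.i.d. copies of $\mathbf{z}$. $\nabla^2U_p$ denotes the Hessian matrix of $U_p$; for symmetric matrices, $\mathbf{A}\ge\mathbf{B}$ means $\mathbf{A}-\mathbf{B}$ is positive semidefinite. $\lambda_{\max}(\cdot)$ and $\lambda_{\min}(\cdot)$ denote the largest and smallest eigenvalues of a symmetric matrix. *)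

theory Defs
  imports
    "HOL-Probability.Probability"
    "Jordan_Normal_Form.Char_Poly"
    "Jordan_Normal_Form.DL_Submatrix"
begin

text \<open>
  Points of \<open>p\<close>-dimensional Euclidean space are elements of \<^term>\<open>carrier_vec p :: real Matrix.vec set\<close>,
  so that constants can be chosen uniformly in the dimension.  The coordinates are
  indexed from \<open>0\<close>, so the first coordinate of \<open>v\<close> is \<open>v $ 0\<close>.
\<close>

no_notation inner (infix "\<bullet>" 70)
no_notation vec_nth (infixl "$" 90)
hide_const (open) Finite_Cartesian_Product.vec Finite_Cartesian_Product.row
hide_type (open) Finite_Cartesian_Product.vec

definition borel_vec :: "nat \<Rightarrow> real vec measure" where
  "borel_vec p =
     vimage_algebra (carrier_vec p) (\<lambda>v. \<lambda>i\<in>{..<p}. v $ i) (Pi\<^sub>M {..<p} (\<lambda>_. borel))"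

definition lborel_vec :: "nat \<Rightarrow> real vec measure" where
  "lborel_vec p = distr (Pi\<^sub>M {..<p} (\<lambda>_. lborel)) (borel_vec p) (vec p)"

definition pos_semidef :: "nat \<Rightarrow> real mat \<Rightarrow> bool" where
  "pos_semidef p A \<longleftrightarrow> A \<in> carrier_mat p p \<and> transpose_mat A = A \<and>
     (\<forall>v\<in>carrier_vec p. 0 \<le> v \<bullet> (A *\<^sub>v v))"

definition loewner_ge :: "nat \<Rightarrow> real mat \<Rightarrow> real mat \<Rightarrow> bool" where
  "loewner_ge p A B \<longleftrightarrow> A \<in> carrier_mat p p \<and> B \<in> carrier_mat p p \<and> pos_semidef p (A - B)"

text \<open>\<open>R\<close> is the (unique) symmetric positive semidefinite inverse square root of \<open>S\<close>.\<close>

definition is_inv_sqrt :: "nat \<Rightarrow> real mat \<Rightarrow> real mat \<Rightarrow> bool" where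
  "is_inv_sqrt p S R \<longleftrightarrow> pos_semidef p R \<and> inverts_mat (R * R) S \<and> inverts_mat S (R * R)"

definition lambda_max :: "real mat \<Rightarrow> real" where
  "lambda_max A = Max {k. eigenvalue A k}"

definition lambda_min :: "real mat \<Rightarrow> real" where
  "lambda_min A = Min {k. eigenvalue A k}"

definition vec_len :: "real vec \<Rightarrow> real" where
  "vec_len v = sqrt (v \<bullet> v)"

text \<open>Frechet differentiability at \<open>v\<close>, the derivative being \<open>h \<mapsto> g \<bullet> h\<close>.\<close>

definition has_gradient :: "nat \<Rightarrow> (real vec \<Rightarrow> real) \<Rightarrow> real vec \<Rightarrow> real vec \<Rightarrow> bool" where
  "has_gradient p f v g \<longleftrightarrow> g \<in> carrier_vec p \<and>
     (\<forall>e>0. \<exists>d>0. \<forall>h\<in>carrier_vec p. vec_len h < d \<longrightarrow>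
        \<bar>f (v + h) - f v - g \<bullet> h\<bar> \<le> e * vec_len h)"

text \<open>\<open>f\<close> is twice differentiable on the whole space, with Hessian matrix \<open>H v\<close> at \<open>v\<close>.\<close>

definition has_hessian :: "nat \<Rightarrow> (real vec \<Rightarrow> real) \<Rightarrow> (real vec \<Rightarrow> real mat) \<Rightarrow> bool" where
  "has_hessian p f H \<longleftrightarrow>
     (\<exists>g. \<forall>v\<in>carrier_vec p. has_gradient p f v (g v) \<and> H v \<in> carrier_mat p p \<and>
        (\<forall>i<p. has_gradient p (\<lambda>u. g u $ i) v (row (H v) i)))"

definition orthogonal_mats :: "nat \<Rightarrow> real mat set" where
  "orthogonal_mats p = {Q \<in> carrier_mat p p. transpose_mat Q * Q = 1\<^sub>m p}"

definition vec_law :: "nat \<Rightarrow> real vec measure \<Rightarrow> bool" where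
  "vec_law p \<rho> \<longleftrightarrow> prob_space \<rho> \<and> sets \<rho> = sets (borel_vec p)"

definition spherical_law :: "nat \<Rightarrow> real vec measure \<Rightarrow> bool" where
  "spherical_law p \<rho> \<longleftrightarrow> vec_law p \<rho> \<and>
     (\<forall>Q\<in>orthogonal_mats p. distr \<rho> (borel_vec p) (\<lambda>v. Q *\<^sub>v v) = \<rho>)"

definition elliptical_law :: "nat \<Rightarrow> real vec measure \<Rightarrow> bool" where
  "elliptical_law p \<nu> \<longleftrightarrow>
     (\<exists>\<rho>. \<exists>m\<in>carrier_vec p. \<exists>A\<in>carrier_mat p p. spherical_law p \<rho> \<and>
        \<nu> = distr \<rho> (borel_vec p) (\<lambda>v. m + A *\<^sub>v v))"

definition has_mean :: "nat \<Rightarrow> real vec measure \<Rightarrow> real vec \<Rightarrow> bool" where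
  "has_mean p \<rho> m \<longleftrightarrow> m \<in> carrier_vec p \<and>
     (\<forall>i<p. integrable \<rho> (\<lambda>v. v $ i) \<and> (LINT v|\<rho>. v $ i) = m $ i)"

definition has_covariance :: "nat \<Rightarrow> real vec measure \<Rightarrow> real mat \<Rightarrow> bool" where
  "has_covariance p \<rho> S \<longleftrightarrow> S \<in> carrier_mat p p \<and>
     (\<exists>m. has_mean p \<rho> m \<and>
       (\<forall>i<p. \<forall>j<p. integrable \<rho> (\<lambda>v. (v $ i - m $ i) * (v $ j - m $ j)) \<and>
          (LINT v|\<rho>. (v $ i - m $ i) * (v $ j - m $ j)) = S $$ (i, j)))"

definition spherically_symmetric :: "nat \<Rightarrow> (real vec \<Rightarrow> real) \<Rightarrow> bool" where
  "spherically_symmetric p f \<longleftrightarrow>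
     (\<forall>Q\<in>orthogonal_mats p. \<forall>v\<in>carrier_vec p. f (Q *\<^sub>v v) = f v)"

definition log_concave :: "nat \<Rightarrow> (real vec \<Rightarrow> real) \<Rightarrow> bool" where
  "log_concave p f \<longleftrightarrow> (\<forall>v\<in>carrier_vec p. 0 \<le> f v) \<and>
     (\<forall>u\<in>carrier_vec p. \<forall>v\<in>carrier_vec p. \<forall>t\<in>{0<..<1}.
        f u powr (1 - t) * f v powr t \<le> f ((1 - t) \<cdot>\<^sub>v u + t \<cdot>\<^sub>v v))"

text \<open>
  \<open>\<nu>\<close> is the common law of the rows of \<open>X\<close>, \<open>\<Sigma>\<close> its covariance matrix,
  \<open>R\<close> the matrix \<open>\<Sigma>\<close> to the power \<open>-1/2\<close>, and \<open>\<mu>\<close> the law of the standardized vector;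
  the standardized design matrix is \<open>X \<omega> * R\<close>.
\<close>

locale random_design = prob_space M
  for M :: "'w measure" and n p :: nat and X :: "'w \<Rightarrow> real mat"
    and \<nu> :: "real vec measure" and \<Sigma> R :: "real mat"
    and \<mu> :: "real vec measure" and U :: "real vec \<Rightarrow> real" +
  assumes n_pos: "0 < n" and p_pos: "0 < p"
    and X_dim: "\<And>\<omega>. \<omega> \<in> space M \<Longrightarrow> X \<omega> \<in> carrier_mat n p"
    and rows_indep: "indep_vars (\<lambda>_. borel_vec p) (\<lambda>i \<omega>. row (X \<omega>) i) {..<n}"
    and rows_law: "\<And>i. i < n \<Longrightarrow> distr M (borel_vec p) (\<lambda>\<omega>. row (X \<omega>) i) = \<nu>"
    and elliptical: "elliptical_law p \<nu>"
    and mean: "has_mean p \<nu> (0\<^sub>v p)"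
    and covariance: "has_covariance p \<nu> \<Sigma>"
    and nonsingular: "invertible_mat \<Sigma>"
    and root: "is_inv_sqrt p \<Sigma> R"
    and standardized: "\<mu> = distr \<nu> (borel_vec p) (\<lambda>v. R *\<^sub>v v)"
    and spherical: "spherical_law p \<mu>"
    and no_atom: "measure \<mu> {0\<^sub>v p} = 0"
    and U_measurable: "U \<in> borel_measurable (borel_vec p)"
    and density: "\<mu> = density (lborel_vec p) (\<lambda>v. ennreal (exp (- U v)))"
    and density_symmetric: "spherically_symmetric p (\<lambda>v. exp (- U v))"
    and density_log_concave: "log_concave p (\<lambda>v. exp (- U v))"

end

theory Submission
  imports Defs "Jordan_Normal_Form.Spectral_Radius"
begin

text \<open>
  The potential \<open>U\<close> is radial with profile \<open>u\<close>, and \<open>u s - c2 * s^2 / 2\<close> is nondecreasing for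
  \<open>s \<ge> 0\<close>. Hence the density is a centred Gaussian times a radially decreasing function, so the
  standardized vector \<open>z\<close> is subgaussian: its moment generating function is at most that of a
  Gaussian with covariance \<open>1 / c2\<close>. The bound on the first moment forces the typical norm to be of order
  \<open>sqrt p\<close>, and dilations give \<open>P (norm z \<le> \<epsilon> * sqrt p) \<le> exp (- p)\<close> as well as a small ball
  estimate for the direction; together, the restriction of \<open>z\<close> to \<open>m\<close> coordinates has norm at
  least a constant times \<open>sqrt m\<close> outside an event of probability \<open>2 * exp (- m)\<close>.

  For \<open>n\<close> independent rows, a net argument for the bilinear form bounds the largest singular
  value. For the smallest one, write
  \<open>norm (\<Sum>i. a i * z i) ^ 2 = (\<Sum>i. a i ^ 2 * norm (z i) ^ 2) + 2 * T\<close>, where the cross term \<open>T\<close>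
  is a martingale in the number of rows. Truncating its increments at the level given by the upper
  bound makes \<open>T > - \<tau> * m\<close> fail with probability at most \<open>exp (- r * m)\<close> for each \<open>a\<close>, which
  beats the size of a net in dimension \<open>n\<close> as soon as \<open>m > c * n\<close>.
\<close>

section \<open>Radially decreasing densities\<close>

text \<open>The coordinates of a row are dependent; the only independence is between rows, so the
  cross term has to be handled by exposing the rows one at a time. Convexity yields upper tails,
  whereas lower bounds on norms come from the first moment: it limits how far the profile can rise
  up to radius \<open>c3 * sqrt p / 4\<close>, and this makes dilations cheap.

  The conditional variance proxy of an increment of the cross term is proportional to the squared
  norm of a random partial sum. The bound on the largest singular value must therefore precede the
  one on the smallest, and it is used once more to pass from net points to all coefficient vectors.

  The two union bounds are paid for differently. For the largest singular value the threshold may be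
  raised until it beats the nets. For the smallest one the admissible deviation is fixed by the row
  lengths, so the payment must come from \<open>m\<close> being large compared with
  \<open>n\<close>; this is the origin of \<open>c\<close>.\<close>

lemma ennreal_rearrangement:
  fixes a b g k :: ennreal
  assumes "a \<le> b \<and> g \<le> k \<or> b \<le> a \<and> k \<le> g"
  shows "a * k + b * g \<le> a * g + b * k"
proof -
  have *: "a * k + b * g \<le> a * g + b * k" if "a \<le> b" "g \<le> k" for a b g k :: ennreal
  proof -
    \<comment> \<open>The product (b - a) * (k - g) cannot be expanded in \<open>ennreal\<close>;
      with the differences as summands the surplus is \<open>d * e\<close>.\<close>
    obtain d where "b = a + d" using \<open>a \<le> b\<close> by (auto simp: le_iff_add)
    moreover obtain e where "k = g + e" using \<open>g \<le> k\<close> by (auto simp: le_iff_add)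
    ultimately show ?thesis by (simp add: algebra_simps add_increasing add_left_mono)
  qed
  show ?thesis using assms *[of a b g k] *[of b a k g] by (auto simp: add.commute)
qed

text \<open>Completing the square turns the tilt into a shift of the Gaussian by \<open>h = t / c\<close>; the reflection
  \<open>x \<mapsto> h - x\<close> then symmetrizes the shifted integral, and the rearrangement inequality applies
  pointwise.\<close>

lemma nn_integral_even_unimodal_tilt:
  fixes \<Phi> :: "real \<Rightarrow> ennreal" and c t :: real
  assumes [measurable]: "\<Phi> \<in> borel_measurable borel"
    and anti: "\<And>x y. \<bar>x\<bar> \<le> \<bar>y\<bar> \<Longrightarrow> \<Phi> y \<le> \<Phi> x" and c: "0 < c"
  shows "(\<integral>\<^sup>+x. \<Phi> x * ennreal (exp (t * x - c * x\<^sup>2 / 2)) \<partial>lborel)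
    \<le> ennreal (exp (t\<^sup>2 / (2 * c))) * (\<integral>\<^sup>+x. \<Phi> x * ennreal (exp (- c * x\<^sup>2 / 2)) \<partial>lborel)"
proof -
  define h where "h = t / c"
  define G where "G x = ennreal (exp (- c * x\<^sup>2 / 2))" for x
  have [measurable]: "G \<in> borel_measurable borel" unfolding G_def by measurable
  have antiG: "G y \<le> G x" if "\<bar>x\<bar> \<le> \<bar>y\<bar>" for x y
    using that c by (auto simp: G_def abs_le_square_iff intro!: ennreal_leI)
  have evenG: "G (- x) = G x" and even\<Phi>: "\<Phi> (- x) = \<Phi> x" for x
    using anti[of x "- x"] anti[of "- x" x] by (auto simp: G_def)
  have tilt: "ennreal (exp (t * x - c * x\<^sup>2 / 2)) = ennreal (exp (t\<^sup>2 / (2 * c))) * G (x - h)" for x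
    unfolding G_def ennreal_mult'[symmetric, OF exp_ge_zero] exp_add[symmetric]
    using c by (intro arg_cong[where f=ennreal] arg_cong[where f=exp])
      (simp add: h_def field_simps power2_eq_square)
  have A: "(\<integral>\<^sup>+x. \<Phi> (x - h) * G x \<partial>lborel) = (\<integral>\<^sup>+x. \<Phi> x * G (x - h) \<partial>lborel)"
    using nn_integral_real_affine[of "\<lambda>x. \<Phi> (x - h) * G x" "-1" h]
      even\<Phi> evenG[of "h - _"] by simp
  have B: "(\<integral>\<^sup>+x. \<Phi> (x - h) * G (x - h) \<partial>lborel) = (\<integral>\<^sup>+x. \<Phi> x * G x \<partial>lborel)"
    using nn_integral_real_affine[of "\<lambda>x. \<Phi> x * G x" 1 "- h"] by simp
  have "2 * (\<integral>\<^sup>+x. \<Phi> x * G (x - h) \<partial>lborel)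
    = (\<integral>\<^sup>+x. \<Phi> x * G (x - h) + \<Phi> (x - h) * G x \<partial>lborel)"
    by (subst nn_integral_add) (auto simp: A mult_2)
  also have "\<dots> \<le> (\<integral>\<^sup>+x. \<Phi> x * G x + \<Phi> (x - h) * G (x - h) \<partial>lborel)"
  proof (rule nn_integral_mono)
    fix x
    have "\<bar>x\<bar> \<le> \<bar>x - h\<bar> \<or> \<bar>x - h\<bar> \<le> \<bar>x\<bar>" by linarith
    thus "\<Phi> x * G (x - h) + \<Phi> (x - h) * G x \<le> \<Phi> x * G x + \<Phi> (x - h) * G (x - h)"
      by (intro ennreal_rearrangement) (auto intro: anti antiG)
  qed
  also have "\<dots> = 2 * (\<integral>\<^sup>+x. \<Phi> x * G x \<partial>lborel)"
    by (subst nn_integral_add) (auto simp: B mult_2)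
  finally have "(\<integral>\<^sup>+x. \<Phi> x * G (x - h) \<partial>lborel) \<le> (\<integral>\<^sup>+x. \<Phi> x * G x \<partial>lborel)"
    by (subst (asm) ennreal_mult_le_mult_iff) auto
  moreover have "(\<integral>\<^sup>+x. \<Phi> x * ennreal (exp (t * x - c * x\<^sup>2 / 2)) \<partial>lborel)
     = ennreal (exp (t\<^sup>2 / (2 * c))) * (\<integral>\<^sup>+x. \<Phi> x * G (x - h) \<partial>lborel)"
    unfolding tilt by (subst nn_integral_cmult[symmetric]) (simp_all add: mult_ac)
  ultimately show ?thesis unfolding G_def[symmetric] by (simp add: mult_left_mono)
qed

lemma sum_fun_upd_insert:
  assumes "finite I" "i \<notin> I"
  shows "(\<Sum>j\<in>insert i I. F j ((x(i := y)) j)) = F i y + (\<Sum>j\<in>I. F j (x j))"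
proof -
  have "(\<Sum>j\<in>I. F j ((x(i := y)) j)) = (\<Sum>j\<in>I. F j (x j))"
    using assms by (intro sum.cong) auto
  thus ?thesis using assms by (simp del: fun_upd_apply add: fun_upd_same)
qed

interpretation lborel_product: product_sigma_finite "\<lambda>_. lborel :: real measure"
  by standard

text \<open>Induction over the coordinates. The weight \<open>w\<close> stays arbitrary because the
  induction hypothesis is applied to the slices \<open>w (y\<^sup>2 + _)\<close>, which are antitone
  again. Integrating out \<open>I\<close> leaves an even function \<open>\<Phi>\<close> that
  decreases in the modulus, and the one-dimensional tilt applies to it.\<close>

lemma nn_integral_radial_tilt:
  fixes w :: "real \<Rightarrow> ennreal" and c :: real and t :: "'i \<Rightarrow> real"
  assumes "finite I" and "w \<in> borel_measurable borel"
    and "\<And>a b. 0 \<le> a \<Longrightarrow> a \<le> b \<Longrightarrow> w b \<le> w a" and c: "0 < c"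
  shows "(\<integral>\<^sup>+x. w (\<Sum>i\<in>I. (x i)\<^sup>2) * ennreal (exp (\<Sum>i\<in>I. t i * x i - c * (x i)\<^sup>2 / 2)) \<partial>Pi\<^sub>M I (\<lambda>_. lborel))
    \<le> ennreal (exp (\<Sum>i\<in>I. (t i)\<^sup>2 / (2 * c))) *
      (\<integral>\<^sup>+x. w (\<Sum>i\<in>I. (x i)\<^sup>2) * ennreal (exp (\<Sum>i\<in>I. - c * (x i)\<^sup>2 / 2)) \<partial>Pi\<^sub>M I (\<lambda>_. lborel))"
  using assms(1-3)
proof (induction I arbitrary: w rule: finite_induct)
  case empty
  show ?case by simp
next
  case (insert i I)
  note [measurable] = insert.prems(1)
  interpret I: sigma_finite_measure "Pi\<^sub>M I (\<lambda>_. lborel :: real measure)"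
    by (rule lborel_product.sigma_finite) fact
  define \<Phi> where "\<Phi> y = (\<integral>\<^sup>+x. w (y\<^sup>2 + (\<Sum>i\<in>I. (x i)\<^sup>2)) *
      ennreal (exp (\<Sum>i\<in>I. - c * (x i)\<^sup>2 / 2)) \<partial>Pi\<^sub>M I (\<lambda>_. lborel))" for y
  have [measurable]: "\<Phi> \<in> borel_measurable borel" unfolding \<Phi>_def by measurable
  have anti: "\<Phi> y \<le> \<Phi> x" if "\<bar>x\<bar> \<le> \<bar>y\<bar>" for x y
    unfolding \<Phi>_def using that
    by (intro nn_integral_mono mult_right_mono insert.prems(2))
      (auto simp: abs_le_square_iff intro!: sum_nonneg add_nonneg_nonneg)
  have "(\<integral>\<^sup>+x. w (\<Sum>i\<in>insert i I. (x i)\<^sup>2) * ennreal (exp (\<Sum>i\<in>insert i I. t i * x i - c * (x i)\<^sup>2 / 2))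
           \<partial>Pi\<^sub>M (insert i I) (\<lambda>_. lborel))
     = (\<integral>\<^sup>+y. \<integral>\<^sup>+x. ennreal (exp (t i * y - c * y\<^sup>2 / 2)) *
           (w (y\<^sup>2 + (\<Sum>i\<in>I. (x i)\<^sup>2)) * ennreal (exp (\<Sum>i\<in>I. t i * x i - c * (x i)\<^sup>2 / 2)))
           \<partial>Pi\<^sub>M I (\<lambda>_. lborel) \<partial>lborel)"
    by (subst lborel_product.product_nn_integral_insert_rev)
      (simp_all add: insert.hyps sum_fun_upd_insert[OF insert.hyps, where F="\<lambda>j v. v\<^sup>2"]
       sum_fun_upd_insert[OF insert.hyps, where F="\<lambda>j v. t j * v - c * v\<^sup>2 / 2"] exp_add ennreal_mult' mult_ac
       del: fun_upd_apply sum.insert)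
  also have "\<dots> = (\<integral>\<^sup>+y. ennreal (exp (t i * y - c * y\<^sup>2 / 2)) * (\<integral>\<^sup>+x.
           w (y\<^sup>2 + (\<Sum>i\<in>I. (x i)\<^sup>2)) * ennreal (exp (\<Sum>i\<in>I. t i * x i - c * (x i)\<^sup>2 / 2))
           \<partial>Pi\<^sub>M I (\<lambda>_. lborel)) \<partial>lborel)"
    by (intro nn_integral_cong nn_integral_cmult) measurable
  also have "\<dots> \<le> (\<integral>\<^sup>+y. ennreal (exp (t i * y - c * y\<^sup>2 / 2)) *
       (ennreal (exp (\<Sum>i\<in>I. (t i)\<^sup>2 / (2 * c))) * \<Phi> y) \<partial>lborel)"
    unfolding \<Phi>_def
    by (intro nn_integral_mono mult_left_mono insert.IH) (auto intro!: insert.prems(2))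
  also have "\<dots> = ennreal (exp (\<Sum>i\<in>I. (t i)\<^sup>2 / (2 * c))) *
     (\<integral>\<^sup>+y. \<Phi> y * ennreal (exp (t i * y - c * y\<^sup>2 / 2)) \<partial>lborel)"
    by (subst nn_integral_cmult[symmetric]) (auto simp: mult_ac)
  also have "\<dots> \<le> ennreal (exp (\<Sum>i\<in>I. (t i)\<^sup>2 / (2 * c))) *
     (ennreal (exp ((t i)\<^sup>2 / (2 * c))) * (\<integral>\<^sup>+y. \<Phi> y * ennreal (exp (- c * y\<^sup>2 / 2)) \<partial>lborel))"
    by (intro mult_left_mono nn_integral_even_unimodal_tilt anti c) auto
  also have "\<dots> = ennreal (exp (\<Sum>i\<in>insert i I. (t i)\<^sup>2 / (2 * c))) *
       (\<integral>\<^sup>+y. \<Phi> y * ennreal (exp (- c * y\<^sup>2 / 2)) \<partial>lborel)"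
    by (simp add: insert.hyps exp_add ennreal_mult' mult_ac)
  also have "(\<integral>\<^sup>+y. \<Phi> y * ennreal (exp (- c * y\<^sup>2 / 2)) \<partial>lborel) =
     (\<integral>\<^sup>+y. \<integral>\<^sup>+x. w (y\<^sup>2 + (\<Sum>i\<in>I. (x i)\<^sup>2)) * ennreal (exp (\<Sum>i\<in>I. - c * (x i)\<^sup>2 / 2))
        * ennreal (exp (- c * y\<^sup>2 / 2)) \<partial>Pi\<^sub>M I (\<lambda>_. lborel) \<partial>lborel)"
    unfolding \<Phi>_def by (intro nn_integral_cong nn_integral_multc[symmetric]) measurable
  also have "\<dots> = (\<integral>\<^sup>+x. w (\<Sum>i\<in>insert i I. (x i)\<^sup>2) * ennreal (exp (\<Sum>i\<in>insert i I. - c * (x i)\<^sup>2 / 2))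
           \<partial>Pi\<^sub>M (insert i I) (\<lambda>_. lborel))"
    by (subst lborel_product.product_nn_integral_insert_rev)
      (simp_all only: insert.hyps measurable_lborel1 sum_fun_upd_insert[OF insert.hyps, where F="\<lambda>j v. v\<^sup>2"]
       sum_fun_upd_insert[OF insert.hyps, where F="\<lambda>j v. - c * v\<^sup>2 / 2"] exp_add
       ennreal_mult'[OF exp_ge_zero] mult_ac, measurable)
  finally show ?case .
qed

text \<open>The factor may differ between coordinates because the cone estimate stretches only those
  in \<open>J\<close>. One coordinate is peeled off at a time, which reduces the claim to the affine
  substitution on the real line.\<close>

lemma nn_integral_scale_PiM:
  fixes c :: "'i \<Rightarrow> real"
  assumes "finite I" and "\<And>i. i \<in> I \<Longrightarrow> 0 < c i"
    and "f \<in> borel_measurable (Pi\<^sub>M I (\<lambda>_. lborel))"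
  shows "(\<integral>\<^sup>+x. f x \<partial>Pi\<^sub>M I (\<lambda>_. lborel)) =
     ennreal (\<Prod>i\<in>I. c i) * (\<integral>\<^sup>+x. f (\<lambda>i\<in>I. c i * x i) \<partial>Pi\<^sub>M I (\<lambda>_. lborel))"
  using assms
proof (induction I arbitrary: f rule: finite_induct)
  case empty
  show ?case by (simp add: PiM_empty nn_integral_count_space_finite)
next
  case (insert i I)
  note [measurable] = insert.prems(2)
  interpret I: sigma_finite_measure "Pi\<^sub>M I (\<lambda>_. lborel :: real measure)"
    by (rule lborel_product.sigma_finite) fact
  have ci: "c i > 0" using insert.prems(1) by auto
  have m1[measurable]: "(\<lambda>x. f (x(i := z))) \<in> borel_measurable (Pi\<^sub>M I (\<lambda>_. lborel))" for z :: real
    by (rule measurable_compose[OF measurable_fun_upd[where J=I] insert.prems(2)]) auto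
  have m2[measurable]: "(\<lambda>(y, x). f (x(i := y))) \<in> borel_measurable (lborel \<Otimes>\<^sub>M Pi\<^sub>M I (\<lambda>_. lborel))"
    unfolding split_beta' by (rule measurable_compose[OF measurable_fun_upd[where J=I] insert.prems(2)]) auto
  have "(\<integral>\<^sup>+x. f x \<partial>Pi\<^sub>M (insert i I) (\<lambda>_. lborel)) =
     (\<integral>\<^sup>+y. \<integral>\<^sup>+x. f (x(i := y)) \<partial>Pi\<^sub>M I (\<lambda>_. lborel) \<partial>lborel)"
    by (rule lborel_product.product_nn_integral_insert_rev) (use insert in auto)
  also have "\<dots> = (\<integral>\<^sup>+y. ennreal (\<Prod>i\<in>I. c i) *
      (\<integral>\<^sup>+x. f ((\<lambda>i\<in>I. c i * x i)(i := y)) \<partial>Pi\<^sub>M I (\<lambda>_. lborel)) \<partial>lborel)"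
    by (intro nn_integral_cong insert.IH m1) (use insert.prems in auto)
  also have "\<dots> = ennreal (c i) * (\<integral>\<^sup>+y. ennreal (\<Prod>i\<in>I. c i) *
      (\<integral>\<^sup>+x. f ((\<lambda>i\<in>I. c i * x i)(i := c i * y)) \<partial>Pi\<^sub>M I (\<lambda>_. lborel)) \<partial>lborel)"
  proof -
    have [measurable]: "(\<lambda>(y, x). f ((\<lambda>i\<in>I. c i * x i)(i := y))) \<in>
      borel_measurable (lborel \<Otimes>\<^sub>M Pi\<^sub>M I (\<lambda>_. lborel))"
      unfolding split_beta'
      by (rule measurable_compose[OF measurable_fun_upd[where J=I] insert.prems(2)]) auto
    have "(\<lambda>y. ennreal (\<Prod>i\<in>I. c i) *
      (\<integral>\<^sup>+x. f ((\<lambda>i\<in>I. c i * x i)(i := y)) \<partial>Pi\<^sub>M I (\<lambda>_. lborel))) \<in> borel_measurable borel"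
      by measurable
    from nn_integral_real_affine[OF this, of "c i" 0] ci show ?thesis by simp
  qed
  also have "\<dots> = ennreal (c i) * (ennreal (\<Prod>i\<in>I. c i) * (\<integral>\<^sup>+y.
      (\<integral>\<^sup>+x. f ((\<lambda>i\<in>I. c i * x i)(i := c i * y)) \<partial>Pi\<^sub>M I (\<lambda>_. lborel)) \<partial>lborel))"
  proof (subst nn_integral_cmult)
    have [measurable]: "(\<lambda>(y, x). f ((\<lambda>i\<in>I. c i * x i)(i := c i * y))) \<in>
      borel_measurable (lborel \<Otimes>\<^sub>M Pi\<^sub>M I (\<lambda>_. lborel))"
      unfolding split_beta'
      by (rule measurable_compose[OF measurable_fun_upd[where J=I] insert.prems(2)]) auto
    show "(\<lambda>y. \<integral>\<^sup>+x. f ((\<lambda>i\<in>I. c i * x i)(i := c i * y)) \<partial>Pi\<^sub>M I (\<lambda>_. lborel)) \<in> borel_measurable lborel"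
      by measurable
  qed simp
  also have "\<dots> = ennreal (\<Prod>i\<in>insert i I. c i) * (\<integral>\<^sup>+y.
      (\<integral>\<^sup>+x. f (\<lambda>j\<in>insert i I. c j * (x(i := y)) j) \<partial>Pi\<^sub>M I (\<lambda>_. lborel)) \<partial>lborel)"
  proof -
    have "(\<lambda>j\<in>insert i I. c j * (x(i := y)) j) = (\<lambda>i\<in>I. c i * x i)(i := c i * y)" for x y
      using insert.hyps by (auto simp: fun_eq_iff)
    thus ?thesis using insert.hyps ci by (simp add: ennreal_mult' mult.assoc)
  qed
  also have "(\<integral>\<^sup>+y. (\<integral>\<^sup>+x. f (\<lambda>j\<in>insert i I. c j * (x(i := y)) j) \<partial>Pi\<^sub>M I (\<lambda>_. lborel)) \<partial>lborel) =
      (\<integral>\<^sup>+x. f (\<lambda>j\<in>insert i I. c j * x j) \<partial>Pi\<^sub>M (insert i I) (\<lambda>_. lborel))"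
    by (rule lborel_product.product_nn_integral_insert_rev[symmetric]) (use insert.hyps in auto)
  finally show ?case .
qed

section \<open>Direction estimates by dilation\<close>

lemma prod_if_const:
  assumes "finite P" "J \<subseteq> P"
  shows "(\<Prod>i\<in>P. if i \<in> J then d else (1::real)) = d ^ card J"
proof -
  have "(\<Prod>i\<in>P. if i \<in> J then d else 1) = (\<Prod>i\<in>P \<inter> J. d)"
    by (rule prod.inter_restrict[OF assms(1), symmetric])
  thus ?thesis using assms(2) by (simp add: inf_absorb2)
qed

text \<open>Substitute \<open>d * x i\<close> for \<open>x i\<close>, \<open>i \<in> J\<close>. Where the image lies in the cone, this shortens the
  vector by a factor of at most \<open>sqrt (1 + card J / card P)\<close>, so monotonicity of \<open>f\<close> and a second
  dilation suffice: no polar coordinates are needed.\<close>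

lemma nn_integral_cone_le:
  fixes f :: "real \<Rightarrow> ennreal" and d :: real
  assumes P: "finite P" "P \<noteq> {}" and J: "J \<subseteq> P" and [measurable]: "f \<in> borel_measurable borel"
    and anti: "\<And>a b. 0 \<le> a \<Longrightarrow> a \<le> b \<Longrightarrow> f b \<le> f a" and d: "0 < d"
  defines "A \<equiv> {x. real (card P) * (\<Sum>i\<in>J. (x i)\<^sup>2) \<le> d\<^sup>2 * real (card J) * (\<Sum>i\<in>P. (x i)\<^sup>2)}"
  shows "(\<integral>\<^sup>+x. indicator A x * f (\<Sum>i\<in>P. (x i)\<^sup>2) \<partial>Pi\<^sub>M P (\<lambda>_. lborel))
    \<le> ennreal (d ^ card J * exp (card J / 2)) * (\<integral>\<^sup>+x. f (\<Sum>i\<in>P. (x i)\<^sup>2) \<partial>Pi\<^sub>M P (\<lambda>_. lborel))"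
proof -
  define p m where "p = real (card P)" and "m = real (card J)"
  have p: "p > 0" and m: "m \<ge> 0" using P by (auto simp: p_def m_def card_gt_0_iff)
  define s where "s = sqrt (1 + m / p)"
  have s: "s > 0" "s\<^sup>2 = 1 + m / p" using p m by (auto simp: s_def intro: add_pos_nonneg)
  define c where "c i = (if i \<in> J then d else 1)" for i
  have finJ: "finite J" using P J finite_subset by blast
  have [measurable]: "(\<lambda>x. \<Sum>i\<in>J. (x i :: real)\<^sup>2) \<in> borel_measurable (Pi\<^sub>M P (\<lambda>_. lborel))"
  proof (intro borel_measurable_sum)
    fix i assume "i \<in> J"
    hence "(\<lambda>x. x i) \<in> Pi\<^sub>M P (\<lambda>_. lborel :: real measure) \<rightarrow>\<^sub>M lborel"
      using J by (intro measurable_component_singleton) auto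
    hence [measurable]: "(\<lambda>x. x i :: real) \<in> borel_measurable (Pi\<^sub>M P (\<lambda>_. lborel))" by simp
    show "(\<lambda>x. (x i :: real)\<^sup>2) \<in> borel_measurable (Pi\<^sub>M P (\<lambda>_. lborel))" by measurable
  qed
  have "A \<inter> space (Pi\<^sub>M P (\<lambda>_. lborel :: real measure)) \<in> sets (Pi\<^sub>M P (\<lambda>_. lborel))"
  proof -
    have "{x \<in> space (Pi\<^sub>M P (\<lambda>_. lborel)). real (card P) * (\<Sum>i\<in>J. (x i)\<^sup>2) \<le> d\<^sup>2 * real (card J) * (\<Sum>i\<in>P. (x i :: real)\<^sup>2)}
       \<in> sets (Pi\<^sub>M P (\<lambda>_. lborel))" by measurable
    thus ?thesis by (simp add: A_def Int_def conj_commute)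
  qed
  hence [measurable]: "(indicator A :: _ \<Rightarrow> ennreal) \<in> borel_measurable (Pi\<^sub>M P (\<lambda>_. lborel))"
    by (simp add: borel_measurable_indicator_iff)
  have split: "(\<Sum>i\<in>P. g i) = (\<Sum>i\<in>J. g i) + (\<Sum>i\<in>P - J. g i)" for g :: "'a \<Rightarrow> real"
    using sum.subset_diff[OF J P(1)] by (simp add: add.commute)
  have "(\<integral>\<^sup>+x. indicator A x * f (\<Sum>i\<in>P. (x i)\<^sup>2) \<partial>Pi\<^sub>M P (\<lambda>_. lborel))
    = ennreal (d ^ card J) * (\<integral>\<^sup>+x. indicator A (\<lambda>i\<in>P. c i * x i) * f (\<Sum>i\<in>P. ((\<lambda>i\<in>P. c i * x i) i)\<^sup>2)
         \<partial>Pi\<^sub>M P (\<lambda>_. lborel))"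
    by (subst nn_integral_scale_PiM[of P c])
       (use P d in \<open>auto simp: c_def prod_if_const[OF P(1) J] cong: if_cong\<close>)
  also have "\<dots> \<le> ennreal (d ^ card J) * (\<integral>\<^sup>+x. f (\<Sum>i\<in>P. ((\<lambda>i\<in>P. (1/s) * x i) i)\<^sup>2) \<partial>Pi\<^sub>M P (\<lambda>_. lborel))"
  proof (intro mult_left_mono nn_integral_mono)
    fix x :: "'a \<Rightarrow> real"
    define a b where "a = (\<Sum>i\<in>J. (x i)\<^sup>2)" and "b = (\<Sum>i\<in>P-J. (x i)\<^sup>2)"
    have ab: "a \<ge> 0" "b \<ge> 0" by (auto simp: a_def b_def intro!: sum_nonneg)
    have J': "(\<Sum>i\<in>J. ((\<lambda>i\<in>P. c i * x i) i)\<^sup>2) = d\<^sup>2 * a"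
      unfolding a_def sum_distrib_left using J by (intro sum.cong) (auto simp: c_def power_mult_distrib)
    have PJ': "(\<Sum>i\<in>P-J. ((\<lambda>i\<in>P. c i * x i) i)\<^sup>2) = b"
      unfolding b_def by (intro sum.cong) (auto simp: c_def)
    have S': "(\<Sum>i\<in>P. ((\<lambda>i\<in>P. (1/s) * x i) i)\<^sup>2) = (a + b) / s\<^sup>2"
      unfolding a_def b_def split[symmetric] sum_divide_distrib
      by (intro sum.cong) (auto simp: power_divide)
    show "indicator A (\<lambda>i\<in>P. c i * x i) * f (\<Sum>i\<in>P. ((\<lambda>i\<in>P. c i * x i) i)\<^sup>2)
       \<le> f (\<Sum>i\<in>P. ((\<lambda>i\<in>P. (1/s) * x i) i)\<^sup>2)"
    proof (cases "(\<lambda>i\<in>P. c i * x i) \<in> A")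
      case True
      hence "p * (d\<^sup>2 * a) \<le> d\<^sup>2 * m * (d\<^sup>2 * a + b)"
        unfolding A_def mem_Collect_eq split J' PJ' p_def m_def .
      hence "d\<^sup>2 * (p * a) \<le> d\<^sup>2 * (m * (d\<^sup>2 * a + b))" by (simp add: mult_ac)
      hence "p * a \<le> m * (d\<^sup>2 * a + b)" using d by (subst (asm) mult_le_cancel_left_pos) auto
      hence "a \<le> m / p * (d\<^sup>2 * a + b)" using p by (simp add: field_simps)
      moreover have "0 \<le> d\<^sup>2 * a" using ab by simp
      ultimately have "a + b \<le> s\<^sup>2 * (d\<^sup>2 * a + b)" unfolding s by (simp add: algebra_simps)
      hence "(a + b) / s\<^sup>2 \<le> d\<^sup>2 * a + b" using s(1) by (simp add: field_simps)
      hence "f (d\<^sup>2 * a + b) \<le> f ((a + b) / s\<^sup>2)" using ab by (intro anti) auto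
      thus ?thesis using True unfolding S' split J' PJ' by simp
    qed simp
  qed simp
  also have "(\<integral>\<^sup>+x. f (\<Sum>i\<in>P. ((\<lambda>i\<in>P. (1/s) * x i) i)\<^sup>2) \<partial>Pi\<^sub>M P (\<lambda>_. lborel))
    = ennreal (s ^ card P) * (\<integral>\<^sup>+x. f (\<Sum>i\<in>P. (x i)\<^sup>2) \<partial>Pi\<^sub>M P (\<lambda>_. lborel))"
  proof -
    have "(\<integral>\<^sup>+x. f (\<Sum>i\<in>P. (x i)\<^sup>2) \<partial>Pi\<^sub>M P (\<lambda>_. lborel)) = ennreal ((1/s) ^ card P) *
       (\<integral>\<^sup>+x. f (\<Sum>i\<in>P. ((\<lambda>i\<in>P. (1/s) * x i) i)\<^sup>2) \<partial>Pi\<^sub>M P (\<lambda>_. lborel))"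
      by (subst nn_integral_scale_PiM[of P "\<lambda>_. 1/s"]) (use P s in auto)
    hence "ennreal (s ^ card P) * (\<integral>\<^sup>+x. f (\<Sum>i\<in>P. (x i)\<^sup>2) \<partial>Pi\<^sub>M P (\<lambda>_. lborel)) =
      ennreal (s ^ card P * (1/s) ^ card P) * (\<integral>\<^sup>+x. f (\<Sum>i\<in>P. ((\<lambda>i\<in>P. (1/s) * x i) i)\<^sup>2) \<partial>Pi\<^sub>M P (\<lambda>_. lborel))"
      using s by (subst ennreal_mult) (auto simp: mult.assoc)
    also have "s ^ card P * (1/s) ^ card P = 1" using s by (simp add: power_mult_distrib[symmetric])
    finally show ?thesis by simp
  qed
  also have "ennreal (d ^ card J) * (ennreal (s ^ card P) * (\<integral>\<^sup>+x. f (\<Sum>i\<in>P. (x i)\<^sup>2) \<partial>Pi\<^sub>M P (\<lambda>_. lborel)))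
    = ennreal (d ^ card J * s ^ card P) * (\<integral>\<^sup>+x. f (\<Sum>i\<in>P. (x i)\<^sup>2) \<partial>Pi\<^sub>M P (\<lambda>_. lborel))"
    using s d by (simp add: ennreal_mult mult.assoc)
  also have "\<dots> \<le> ennreal (d ^ card J * exp (card J / 2)) * (\<integral>\<^sup>+x. f (\<Sum>i\<in>P. (x i)\<^sup>2) \<partial>Pi\<^sub>M P (\<lambda>_. lborel))"
  proof (intro mult_right_mono ennreal_leI mult_left_mono)
    \<comment> \<open>The power (1 + m / p) ^ (p / 2) is at most exp (m / 2), so the cost of the
      second dilation is bounded independently of the dimension \<open>p\<close>.\<close>
    have "s\<^sup>2 \<le> (exp (m / (2 * p)))\<^sup>2"
      unfolding s using exp_ge_add_one_self[of "m/p"] by (simp add: exp_double[symmetric])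
    hence "s \<le> exp (m / (2 * p))" using s(1) by (simp add: power2_le_iff_abs_le)
    hence "s ^ card P \<le> exp (m / (2 * p)) ^ card P" using s(1) by (intro power_mono) auto
    also have "\<dots> = exp (m / 2)" using p by (simp add: exp_of_nat_mult[symmetric] p_def)
    finally show "s ^ card P \<le> exp (card J / 2)" by (simp add: m_def)
  qed (use d in auto)
  finally show ?thesis .
qed

lemma two_mult_le_exp: "2 * t \<le> exp (t::real)" if "0 \<le> t"
proof -
  have "1 + t + t\<^sup>2 / 2 \<le> exp t" using exp_lower_Taylor_quadratic[OF that] by simp
  moreover have "0 \<le> (t - 1)\<^sup>2" by simp
  ultimately show ?thesis by (simp add: power2_eq_square algebra_simps)
qed

section \<open>Convex radial potentials: growth of the profile and small norms\<close>

locale radial_density =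
  fixes P :: "'i set" and u u' :: "real \<Rightarrow> real"
  assumes P: "finite P" "P \<noteq> {}"
    and der: "\<And>s. (u has_real_derivative u' s) (at s)"
    and mono: "\<And>s t. 0 \<le> s \<Longrightarrow> s \<le> t \<Longrightarrow> u' s \<le> u' t"
    and pos: "\<And>s. 0 \<le> s \<Longrightarrow> 0 \<le> u' s"
    and total: "(\<integral>\<^sup>+x. ennreal (exp (- u (sqrt (\<Sum>i\<in>P. (x i)\<^sup>2)))) \<partial>Pi\<^sub>M P (\<lambda>_. lborel)) = 1"
begin

lemma profile_mono: "u s \<le> u t" if "0 \<le> s" "s \<le> t"
  by (rule DERIV_nonneg_imp_nondecreasing[OF that(2)]) (use that der pos in force)

lemma profile_measurable [measurable]: "u \<in> borel_measurable borel"
  using der by (intro borel_measurable_continuous_onI continuous_at_imp_continuous_on)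
    (auto intro: DERIV_isCont)

text \<open>If \<open>u\<close> grew faster, convexity would make the density decay so quickly beyond \<open>R\<close> that the
  substitution \<open>x = 2 y\<close> bounds the contribution of \<open>\<bar>x\<bar> > 2 R\<close> to the mean norm by \<open>R\<close>.\<close>

lemma profile_growth:
  assumes R: "0 < R" and large: "ennreal (3 * R) < (\<integral>\<^sup>+x. ennreal (sqrt (\<Sum>i\<in>P. (x i)\<^sup>2)) *
      ennreal (exp (- u (sqrt (\<Sum>i\<in>P. (x i)\<^sup>2)))) \<partial>Pi\<^sub>M P (\<lambda>_. lborel))"
  shows "u R - u 0 \<le> 2 * card P"
proof (rule ccontr)
  define N where "N x = sqrt (\<Sum>i\<in>P. (x i)\<^sup>2)" for x :: "'i \<Rightarrow> real"
  have [measurable]: "N \<in> borel_measurable (Pi\<^sub>M P (\<lambda>_. lborel))" unfolding N_def by measurable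
  have N0: "N x \<ge> 0" for x by (simp add: N_def sum_nonneg)
  let ?p = "real (card P)"
  have p: "card P \<ge> 1" using P by (simp add: Suc_le_eq card_gt_0_iff)
  assume "\<not> ?thesis"
  hence D: "2 * ?p < u R - u 0" by simp
  \<comment> \<open>The mean slope on (0, R) exceeds 2 * p / R; since \<open>u'\<close> is monotone,
    so does the slope everywhere beyond \<open>R\<close>.\<close>
  obtain \<eta> where \<eta>: "0 < \<eta>" "\<eta> < R" "u R - u 0 = R * u' \<eta>"
    using MVT2[OF R, of u u'] der by auto
  have grow: "u (2 * s) - u s \<ge> 2 * ?p * s / R" if s: "s \<ge> R" for s
  proof -
    obtain \<xi> where \<xi>: "s < \<xi>" "u (2 * s) - u s = (2 * s - s) * u' \<xi>"
      using MVT2[of s "2 * s" u u'] der s R by auto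
    have "2 * ?p / R \<le> u' \<eta>" using D \<eta> R by (simp add: field_simps)
    also have "u' \<eta> \<le> u' \<xi>" using \<xi> \<eta> s by (intro mono) auto
    finally have "s * (2 * ?p / R) \<le> s * u' \<xi>" using s R by (intro mult_left_mono) auto
    thus ?thesis using \<xi> by (simp add: mult_ac)
  qed
  \<comment> \<open>This compares the integrands after the substitution. Doubling the radius gains
    exp (- 2 * p * \<tau>): one half of the exponent pays for the Jacobian
    \<open>2 ^ card P\<close>, the other for the factor \<open>2 * \<tau>\<close> of the
    norm.\<close>
  have key: "2 ^ card P * (2 * s * exp (- u (2 * s))) \<le> R * exp (- u s)" if s: "s > R" for s
  proof -
    define \<tau> where "\<tau> = s / R"
    have \<tau>: "\<tau> \<ge> 1" "s = R * \<tau>" using s R by (auto simp: \<tau>_def)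
    have "(2::real) ^ card P \<le> exp 1 ^ card P"
      using exp_ge_add_one_self[of 1] by (intro power_mono) auto
    also have "\<dots> = exp ?p" by (simp add: exp_of_nat_mult[symmetric])
    also have "\<dots> \<le> exp (?p * \<tau>)" using \<tau> by (simp add: mult_le_cancel_left1)
    finally have 1: "2 ^ card P \<le> exp (?p * \<tau>)" .
    have "2 * \<tau> \<le> exp \<tau>" using \<tau> by (intro two_mult_le_exp) auto
    also have "\<dots> \<le> exp (?p * \<tau>)" using \<tau> p by (simp add: mult_le_cancel_right1)
    finally have 2: "2 * \<tau> \<le> exp (?p * \<tau>)" .
    have "u (2 * s) \<ge> u s + 2 * ?p * \<tau>" using grow[of s] s by (simp add: \<tau>_def)
    hence 3: "exp (- u (2 * s)) \<le> exp (- u s) * (exp (- (?p * \<tau>)) * exp (- (?p * \<tau>)))"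
      by (simp add: exp_add[symmetric] algebra_simps)
    have "2 ^ card P * (2 * \<tau> * exp (- u (2 * s))) \<le>
       exp (?p * \<tau>) * (exp (?p * \<tau>) * (exp (- u s) * (exp (- (?p * \<tau>)) * exp (- (?p * \<tau>)))))"
      using \<tau> by (intro mult_mono 1 2 3) auto
    also have "\<dots> = exp (- u s)" by (simp add: exp_add[symmetric])
    finally have "R * (2 ^ card P * (2 * \<tau> * exp (- u (2 * s)))) \<le> R * exp (- u s)"
      using R by (intro mult_left_mono) auto
    thus ?thesis using \<tau> by (simp add: mult_ac)
  qed
  let ?f = "\<lambda>x. ennreal (exp (- u (N x)))"
  define h where "h x = ennreal (N x) * ?f x * indicator {2 * R<..} (N x)" for x
  have [measurable]: "h \<in> borel_measurable (Pi\<^sub>M P (\<lambda>_. lborel))" unfolding h_def by measurable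
  have "(\<integral>\<^sup>+x. ennreal (N x) * ?f x \<partial>Pi\<^sub>M P (\<lambda>_. lborel)) \<le>
    (\<integral>\<^sup>+x. ennreal (2 * R) * ?f x + h x \<partial>Pi\<^sub>M P (\<lambda>_. lborel))"
    by (intro nn_integral_mono)
      (auto simp: h_def indicator_def not_less intro!: mult_right_mono ennreal_leI)
  also have "\<dots> = ennreal (2 * R) + (\<integral>\<^sup>+x. h x \<partial>Pi\<^sub>M P (\<lambda>_. lborel))"
    using total by (simp add: nn_integral_add nn_integral_cmult N_def)
  also have "(\<integral>\<^sup>+x. h x \<partial>Pi\<^sub>M P (\<lambda>_. lborel)) \<le> ennreal R"
  proof -
    have N2: "N (\<lambda>i\<in>P. 2 * x i) = 2 * N x" for x
    proof -
      have "(\<Sum>i\<in>P. ((\<lambda>i\<in>P. 2 * x i) i)\<^sup>2) = 2\<^sup>2 * (\<Sum>i\<in>P. (x i)\<^sup>2)"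
        unfolding sum_distrib_left by (intro sum.cong) (auto simp: power_mult_distrib)
      thus ?thesis unfolding N_def by (simp only: real_sqrt_mult real_sqrt_abs abs_numeral)
    qed
    have "(\<integral>\<^sup>+x. h x \<partial>Pi\<^sub>M P (\<lambda>_. lborel)) =
       ennreal (2 ^ card P) * (\<integral>\<^sup>+x. h (\<lambda>i\<in>P. 2 * x i) \<partial>Pi\<^sub>M P (\<lambda>_. lborel))"
      by (subst nn_integral_scale_PiM[of P "\<lambda>_. 2"]) (use P in auto)
    also have "\<dots> = (\<integral>\<^sup>+x. ennreal (2 ^ card P) * h (\<lambda>i\<in>P. 2 * x i) \<partial>Pi\<^sub>M P (\<lambda>_. lborel))"
    proof (rule nn_integral_cmult[symmetric])
      show "(\<lambda>x. h (\<lambda>i\<in>P. 2 * x i)) \<in> borel_measurable (Pi\<^sub>M P (\<lambda>_. lborel))"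
        unfolding h_def N2 by measurable
    qed
    also have "\<dots> \<le> (\<integral>\<^sup>+x. ennreal R * ?f x \<partial>Pi\<^sub>M P (\<lambda>_. lborel))"
    proof (intro nn_integral_mono)
      fix x
      show "ennreal (2 ^ card P) * h (\<lambda>i\<in>P. 2 * x i) \<le> ennreal R * ?f x"
      proof (cases "N x > R")
        case True
        have "ennreal (2 ^ card P) * h (\<lambda>i\<in>P. 2 * x i) = ennreal (2 ^ card P * (2 * N x * exp (- u (2 * N x))))"
          using True N0[of x] by (simp add: h_def N2 ennreal_mult)
        also have "\<dots> \<le> ennreal (R * exp (- u (N x)))" by (intro ennreal_leI key True)
        finally show ?thesis using R by (simp add: ennreal_mult)
      qed (simp add: h_def N2)
    qed
    also have "\<dots> = ennreal R" using total by (simp add: nn_integral_cmult N_def)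
    finally show ?thesis .
  qed
  also have "ennreal (2 * R) + ennreal R = ennreal (3 * R)" using R by (subst ennreal_plus[symmetric]) auto
  finally show False using large by (simp add: N_def add_left_mono)
qed

text \<open>Contraction by exp (-3) has Jacobian exp (-3 * p). Within radius \<open>R\<close> the
  growth bound lets the density vary by a factor of at most exp (2 * p), which leaves exp (-
  p).\<close>

lemma radius_small_ball:
  assumes R: "0 < R" and growth: "u R - u 0 \<le> 2 * card P"
  shows "(\<integral>\<^sup>+x. indicator {x. sqrt (\<Sum>i\<in>P. (x i)\<^sup>2) \<le> exp (-3) * R} x *
      ennreal (exp (- u (sqrt (\<Sum>i\<in>P. (x i)\<^sup>2)))) \<partial>Pi\<^sub>M P (\<lambda>_. lborel)) \<le> ennreal (exp (- real (card P)))"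
proof -
  define N where "N x = sqrt (\<Sum>i\<in>P. (x i)\<^sup>2)" for x :: "'i \<Rightarrow> real"
  have [measurable]: "N \<in> borel_measurable (Pi\<^sub>M P (\<lambda>_. lborel))" unfolding N_def by measurable
  have N0: "N x \<ge> 0" for x by (simp add: N_def sum_nonneg)
  define d :: real where "d = exp (-3)"
  have d: "0 < d" "d \<le> 1" by (auto simp: d_def)
  have N2: "N (\<lambda>i\<in>P. d * x i) = d * N x" for x
  proof -
    have "(\<Sum>i\<in>P. ((\<lambda>i\<in>P. d * x i) i)\<^sup>2) = d\<^sup>2 * (\<Sum>i\<in>P. (x i)\<^sup>2)"
      unfolding sum_distrib_left by (intro sum.cong) (auto simp: power_mult_distrib)
    thus ?thesis unfolding N_def using d by (simp only: real_sqrt_mult real_sqrt_abs abs_of_pos)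
  qed
  let ?f = "\<lambda>x. ennreal (exp (- u (N x)))"
  have "(\<integral>\<^sup>+x. indicator {x. N x \<le> d * R} x * ?f x \<partial>Pi\<^sub>M P (\<lambda>_. lborel)) =
     (\<integral>\<^sup>+x. indicator {..d * R} (N x) * ?f x \<partial>Pi\<^sub>M P (\<lambda>_. lborel))"
    by (intro nn_integral_cong) (simp add: indicator_def)
  also have "\<dots> =
    ennreal (d ^ card P) * (\<integral>\<^sup>+x. indicator {..d * R} (N (\<lambda>i\<in>P. d * x i)) * ?f (\<lambda>i\<in>P. d * x i) \<partial>Pi\<^sub>M P (\<lambda>_. lborel))"
    by (subst nn_integral_scale_PiM[of P "\<lambda>_. d"]) (use P d in auto)
  also have "\<dots> \<le> ennreal (d ^ card P) * (\<integral>\<^sup>+x. ennreal (exp (2 * card P)) * ?f x \<partial>Pi\<^sub>M P (\<lambda>_. lborel))"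
  proof (intro mult_left_mono nn_integral_mono)
    fix x
    show "indicator {..d * R} (N (\<lambda>i\<in>P. d * x i)) * ?f (\<lambda>i\<in>P. d * x i) \<le> ennreal (exp (2 * card P)) * ?f x"
    proof (cases "N x \<le> R")
      case True
      have "u (N x) \<le> u R" using True N0 by (intro profile_mono) auto
      moreover have "u 0 \<le> u (d * N x)" using d N0 by (intro profile_mono) auto
      ultimately have "exp (- u (d * N x)) \<le> exp (2 * card P + - u (N x))" using growth by simp
      hence "?f (\<lambda>i\<in>P. d * x i) \<le> ennreal (exp (2 * card P)) * ?f x"
        by (simp add: N2 ennreal_mult[symmetric] exp_add[symmetric])
      thus ?thesis by (auto simp: indicator_def)
    next
      case False
      thus ?thesis using d by (simp add: N2 indicator_def)
    qed
  qed simp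
  also have "\<dots> = ennreal (d ^ card P) * ennreal (exp (2 * card P))"
    using total by (simp add: nn_integral_cmult N_def)
  also have "\<dots> = ennreal (exp (- real (card P)))"
    by (simp add: d_def ennreal_mult[symmetric] exp_of_nat_mult[symmetric] exp_add[symmetric])
  finally show ?thesis by (simp add: N_def d_def)
qed

end

section \<open>Exponential moments and small balls of strongly log-concave radial laws\<close>

lemma sum_abs_le_sqrt_card:
  "(\<Sum>i\<in>I. \<bar>x i\<bar>) \<le> sqrt (card I) * sqrt (\<Sum>i\<in>I. (x i)\<^sup>2)" for x :: "'i \<Rightarrow> real"
  using L2_set_mult_ineq[of "\<lambda>_. 1" x I] by (simp add: L2_set_def)

text \<open>\<open>strong\<close> is a lower bound \<open>\<kappa>\<close> on the second derivative
  in integrated form, and \<open>der0\<close> is what evenness of the profile contributes. Functions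
  over \<open>P\<close> replace vectors so that Fubini arguments can proceed coordinate by
  coordinate.\<close>

locale strongly_log_concave_radial =
  fixes P :: "'i set" and u u' :: "real \<Rightarrow> real" and \<kappa> b :: real and \<rho> :: "('i \<Rightarrow> real) measure"
  assumes P: "finite P" "P \<noteq> {}" and \<kappa>: "0 < \<kappa>" and b: "0 < b"
    and der: "\<And>s. (u has_real_derivative u' s) (at s)"
    and strong: "\<And>s t. 0 \<le> s \<Longrightarrow> s \<le> t \<Longrightarrow> u' s + \<kappa> * (t - s) \<le> u' t"
    and der0: "u' 0 = 0"
    and \<rho>: "\<rho> = density (Pi\<^sub>M P (\<lambda>_. lborel)) (\<lambda>x. ennreal (exp (- u (sqrt (\<Sum>i\<in>P. (x i)\<^sup>2)))))"
    and total: "emeasure \<rho> (space \<rho>) = 1"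
    and first: "\<And>j. j \<in> P \<Longrightarrow> ennreal b \<le> (\<integral>\<^sup>+x. ennreal \<bar>x j\<bar> \<partial>\<rho>)"
begin

lemma mono: "0 \<le> s \<Longrightarrow> s \<le> t \<Longrightarrow> u' s \<le> u' t"
  using strong[of s t] \<kappa> mult_nonneg_nonneg[of \<kappa> "t - s"] by linarith

lemma pos: "0 \<le> s \<Longrightarrow> 0 \<le> u' s"
  using mono[of 0 s] der0 by auto

lemma total': "(\<integral>\<^sup>+x. ennreal (exp (- u (sqrt (\<Sum>i\<in>P. (x i)\<^sup>2)))) \<partial>Pi\<^sub>M P (\<lambda>_. lborel)) = 1"
proof -
  have [measurable]: "u \<in> borel_measurable borel"
    using der by (intro borel_measurable_continuous_onI continuous_at_imp_continuous_on)
      (auto intro: DERIV_isCont)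
  have "1 = (\<integral>\<^sup>+x. 1 \<partial>\<rho>)" using total by simp
  also have "\<dots> = (\<integral>\<^sup>+x. ennreal (exp (- u (sqrt (\<Sum>i\<in>P. (x i)\<^sup>2)))) \<partial>Pi\<^sub>M P (\<lambda>_. lborel))"
    unfolding \<rho> by (subst nn_integral_density) (simp_all, measurable)
  finally show ?thesis ..
qed

sublocale profile: radial_density P u u'
  by standard (fact P der mono pos total')+

lemmas [measurable] = profile.profile_measurable

lemma gaussian_part_mono:
  assumes "0 \<le> s" "s \<le> t"
  shows "u s - \<kappa> * s\<^sup>2 / 2 \<le> u t - \<kappa> * t\<^sup>2 / 2"
proof (rule DERIV_nonneg_imp_nondecreasing[OF assms(2)])
  fix x assume x: "s \<le> x" "x \<le> t"
  show "\<exists>y. ((\<lambda>s. u s - \<kappa> * s\<^sup>2 / 2) has_real_derivative y) (at x) \<and> 0 \<le> y"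
    using strong[of 0 x] x assms der0
    by (intro exI[of _ "u' x - \<kappa> * x"]) (auto intro!: derivative_eq_intros der)
qed

lemma nn_integral_\<rho>:
  assumes "f \<in> borel_measurable (Pi\<^sub>M P (\<lambda>_. lborel))"
  shows "(\<integral>\<^sup>+x. f x \<partial>\<rho>) = (\<integral>\<^sup>+x. f x * ennreal (exp (- u (sqrt (\<Sum>i\<in>P. (x i)\<^sup>2)))) \<partial>Pi\<^sub>M P (\<lambda>_. lborel))"
  unfolding \<rho> using assms by (subst nn_integral_density) (auto simp: mult.commute)

lemma exponential_moment:
  "(\<integral>\<^sup>+x. ennreal (exp (\<Sum>i\<in>P. t i * x i)) \<partial>\<rho>) \<le> ennreal (exp ((\<Sum>i\<in>P. (t i)\<^sup>2) / (2 * \<kappa>)))"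
proof -
  define w where "w r = ennreal (exp (\<kappa> * r / 2 - u (sqrt r)))" for r
  have [measurable]: "w \<in> borel_measurable borel" unfolding w_def by measurable
  have anti: "w s \<le> w r" if "0 \<le> r" "r \<le> s" for r s
    using gaussian_part_mono[of "sqrt r" "sqrt s"] that by (auto simp: w_def intro!: ennreal_leI)
  have 1: "ennreal (exp (\<Sum>i\<in>P. t i * x i)) * ennreal (exp (- u (sqrt (\<Sum>i\<in>P. (x i)\<^sup>2)))) =
    w (\<Sum>i\<in>P. (x i)\<^sup>2) * ennreal (exp (\<Sum>i\<in>P. t i * x i - \<kappa> * (x i)\<^sup>2 / 2))" for x t
    unfolding w_def
    by (simp add: ennreal_mult[symmetric] exp_add[symmetric] sum_subtractf sum_distrib_left sum_divide_distrib)
  have "(\<integral>\<^sup>+x. ennreal (exp (\<Sum>i\<in>P. t i * x i)) \<partial>\<rho>) =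
    (\<integral>\<^sup>+x. w (\<Sum>i\<in>P. (x i)\<^sup>2) * ennreal (exp (\<Sum>i\<in>P. t i * x i - \<kappa> * (x i)\<^sup>2 / 2)) \<partial>Pi\<^sub>M P (\<lambda>_. lborel))"
    by (subst nn_integral_\<rho>) (measurable, simp add: 1)
  also have "\<dots> \<le> ennreal (exp (\<Sum>i\<in>P. (t i)\<^sup>2 / (2 * \<kappa>))) *
      (\<integral>\<^sup>+x. w (\<Sum>i\<in>P. (x i)\<^sup>2) * ennreal (exp (\<Sum>i\<in>P. - \<kappa> * (x i)\<^sup>2 / 2)) \<partial>Pi\<^sub>M P (\<lambda>_. lborel))"
    by (intro nn_integral_radial_tilt P \<kappa> anti) auto
  \<comment> \<open>The factorization at t = 0 identifies this integral with the total mass.\<close>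
  also have "(\<integral>\<^sup>+x. w (\<Sum>i\<in>P. (x i)\<^sup>2) * ennreal (exp (\<Sum>i\<in>P. - \<kappa> * (x i)\<^sup>2 / 2)) \<partial>Pi\<^sub>M P (\<lambda>_. lborel)) = 1"
    using 1[of "\<lambda>_. 0"] total' by simp
  finally show ?thesis by (simp add: sum_divide_distrib)
qed

text \<open>There are two ways to be short on \<open>J\<close>: the whole vector has norm at most
  exp (-3) * R, or \<open>J\<close> carries at most the share exp (-3) * m / p of the squared norm.
  Each has probability at most exp (- m). Outside both, the squared norm on \<open>J\<close> is at
  least exp (-3) * (m / p) * exp (-6) * b^2 * p / 16.\<close>

lemma small_ball:
  assumes J: "J \<subseteq> P"
  shows "emeasure \<rho> {x \<in> space \<rho>. (\<Sum>i\<in>J. (x i)\<^sup>2) < exp (-9) * b\<^sup>2 / 16 * card J} \<le> ennreal (2 * exp (- real (card J)))"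
proof -
  define N where "N x = sqrt (\<Sum>i\<in>P. (x i)\<^sup>2)" for x :: "'i \<Rightarrow> real"
  have [measurable]: "N \<in> borel_measurable (Pi\<^sub>M P (\<lambda>_. lborel))" unfolding N_def by measurable
  have N2: "(N x)\<^sup>2 = (\<Sum>i\<in>P. (x i)\<^sup>2)" for x by (simp add: N_def sum_nonneg)
  have N0: "N x \<ge> 0" for x by (simp add: N_def sum_nonneg)
  define p m where "p = real (card P)" and "m = real (card J)"
  have p: "p > 0" using P by (auto simp: p_def card_gt_0_iff)
  have mp: "0 \<le> m" "m \<le> p" using J P by (auto simp: p_def m_def intro: card_mono)
  \<comment> \<open>Summing the first moments and applying Cauchy-Schwarz gives a mean norm of at
    least b * sqrt p; a quarter of it leaves the strict inequality 3 * R < b * sqrt p that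
    \<open>profile_growth\<close> asks for.\<close>
  define R where "R = b * sqrt p / 4"
  have R: "R > 0" using b p by (simp add: R_def)
  have "ennreal (p * b) \<le> (\<Sum>j\<in>P. ennreal b)" using b p by (simp add: p_def ennreal_mult ennreal_of_nat_eq_real_of_nat)
  also have "\<dots> \<le> (\<Sum>j\<in>P. \<integral>\<^sup>+x. ennreal \<bar>x j\<bar> \<partial>\<rho>)" by (intro sum_mono first)
  also have "\<dots> = (\<integral>\<^sup>+x. (\<Sum>j\<in>P. ennreal \<bar>x j\<bar>) \<partial>\<rho>)"
    by (subst nn_integral_sum) (auto simp: \<rho>)
  also have "\<dots> \<le> (\<integral>\<^sup>+x. ennreal (sqrt p) * ennreal (N x) \<partial>\<rho>)"
    unfolding p_def N_def using sum_abs_le_sqrt_card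
    by (intro nn_integral_mono) (auto simp: ennreal_mult[symmetric] sum_nonneg intro!: ennreal_leI)
  also have "\<dots> = ennreal (sqrt p) * (\<integral>\<^sup>+x. ennreal (N x) \<partial>\<rho>)"
    by (rule nn_integral_cmult) (auto simp: \<rho>)
  finally have *: "ennreal (sqrt p) * ennreal (sqrt p * b) \<le> ennreal (sqrt p) * (\<integral>\<^sup>+x. ennreal (N x) \<partial>\<rho>)"
    using p b by (simp add: ennreal_mult[symmetric] mult.assoc[symmetric])
  have "ennreal (3 * R) < ennreal (sqrt p * b)" using p b by (intro ennreal_lessI) (auto simp: R_def)
  also have "\<dots> \<le> (\<integral>\<^sup>+x. ennreal (N x) \<partial>\<rho>)"
    using * p by (subst (asm) ennreal_mult_le_mult_iff) auto
  also have "\<dots> = (\<integral>\<^sup>+x. ennreal (N x) * ennreal (exp (- u (N x))) \<partial>Pi\<^sub>M P (\<lambda>_. lborel))"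
    unfolding N_def by (intro nn_integral_\<rho>) measurable
  finally have "u R - u 0 \<le> 2 * card P"
    unfolding N_def by (rule profile.profile_growth[OF R])
  from profile.radius_small_ball[OF R this]
  have radius: "(\<integral>\<^sup>+x. indicator {x. N x \<le> exp (-3) * R} x * ennreal (exp (- u (N x))) \<partial>Pi\<^sub>M P (\<lambda>_. lborel))
    \<le> ennreal (exp (- m))"
    unfolding N_def using mp by - (erule order_trans, auto simp: m_def p_def intro!: ennreal_leI)
  \<comment> \<open>With this value the cone bound d ^ m * exp (m / 2) equals exp (- m).\<close>
  define d :: real where "d = exp (- 3 / 2)"
  have d2: "d\<^sup>2 = exp (-3)" by (simp add: d_def exp_double[symmetric])
  define A where "A = {x. p * (\<Sum>i\<in>J. (x i)\<^sup>2) \<le> d\<^sup>2 * m * (\<Sum>i\<in>P. (x i :: real)\<^sup>2)}"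
  have "(\<integral>\<^sup>+x. indicator A x * ennreal (exp (- u (N x))) \<partial>Pi\<^sub>M P (\<lambda>_. lborel))
    \<le> ennreal (d ^ card J * exp (card J / 2)) * (\<integral>\<^sup>+x. ennreal (exp (- u (N x))) \<partial>Pi\<^sub>M P (\<lambda>_. lborel))"
    unfolding A_def p_def m_def N_def
    by (rule nn_integral_cone_le[OF P J, where f="\<lambda>r. ennreal (exp (- u (sqrt r)))"])
      (auto simp: d_def intro!: ennreal_leI profile.profile_mono)
  also have "\<dots> = ennreal (exp (- m))"
    using total' by (simp add: N_def d_def m_def exp_of_nat_mult[symmetric] exp_add[symmetric])
  finally have cone: "(\<integral>\<^sup>+x. indicator A x * ennreal (exp (- u (N x))) \<partial>Pi\<^sub>M P (\<lambda>_. lborel)) \<le> ennreal (exp (- m))" .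
  let ?B = "{x \<in> space \<rho>. (\<Sum>i\<in>J. (x i)\<^sup>2) < exp (-9) * b\<^sup>2 / 16 * card J}"
  have cJ: "(\<lambda>x. x i) \<in> borel_measurable (Pi\<^sub>M P (\<lambda>_. lborel :: real measure))" if "i \<in> J" for i
  proof -
    have "(\<lambda>x. x i) \<in> Pi\<^sub>M P (\<lambda>_. lborel :: real measure) \<rightarrow>\<^sub>M lborel"
      using J that by (intro measurable_component_singleton) auto
    thus ?thesis by simp
  qed
  have [measurable]: "(\<lambda>x. \<Sum>i\<in>J. (x i :: real)\<^sup>2) \<in> borel_measurable (Pi\<^sub>M P (\<lambda>_. lborel))"
    by (intro borel_measurable_sum borel_measurable_power cJ)
  have [measurable]: "?B \<in> sets \<rho>" unfolding \<rho> by simp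
  have mA: "(indicator A :: _ \<Rightarrow> ennreal) \<in> borel_measurable (Pi\<^sub>M P (\<lambda>_. lborel))"
  proof -
    have "{x \<in> space (Pi\<^sub>M P (\<lambda>_. lborel)). p * (\<Sum>i\<in>J. (x i)\<^sup>2) \<le> d\<^sup>2 * m * (\<Sum>i\<in>P. (x i :: real)\<^sup>2)}
       \<in> sets (Pi\<^sub>M P (\<lambda>_. lborel))" by measurable
    thus ?thesis by (simp add: A_def Int_def conj_commute borel_measurable_indicator_iff)
  qed
  have mN: "(indicator {x. N x \<le> exp (-3) * R} :: _ \<Rightarrow> ennreal) \<in> borel_measurable (Pi\<^sub>M P (\<lambda>_. lborel))"
  proof -
    have "{x \<in> space (Pi\<^sub>M P (\<lambda>_. lborel)). N x \<le> exp (-3) * R} \<in> sets (Pi\<^sub>M P (\<lambda>_. lborel))" by measurable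
    thus ?thesis by (simp add: Int_def conj_commute borel_measurable_indicator_iff)
  qed
  have "emeasure \<rho> ?B = (\<integral>\<^sup>+x. indicator ?B x * ennreal (exp (- u (N x))) \<partial>Pi\<^sub>M P (\<lambda>_. lborel))"
  proof -
    have "emeasure \<rho> ?B = (\<integral>\<^sup>+x. indicator ?B x \<partial>\<rho>)"
      by (intro nn_integral_indicator[symmetric]) measurable
    also have "\<dots> = (\<integral>\<^sup>+x. indicator ?B x * ennreal (exp (- u (N x))) \<partial>Pi\<^sub>M P (\<lambda>_. lborel))"
      unfolding N_def by (intro nn_integral_\<rho> borel_measurable_indicator) (simp add: \<rho>)
    finally show ?thesis .
  qed
  also have "\<dots> \<le> (\<integral>\<^sup>+x. indicator {x. N x \<le> exp (-3) * R} x * ennreal (exp (- u (N x))) +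
      indicator A x * ennreal (exp (- u (N x))) \<partial>Pi\<^sub>M P (\<lambda>_. lborel))"
  proof (intro nn_integral_mono)
    fix x
    have "x \<in> A" if "(\<Sum>i\<in>J. (x i)\<^sup>2) < exp (-9) * b\<^sup>2 / 16 * card J" "exp (-3) * R < N x"
    proof -
      have "(exp (-3) * R)\<^sup>2 \<le> (N x)\<^sup>2" using that(2) R by (intro power_mono) auto
      hence "exp (-6) * (b\<^sup>2 * p / 16) \<le> (N x)\<^sup>2"
        using p by (simp add: R_def power_mult_distrib power_divide exp_double[symmetric])
      hence "d\<^sup>2 * m * (exp (-6) * (b\<^sup>2 * p / 16)) \<le> d\<^sup>2 * m * (N x)\<^sup>2" using mp by (intro mult_left_mono) auto
      moreover have "d\<^sup>2 * m * (exp (-6) * (b\<^sup>2 * p / 16)) = p * (exp (-9) * b\<^sup>2 / 16 * m)"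
      proof -
        have "d\<^sup>2 * exp (-6) = exp (-9)" by (simp add: d2 exp_add[symmetric])
        moreover have "d\<^sup>2 * m * (exp (-6) * (b\<^sup>2 * p / 16)) = (d\<^sup>2 * exp (-6)) * (m * (b\<^sup>2 * p / 16))"
          by (simp only: mult_ac)
        ultimately show ?thesis by simp
      qed
      moreover have "p * (\<Sum>i\<in>J. (x i)\<^sup>2) \<le> p * (exp (-9) * b\<^sup>2 / 16 * m)"
        using that(1) p by (intro mult_left_mono) (auto simp: m_def)
      ultimately show ?thesis unfolding A_def mem_Collect_eq N2[symmetric] by linarith
    qed
    thus "indicator ?B x * ennreal (exp (- u (N x))) \<le> indicator {x. N x \<le> exp (-3) * R} x * ennreal (exp (- u (N x))) +
      indicator A x * ennreal (exp (- u (N x)))" by (auto simp: indicator_def)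
  qed
  also have "\<dots> \<le> ennreal (exp (- m)) + ennreal (exp (- m))"
    using radius cone mA mN by (subst nn_integral_add) (auto intro!: add_mono)
  also have "\<dots> = ennreal (2 * exp (- m))" by (simp add: ennreal_plus[symmetric] del: ennreal_plus)
  finally show ?thesis by (simp add: m_def)
qed

end

section \<open>Nets of Euclidean balls and the operator norm\<close>

lemma sum_two_powr_neg_abs: "(\<Sum>k\<in>{-int B..int B}. (2::real) powr (- \<bar>real_of_int k\<bar>)) \<le> 4"
proof -
  have half: "(\<Sum>j\<le>B. (2::real) powr (- real j)) \<le> 2"
  proof -
    have "(\<Sum>j\<le>B. (2::real) powr (- real j)) = (\<Sum>j\<le>B. (1/2) ^ j)"
      by (intro sum.cong) (auto simp: powr_minus powr_realpow power_one_over inverse_eq_divide)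
    also have "\<dots> \<le> 2" using sum_gp0[of "1/2::real" B] by simp
    finally show ?thesis .
  qed
  \<comment> \<open>Zero lies in both halves, hence 4 where the full series has sum 3.\<close>
  have "{-int B..int B} \<subseteq> int ` {..B} \<union> (\<lambda>j. - int j) ` {..B}"
  proof
    fix k assume "k \<in> {-int B..int B}"
    thus "k \<in> int ` {..B} \<union> (\<lambda>j. - int j) ` {..B}"
      by (cases "k \<ge> 0") (auto intro: image_eqI[of _ _ "nat k"] image_eqI[of _ _ "nat (-k)"])
  qed
  hence "(\<Sum>k\<in>{-int B..int B}. (2::real) powr (- \<bar>real_of_int k\<bar>)) \<le>
     (\<Sum>k\<in>int ` {..B} \<union> (\<lambda>j. - int j) ` {..B}. (2::real) powr (- \<bar>real_of_int k\<bar>))"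
    by (intro sum_mono2) auto
  also have "\<dots> \<le> (\<Sum>k\<in>int ` {..B}. (2::real) powr (- \<bar>real_of_int k\<bar>))
     + (\<Sum>k\<in>(\<lambda>j. - int j) ` {..B}. (2::real) powr (- \<bar>real_of_int k\<bar>))"
    by (simp add: sum_Un sum_nonneg)
  also have "\<dots> = (\<Sum>j\<le>B. (2::real) powr (- real j)) + (\<Sum>j\<le>B. (2::real) powr (- real j))"
    by (subst (1 2) sum.reindex) (auto simp: inj_on_def)
  finally show ?thesis using half by simp
qed

text \<open>Counting by an exponential weight: at every counted point the product of the
  \<open>2 powr (L - \<bar>real_of_int (k i)\<bar>)\<close> is at least 1, and over the box the sum
  of these weights factorizes. The result is uniform in the box size \<open>B\<close>.\<close>

lemma card_lattice_points_le:
  fixes L :: real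
  assumes "finite I"
  shows "real (card {k \<in> Pi\<^sub>E I (\<lambda>_. {-int B..int B}). (\<Sum>i\<in>I. \<bar>real_of_int (k i)\<bar>) \<le> L * card I})
     \<le> (4 * 2 powr L) ^ card I"
proof -
  let ?box = "Pi\<^sub>E I (\<lambda>_. {-int B..int B})"
  let ?S = "{k \<in> ?box. (\<Sum>i\<in>I. \<bar>real_of_int (k i)\<bar>) \<le> L * card I}"
  have fin: "finite ?box" using assms by (intro finite_PiE) auto
  have "real (card ?S) = (\<Sum>k\<in>?S. 1)" by simp
  also have "\<dots> \<le> (\<Sum>k\<in>?S. \<Prod>i\<in>I. 2 powr (L - \<bar>real_of_int (k i)\<bar>))"
  proof (intro sum_mono)
    fix k assume "k \<in> ?S"
    hence "0 \<le> (\<Sum>i\<in>I. L - \<bar>real_of_int (k i)\<bar>)" by (simp add: sum_subtractf mult.commute)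
    hence "1 \<le> 2 powr (\<Sum>i\<in>I. L - \<bar>real_of_int (k i)\<bar>)" by (simp add: ge_one_powr_ge_zero)
    thus "1 \<le> (\<Prod>i\<in>I. 2 powr (L - \<bar>real_of_int (k i)\<bar>))" using assms by (simp add: powr_sum)
  qed
  also have "\<dots> \<le> (\<Sum>k\<in>?box. \<Prod>i\<in>I. 2 powr (L - \<bar>real_of_int (k i)\<bar>))"
    by (intro sum_mono2 fin) (auto intro!: prod_nonneg)
  also have "\<dots> = (\<Prod>i\<in>I. \<Sum>k\<in>{-int B..int B}. 2 powr (L - \<bar>real_of_int k\<bar>))"
    using assms by (subst prod_sum_PiE) auto
  also have "\<dots> = (2 powr L * (\<Sum>k\<in>{-int B..int B}. 2 powr (- \<bar>real_of_int k\<bar>))) ^ card I"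
    by (simp add: sum_distrib_left powr_add[symmetric])
  also have "\<dots> \<le> (2 powr L * 4) ^ card I"
    by (intro power_mono mult_left_mono sum_two_powr_neg_abs mult_nonneg_nonneg sum_nonneg) auto
  finally show ?thesis by (simp add: mult.commute)
qed

text \<open>Net points arise by rounding and may leave the unit ball, hence the radius
  \<open>1 + \<epsilon>\<close>.\<close>

definition is_net :: "real \<Rightarrow> 'i set \<Rightarrow> ('i \<Rightarrow> real) set \<Rightarrow> bool" where
  "is_net \<epsilon> I N \<longleftrightarrow> finite N \<and> (\<forall>x\<in>N. L2_set x I \<le> 1 + \<epsilon>) \<and>
     (\<forall>a. L2_set a I \<le> 1 \<longrightarrow> (\<exists>x\<in>N. L2_set (\<lambda>i. a i - x i) I \<le> \<epsilon>))"

text \<open>Rounding down on the grid of spacing \<open>\<epsilon> / sqrt n\<close> moves a point by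
  at most \<open>\<epsilon>\<close>. By Cauchy-Schwarz the integer coordinates of the rounded point
  have absolute sum at most n * (1 + \<epsilon>) / \<epsilon>; this constraint is what makes the
  count exponential in \<open>n\<close>, which the surrounding box of side proportional to
  \<open>n\<close> would not.\<close>

lemma net_exists:
  fixes \<epsilon> :: real
  assumes I: "finite I" "I \<noteq> {}" and \<epsilon>: "0 < \<epsilon>"
  shows "\<exists>N. is_net \<epsilon> I N \<and> real (card N) \<le> (4 * 2 powr ((1 + \<epsilon>) / \<epsilon>)) ^ card I"
proof -
  define n where "n = real (card I)"
  have n: "n > 0" using I by (simp add: n_def card_gt_0_iff)
  define L where "L = (1 + \<epsilon>) / \<epsilon>"
  define B where "B = nat \<lceil>L * n\<rceil>"
  define S where "S = {k \<in> Pi\<^sub>E I (\<lambda>_. {-int B..int B}). (\<Sum>i\<in>I. \<bar>real_of_int (k i)\<bar>) \<le> L * card I}"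
  define F where "F k i = \<epsilon> * real_of_int (k i) / sqrt n" for k :: "'a \<Rightarrow> int" and i
  define N where "N = {x \<in> F ` S. L2_set x I \<le> 1 + \<epsilon>}"
  have finS: "finite S"
    unfolding S_def by (rule finite_subset[OF _ finite_PiE[OF I(1), of "\<lambda>_. {-int B..int B}"]]) auto
  have "card N \<le> card S"
    unfolding N_def using finS by (intro order_trans[OF card_mono card_image_le]) auto
  hence "real (card N) \<le> (4 * 2 powr L) ^ card I"
    using card_lattice_points_le[OF I(1), of B L] by (simp add: S_def)
  moreover have "is_net \<epsilon> I N"
    unfolding is_net_def
  proof (intro conjI allI impI)
    show "finite N" using finS by (simp add: N_def)
    show "\<forall>x\<in>N. L2_set x I \<le> 1 + \<epsilon>" by (simp add: N_def)
    fix a assume a: "L2_set a I \<le> 1"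
    define k where "k = (\<lambda>i\<in>I. \<lfloor>a i * sqrt n / \<epsilon>\<rfloor>)"
    have close: "\<bar>a i - F k i\<bar> \<le> \<epsilon> / sqrt n" if "i \<in> I" for i
    proof -
      define y where "y = a i * sqrt n / \<epsilon>"
      have ai: "a i = \<epsilon> / sqrt n * y" using n \<epsilon> by (simp add: y_def)
      have "F k i = \<epsilon> / sqrt n * \<lfloor>y\<rfloor>" using that by (simp add: F_def k_def y_def)
      hence "a i - F k i = \<epsilon> / sqrt n * (y - \<lfloor>y\<rfloor>)" by (simp add: ai algebra_simps)
      moreover have "\<bar>y - \<lfloor>y\<rfloor>\<bar> \<le> 1" by linarith
      hence "\<epsilon> / sqrt n * \<bar>y - \<lfloor>y\<rfloor>\<bar> \<le> \<epsilon> / sqrt n * 1"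
        using \<epsilon> n by (intro mult_left_mono) auto
      ultimately show ?thesis using \<epsilon> n by (simp add: abs_mult)
    qed
    have "(\<Sum>i\<in>I. (a i - F k i)\<^sup>2) \<le> (\<Sum>i\<in>I. (\<epsilon> / sqrt n)\<^sup>2)"
      by (intro sum_mono abs_le_square_iff[THEN iffD1]) (use close \<epsilon> n in auto)
    also have "\<dots> = \<epsilon>\<^sup>2" using n by (simp add: n_def power_divide)
    finally have dist: "L2_set (\<lambda>i. a i - F k i) I \<le> \<epsilon>"
      unfolding L2_set_def using \<epsilon> by (intro real_le_lsqrt) (auto simp: sum_nonneg)
    have "L2_set (\<lambda>i. a i + (F k i - a i)) I \<le> L2_set a I + L2_set (\<lambda>i. F k i - a i) I"
      by (rule L2_set_triangle_ineq)
    moreover have "L2_set (\<lambda>i. F k i - a i) I = L2_set (\<lambda>i. a i - F k i) I"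
      by (simp add: L2_set_def power2_commute)
    ultimately have norm: "L2_set (F k) I \<le> 1 + \<epsilon>" using a dist by simp
    have "(\<Sum>i\<in>I. \<bar>F k i\<bar>) \<le> sqrt n * (1 + \<epsilon>)"
    proof -
      have "(\<Sum>i\<in>I. \<bar>F k i\<bar>) \<le> sqrt n * L2_set (F k) I"
        using L2_set_mult_ineq[of "\<lambda>_. 1" "F k" I] by (simp add: L2_set_def n_def)
      also have "\<dots> \<le> sqrt n * (1 + \<epsilon>)" using n by (intro mult_left_mono norm) auto
      finally show ?thesis .
    qed
    hence "sqrt n / \<epsilon> * (\<Sum>i\<in>I. \<bar>F k i\<bar>) \<le> sqrt n / \<epsilon> * (sqrt n * (1 + \<epsilon>))"
      using n \<epsilon> by (intro mult_left_mono) auto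
    also have "sqrt n / \<epsilon> * (sqrt n * (1 + \<epsilon>)) = L * n" using n by (simp add: L_def field_simps)
    also have "sqrt n / \<epsilon> * (\<Sum>i\<in>I. \<bar>F k i\<bar>) = (\<Sum>i\<in>I. \<bar>real_of_int (k i)\<bar>)"
      unfolding sum_distrib_left using n \<epsilon> by (intro sum.cong) (auto simp: F_def abs_mult)
    finally have bd: "(\<Sum>i\<in>I. \<bar>real_of_int (k i)\<bar>) \<le> L * n" .
    have "k i \<in> {-int B..int B}" if "i \<in> I" for i
    proof -
      have "\<bar>real_of_int (k i)\<bar> \<le> (\<Sum>i\<in>I. \<bar>real_of_int (k i)\<bar>)"
        using I that by (intro member_le_sum) auto
      with bd have "\<bar>real_of_int (k i)\<bar> \<le> L * n" by simp
      hence "\<bar>k i\<bar> \<le> \<lceil>L * n\<rceil>" by linarith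
      moreover have "0 \<le> \<lceil>L * n\<rceil>" using calculation abs_ge_zero[of "k i"] by linarith
      ultimately have "\<bar>k i\<bar> \<le> int B" by (simp add: B_def)
      thus ?thesis by auto
    qed
    hence "k \<in> S" using bd by (auto simp: S_def n_def k_def)
    hence "F k \<in> N" using norm by (simp add: N_def)
    thus "\<exists>x\<in>N. L2_set (\<lambda>i. a i - x i) I \<le> \<epsilon>" using dist by blast
  qed
  ultimately show ?thesis by (auto simp: L_def)
qed

section \<open>Operator norms from two nets\<close>

lemma L2_set_scale: "L2_set (\<lambda>i. c * f i) I = \<bar>c\<bar> * L2_set f I"
  by (simp add: L2_set_def power_mult_distrib sum_distrib_left[symmetric] real_sqrt_mult)

lemma L2_set_sq: "(L2_set f I)\<^sup>2 = (\<Sum>i\<in>I. (f i)\<^sup>2)"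
  by (simp add: L2_set_def sum_nonneg)

lemma L2_set_le_imp_abs: "finite I \<Longrightarrow> i \<in> I \<Longrightarrow> \<bar>f i\<bar> \<le> L2_set f I"
  using member_le_L2_set[of I i "\<lambda>i. \<bar>f i\<bar>"] by (simp add: L2_set_def)

text \<open>Replacing one argument after the other by a net point shows that the supremum q of the
  bilinear form over the unit balls satisfies q <= t + q / 4 + (5 / 4) * (1 / 4) * q = t + 9 / 16 *
  q, hence q <= 16 / 7 * t.\<close>

lemma operator_norm_le_net:
  fixes A :: "'i \<Rightarrow> 'j \<Rightarrow> real"
  assumes I: "finite I" "finite J" and NI: "is_net (1/4) I NI" and NJ: "is_net (1/4) J NJ"
    and t: "0 \<le> t" and le: "\<And>x y. x \<in> NI \<Longrightarrow> y \<in> NJ \<Longrightarrow> (\<Sum>i\<in>I. \<Sum>j\<in>J. x i * y j * A i j) \<le> t"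
  shows "L2_set (\<lambda>j. \<Sum>i\<in>I. a i * A i j) J \<le> 3 * t * L2_set a I"
proof -
  define B where "B a b = (\<Sum>i\<in>I. \<Sum>j\<in>J. a i * b j * A i j)" for a b
  define V where "V = {B a b |a b. L2_set a I \<le> 1 \<and> L2_set b J \<le> 1}"
  define q where "q = Sup V"
  \<comment> \<open>A crude bound that makes the supremum finite; otherwise q <= t + 9 / 16 * q
    could not be solved for q.\<close>
  have "B a b \<le> (\<Sum>i\<in>I. \<Sum>j\<in>J. \<bar>A i j\<bar>)" if "L2_set a I \<le> 1" "L2_set b J \<le> 1" for a b
    unfolding B_def
  proof (intro sum_mono)
    fix i j assume ij: "i \<in> I" "j \<in> J"
    have "\<bar>a i\<bar> \<le> 1" "\<bar>b j\<bar> \<le> 1"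
      using L2_set_le_imp_abs[OF I(1) ij(1), of a] L2_set_le_imp_abs[OF I(2) ij(2), of b] that by auto
    hence "\<bar>a i\<bar> * \<bar>b j\<bar> * \<bar>A i j\<bar> \<le> 1 * 1 * \<bar>A i j\<bar>" by (intro mult_mono) auto
    thus "a i * b j * A i j \<le> \<bar>A i j\<bar>" using abs_ge_self[of "a i * b j * A i j"] by (simp add: abs_mult)
  qed
  hence bdd: "bdd_above V" unfolding V_def by (intro bdd_aboveI) blast
  have q: "B a b \<le> q" if "L2_set a I \<le> 1" "L2_set b J \<le> 1" for a b
    unfolding q_def using that by (intro cSup_upper bdd) (auto simp: V_def)
  have q0: "0 \<le> q" using q[of "\<lambda>_. 0" "\<lambda>_. 0"] by (simp add: B_def L2_set_def)
  have hom: "B a b \<le> q * L2_set a I * L2_set b J" for a b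
  proof (cases "L2_set a I = 0 \<or> L2_set b J = 0")
    case True
    hence "(\<forall>i\<in>I. a i = 0) \<or> (\<forall>j\<in>J. b j = 0)" using I by (simp add: L2_set_eq_0_iff)
    hence "B a b = 0" by (auto simp: B_def)
    thus ?thesis using True by auto
  next
    case False
    define r s where "r = L2_set a I" and "s = L2_set b J"
    have rs: "r > 0" "s > 0" using False L2_set_nonneg[of a I] L2_set_nonneg[of b J]
      unfolding r_def s_def by linarith+
    have "B (\<lambda>i. (1/r) * a i) (\<lambda>j. (1/s) * b j) \<le> q"
      using rs by (intro q) (simp_all only: L2_set_scale r_def[symmetric] s_def[symmetric], simp_all)
    also have "B (\<lambda>i. (1/r) * a i) (\<lambda>j. (1/s) * b j) = (1 / (r * s)) * B a b"
      unfolding B_def sum_distrib_left by (intro sum.cong) (auto simp: field_simps)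
    finally show ?thesis using rs by (simp add: field_simps r_def s_def)
  qed
  have "q \<le> t + 9 / 16 * q"
    unfolding q_def
  proof (rule cSup_least)
    show "V \<noteq> {}" by (auto simp: V_def intro!: exI[of _ "\<lambda>_. 0"] simp: L2_set_def)
    fix v assume "v \<in> V"
    then obtain a b where ab: "v = B a b" "L2_set a I \<le> 1" "L2_set b J \<le> 1" by (auto simp: V_def)
    obtain x where x: "x \<in> NI" "L2_set (\<lambda>i. a i - x i) I \<le> 1/4" using NI ab by (auto simp: is_net_def)
    obtain y where y: "y \<in> NJ" "L2_set (\<lambda>i. b i - y i) J \<le> 1/4" using NJ ab by (auto simp: is_net_def)
    have nx: "L2_set x I \<le> 5/4" using NI x by (auto simp: is_net_def)
    have "B a b = B x y + B (\<lambda>i. a i - x i) b + B x (\<lambda>j. b j - y j)"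
      unfolding B_def sum.distrib[symmetric] by (intro sum.cong) (auto simp: algebra_simps)
    also have "B x y \<le> t" unfolding B_def by (rule le) fact+
    also have "B (\<lambda>i. a i - x i) b \<le> q * (1/4) * 1"
      using q0 x ab by (intro order_trans[OF hom] mult_mono) auto
    also have "B x (\<lambda>j. b j - y j) \<le> q * (5/4) * (1/4)"
      using q0 nx y by (intro order_trans[OF hom] mult_mono) auto
    finally show "v \<le> t + 9 / 16 * Sup V" using ab by (simp add: q_def)
  qed
  hence qt: "q \<le> 3 * t" using t by simp
  \<comment> \<open>Testing the form against the image itself and cancelling one factor of its norm
    turns the bilinear bound into a norm bound.\<close>
  define b where "b j = (\<Sum>i\<in>I. a i * A i j)" for j
  have "(L2_set b J)\<^sup>2 = (\<Sum>j\<in>J. \<Sum>i\<in>I. a i * b j * A i j)"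
  proof -
    have "(\<Sum>i\<in>I. a i * b j * A i j) = (b j)\<^sup>2" for j
    proof -
      have "(\<Sum>i\<in>I. a i * b j * A i j) = (\<Sum>i\<in>I. a i * A i j) * b j"
        unfolding sum_distrib_right by (intro sum.cong) auto
      thus ?thesis by (simp only: b_def power2_eq_square)
    qed
    thus ?thesis by (simp add: L2_set_sq)
  qed
  also have "\<dots> = B a b" unfolding B_def by (rule sum.swap)
  also have "\<dots> \<le> q * L2_set a I * L2_set b J" by (rule hom)
  also have "\<dots> \<le> 3 * t * L2_set a I * L2_set b J" using qt by (intro mult_right_mono) auto
  finally have *: "L2_set b J * L2_set b J \<le> (3 * t * L2_set a I) * L2_set b J" by (simp add: power2_eq_square)
  have "L2_set b J \<le> 3 * t * L2_set a I"
  proof (cases "L2_set b J = 0")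
    case True thus ?thesis using t by simp
  next
    case False
    hence "L2_set b J > 0" using L2_set_nonneg[of b J] by linarith
    thus ?thesis using * by simp
  qed
  thus ?thesis by (simp add: b_def[abs_def])
qed

section \<open>Singular values of matrices with independent subgaussian rows\<close>

lemma chernoff_bound:
  assumes [measurable]: "g \<in> borel_measurable M" and C: "0 \<le> C"
    and le: "(\<integral>\<^sup>+x. ennreal (exp (g x)) \<partial>M) \<le> ennreal C"
  shows "emeasure M {x \<in> space M. s \<le> g x} \<le> ennreal (C * exp (- s))"
proof -
  have "emeasure M {x \<in> space M. s \<le> g x} = (\<integral>\<^sup>+x. indicator {x \<in> space M. s \<le> g x} x \<partial>M)"
    by (intro nn_integral_indicator[symmetric]) measurable
  also have "\<dots> \<le> (\<integral>\<^sup>+x. ennreal (exp (g x)) * ennreal (exp (- s)) \<partial>M)"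
    by (intro nn_integral_mono)
      (auto simp: indicator_def ennreal_mult[symmetric] exp_add[symmetric] one_le_exp_iff)
  also have "\<dots> = (\<integral>\<^sup>+x. ennreal (exp (g x)) \<partial>M) * ennreal (exp (- s))"
    by (rule nn_integral_multc) measurable
  also have "\<dots> \<le> ennreal C * ennreal (exp (- s))" by (intro mult_right_mono le) auto
  finally show ?thesis using C by (simp add: ennreal_mult)
qed

lemma emeasure_UN_le:
  fixes e :: real
  assumes "finite I" "\<And>i. i \<in> I \<Longrightarrow> A i \<in> sets M" "\<And>i. i \<in> I \<Longrightarrow> emeasure M (A i) \<le> ennreal e"
    and "0 \<le> e"
  shows "emeasure M (\<Union>i\<in>I. A i) \<le> ennreal (card I * e)"
proof -
  have "emeasure M (\<Union>i\<in>I. A i) \<le> (\<Sum>i\<in>I. emeasure M (A i))"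
    by (rule emeasure_subadditive_finite) (use assms in auto)
  also have "\<dots> \<le> (\<Sum>i\<in>I. ennreal e)" by (intro sum_mono assms)
  also have "\<dots> = ennreal (card I * e)"
    using assms(4) by (simp add: ennreal_mult ennreal_of_nat_eq_real_of_nat)
  finally show ?thesis .
qed

text \<open>The off-diagonal products are ordered so that each term meets only the sum of the
  earlier ones, the form that a martingale argument needs.\<close>

lemma sum_square_partial_sums:
  fixes y :: "nat \<Rightarrow> real"
  shows "(\<Sum>i<n. y i)\<^sup>2 = (\<Sum>i<n. (y i)\<^sup>2) + 2 * (\<Sum>i<n. (\<Sum>l<i. y l) * y i)"
  by (induction n) (simp_all add: power2_eq_square algebra_simps)

text \<open>Here \<open>128\<close> is the base of the cardinality bound of a net of mesh \<open>1/4\<close>, and the factor \<open>3\<close>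
  the loss in passing from two such nets to the operator norm.\<close>

definition upper_const :: "real \<Rightarrow> real" where
  "upper_const \<kappa> = 3 * (2 / \<kappa> + 2 * ln 128 + 1)"

text \<open>The entry 1/2 keeps the net points near unit vectors at norm at least 1/2. The other
  entry lets the approximation error, \<open>upper_const\<close> times sqrt m times the mesh,
  consume at most half of the bound sqrt (\<delta> / 8) * sqrt m that holds on the net.\<close>

definition net_scale :: "real \<Rightarrow> real \<Rightarrow> real" where
  "net_scale \<kappa> \<delta> = min (1/2) (sqrt (\<delta> / 8) / (2 * upper_const \<kappa>))"

definition net_const :: "real \<Rightarrow> real \<Rightarrow> real" where
  "net_const \<kappa> \<delta> = 4 * 2 powr ((1 + net_scale \<kappa> \<delta>) / net_scale \<kappa> \<delta>)"

text \<open>The Chernoff exponent of \<open>cross_event_le\<close> has the optimal value - \<tau>^2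
  * \<kappa> / (8 * C). With \<tau> = \<delta> / 16 * m and C = 4 * m times the square of
  \<open>upper_const\<close>, this is - m times the present constant.\<close>

definition rate_const :: "real \<Rightarrow> real \<Rightarrow> real" where
  "rate_const \<kappa> \<delta> = (\<delta> / 16)\<^sup>2 * \<kappa> / (32 * (upper_const \<kappa>)\<^sup>2)"

text \<open>The aspect ratio beyond which the bound \<open>exp (- rate_const * card J)\<close> for a single net point
  survives the union bound over a net of mesh \<open>net_scale\<close>.\<close>

definition aspect_const :: "real \<Rightarrow> real \<Rightarrow> real" where
  "aspect_const \<kappa> \<delta> = max 4 ((ln (net_const \<kappa> \<delta>) + 2) / rate_const \<kappa> \<delta>)"

text \<open>A row keeps all its coordinates while the estimates concern those in \<open>J\<close>;
  this is why measurability is assumed coordinate by coordinate and the sigma-algebra is left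
  open.\<close>

locale subgaussian_vector = prob_space \<rho>
  for \<rho> :: "('j \<Rightarrow> real) measure" +
  fixes J :: "'j set" and \<kappa> \<delta> :: real
  assumes J: "finite J" "J \<noteq> {}" and \<kappa>: "0 < \<kappa>" and \<delta>: "0 < \<delta>"
    and coord: "\<And>j. j \<in> J \<Longrightarrow> (\<lambda>x. x j) \<in> borel_measurable \<rho>"
    and mgf: "\<And>t. (\<integral>\<^sup>+x. ennreal (exp (\<Sum>j\<in>J. t j * x j)) \<partial>\<rho>) \<le> ennreal (exp ((L2_set t J)\<^sup>2 / (2 * \<kappa>)))"
    and small: "emeasure \<rho> {x \<in> space \<rho>. (\<Sum>j\<in>J. (x j)\<^sup>2) < \<delta> * card J} \<le> ennreal (2 * exp (- real (card J)))"
begin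

sublocale rows: product_prob_space "\<lambda>_::nat. \<rho>" UNIV
  by unfold_locales

abbreviation \<Omega> :: "nat \<Rightarrow> (nat \<Rightarrow> 'j \<Rightarrow> real) measure" where
  "\<Omega> n \<equiv> Pi\<^sub>M {..<n} (\<lambda>_. \<rho>)"

lemma entry_measurable: "i < n \<Longrightarrow> j \<in> J \<Longrightarrow> (\<lambda>z. z i j) \<in> borel_measurable (\<Omega> n)"
  by (rule measurable_compose[of "\<lambda>z. z i" _ \<rho> "\<lambda>x. x j"])
    (auto intro: coord measurable_component_singleton)

lemma upper_const_pos: "0 < upper_const \<kappa>"
  using \<kappa> by (simp add: upper_const_def add_pos_pos)

lemma bilinear_mgf:
  "(\<integral>\<^sup>+z. ennreal (exp (\<Sum>i<n. \<Sum>j\<in>J. a i * b j * z i j)) \<partial>\<Omega> n)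
     \<le> ennreal (exp ((L2_set a {..<n} * L2_set b J)\<^sup>2 / (2 * \<kappa>)))"
proof -
  have "(\<integral>\<^sup>+z. ennreal (exp (\<Sum>i<n. \<Sum>j\<in>J. a i * b j * z i j)) \<partial>\<Omega> n)
    = (\<integral>\<^sup>+z. (\<Prod>i<n. ennreal (exp (\<Sum>j\<in>J. a i * b j * z i j))) \<partial>\<Omega> n)"
    by (simp add: exp_sum prod_ennreal)
  also have "\<dots> = (\<Prod>i<n. \<integral>\<^sup>+x. ennreal (exp (\<Sum>j\<in>J. a i * b j * x j)) \<partial>\<rho>)"
    using coord by (subst rows.product_nn_integral_prod) auto
  also have "\<dots> \<le> (\<Prod>i<n. ennreal (exp ((L2_set (\<lambda>j. a i * b j) J)\<^sup>2 / (2 * \<kappa>))))"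
    by (intro prod_mono_ennreal mgf)
  also have "\<dots> = ennreal (exp (\<Sum>i<n. (L2_set (\<lambda>j. a i * b j) J)\<^sup>2 / (2 * \<kappa>)))"
    by (simp add: exp_sum prod_ennreal)
  also have "(\<Sum>i<n. (L2_set (\<lambda>j. a i * b j) J)\<^sup>2 / (2 * \<kappa>)) = (L2_set a {..<n} * L2_set b J)\<^sup>2 / (2 * \<kappa>)"
    by (simp add: L2_set_scale power_mult_distrib sum_divide_distrib[symmetric] sum_distrib_right[symmetric] L2_set_sq)
  finally show ?thesis .
qed

lemma upper_event:
  assumes n: "0 < n" "n \<le> card J"
  shows "\<exists>B\<in>sets (\<Omega> n). emeasure (\<Omega> n) B \<le> ennreal (exp (- real (card J))) \<and>
    (\<forall>z\<in>space (\<Omega> n) - B. \<forall>a. L2_set (\<lambda>j. \<Sum>i<n. a i * z i j) J \<le>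
        upper_const \<kappa> * sqrt (card J) * L2_set a {..<n})"
proof -
  define m where "m = real (card J)"
  have m: "m > 0" using J by (simp add: m_def card_gt_0_iff)
  have exps: "(4::real) * 2 powr ((1 + 1/4) / (1/4)) = 128" by (simp add: powr_numeral)
  obtain NI where NI: "is_net (1/4) {..<n} NI" "real (card NI) \<le> 128 ^ n"
    using net_exists[of "{..<n}" "1/4"] n unfolding exps by auto
  obtain NJ where NJ: "is_net (1/4) J NJ" "real (card NJ) \<le> 128 ^ card J"
    using net_exists[of J "1/4"] J unfolding exps by auto
  \<comment> \<open>The term 2 / \<kappa> absorbs the moment generating function, 2 * ln 128 the two
    nets (as \<open>n \<le> card J\<close>), and 1 remains as the rate.\<close>
  define t where "t = 2 / \<kappa> + 2 * ln 128 + 1"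
  have t: "t > 0" using \<kappa> by (simp add: t_def add_pos_pos)
  \<comment> \<open>The row coefficients carry the Chernoff parameter sqrt m, so that exponent and
    threshold are both of order m.\<close>
  define E where "E xy = {z \<in> space (\<Omega> n). t * m \<le> (\<Sum>i<n. \<Sum>j\<in>J. (sqrt m * fst xy i) * snd xy j * z i j)}" for xy
  have meas: "(\<lambda>z. \<Sum>i<n. \<Sum>j\<in>J. a i * b j * z i j) \<in> borel_measurable (\<Omega> n)" for a b
    using entry_measurable by (intro borel_measurable_sum borel_measurable_times) auto
  have E: "E xy \<in> sets (\<Omega> n)" for xy unfolding E_def using meas by simp
  have prob: "emeasure (\<Omega> n) (E xy) \<le> ennreal (exp (2 * m / \<kappa> - t * m))" if xy_in: "xy \<in> NI \<times> NJ" for xy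
  proof -
    obtain x y where xy: "xy = (x, y)" "x \<in> NI" "y \<in> NJ" using xy_in by auto
    have "L2_set x {..<n} \<le> 5/4" "L2_set y J \<le> 5/4" using NI NJ xy by (auto simp: is_net_def)
    hence "L2_set x {..<n} * L2_set y J \<le> 5/4 * (5/4)" by (intro mult_mono) auto
    hence "(L2_set x {..<n} * L2_set y J)\<^sup>2 \<le> (5/4 * (5/4))\<^sup>2" by (intro power_mono) auto
    hence "(L2_set x {..<n} * L2_set y J)\<^sup>2 \<le> 4" by (simp add: power2_eq_square)
    hence "m * (L2_set x {..<n} * L2_set y J)\<^sup>2 \<le> m * 4" using m by (intro mult_left_mono) auto
    hence "(L2_set (\<lambda>i. sqrt m * x i) {..<n} * L2_set y J)\<^sup>2 \<le> m * 4"
      using m by (simp add: L2_set_scale power_mult_distrib)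
    hence "(L2_set (\<lambda>i. sqrt m * x i) {..<n} * L2_set y J)\<^sup>2 / (2 * \<kappa>) \<le> m * 4 / (2 * \<kappa>)"
      using \<kappa> by (intro divide_right_mono) auto
    hence "(L2_set (\<lambda>i. sqrt m * x i) {..<n} * L2_set y J)\<^sup>2 / (2 * \<kappa>) \<le> 2 * m / \<kappa>" by simp
    hence "(\<integral>\<^sup>+z. ennreal (exp (\<Sum>i<n. \<Sum>j\<in>J. (sqrt m * x i) * y j * z i j)) \<partial>\<Omega> n) \<le> ennreal (exp (2 * m / \<kappa>))"
      by (intro order_trans[OF bilinear_mgf] ennreal_leI) simp
    from chernoff_bound[OF meas _ this, of "t * m"] show ?thesis
      unfolding E_def by (simp add: xy exp_add[symmetric])
  qed
  define B where "B = (\<Union>xy\<in>NI \<times> NJ. E xy)"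
  have fin: "finite (NI \<times> NJ)" using NI NJ by (auto simp: is_net_def)
  have "emeasure (\<Omega> n) B \<le> ennreal (card (NI \<times> NJ) * exp (2 * m / \<kappa> - t * m))"
    unfolding B_def by (intro emeasure_UN_le fin E prob) auto
  also have "\<dots> \<le> ennreal (exp (- m))"
  proof (intro ennreal_leI)
    have "real (card (NI \<times> NJ)) \<le> 128 ^ n * 128 ^ card J"
      unfolding card_cartesian_product of_nat_mult using NI NJ by (intro mult_mono) auto
    also have "\<dots> \<le> 128 ^ card J * 128 ^ card J"
      using n by (intro mult_right_mono power_increasing) auto
    also have "\<dots> = exp (m * ln 128) * exp (m * ln 128)" by (simp add: m_def exp_of_nat_mult)
    finally have "real (card (NI \<times> NJ)) * exp (2 * m / \<kappa> - t * m) \<le>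
      exp (m * ln 128) * exp (m * ln 128) * exp (2 * m / \<kappa> - t * m)" by (intro mult_right_mono) auto
    also have "\<dots> = exp (- m)"
      unfolding exp_add[symmetric] t_def by (intro arg_cong[where f=exp]) (simp add: algebra_simps)
    finally show "real (card (NI \<times> NJ)) * exp (2 * m / \<kappa> - t * m) \<le> exp (- m)" .
  qed
  finally have "emeasure (\<Omega> n) B \<le> ennreal (exp (- m))" .
  moreover have "L2_set (\<lambda>j. \<Sum>i<n. a i * z i j) J \<le> upper_const \<kappa> * sqrt m * L2_set a {..<n}"
    if z: "z \<in> space (\<Omega> n) - B" for z a
  proof -
    have "L2_set (\<lambda>j. \<Sum>i<n. a i * z i j) J \<le> 3 * (t * sqrt m) * L2_set a {..<n}"
    proof (rule operator_norm_le_net[OF _ J(1) NI(1) NJ(1)])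
      fix x y assume "x \<in> NI" "y \<in> NJ"
      hence "z \<notin> E (x, y)" using z by (auto simp: B_def)
      hence "(\<Sum>i<n. \<Sum>j\<in>J. (sqrt m * x i) * y j * z i j) < t * m" using z by (auto simp: E_def)
      also have "(\<Sum>i<n. \<Sum>j\<in>J. (sqrt m * x i) * y j * z i j) = sqrt m * (\<Sum>i<n. \<Sum>j\<in>J. x i * y j * z i j)"
        by (simp add: sum_distrib_left mult_ac)
      also have "t * m = sqrt m * (t * sqrt m)" using m by simp
      finally show "(\<Sum>i<n. \<Sum>j\<in>J. x i * y j * z i j) \<le> t * sqrt m" using m by simp
    qed (use t m in auto)
    thus ?thesis by (simp only: upper_const_def t_def mult.assoc)
  qed
  ultimately show ?thesis using E fin
    by (intro bexI[of _ B]) (auto simp: B_def m_def intro!: sets.finite_UN)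
qed

lemma short_row_event:
  "\<exists>B\<in>sets (\<Omega> n). emeasure (\<Omega> n) B \<le> ennreal (n * (2 * exp (- real (card J)))) \<and>
    (\<forall>z\<in>space (\<Omega> n) - B. \<forall>i<n. \<delta> * card J \<le> (\<Sum>j\<in>J. (z i j)\<^sup>2))"
proof -
  define S where "S = {x \<in> space \<rho>. (\<Sum>j\<in>J. (x j)\<^sup>2) < \<delta> * card J}"
  have S: "S \<in> sets \<rho>" unfolding S_def using coord by measurable
  define E where "E i = (\<lambda>z. z i) -` S \<inter> space (\<Omega> n)" for i
  have E: "E i \<in> sets (\<Omega> n)" if "i < n" for i
    unfolding E_def using that S by (intro measurable_sets[OF measurable_component_singleton]) auto
  have prob: "emeasure (\<Omega> n) (E i) \<le> ennreal (2 * exp (- real (card J)))" if "i < n" for i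
  proof -
    interpret rn: product_prob_space "\<lambda>_::nat. \<rho>" "{..<n}" by unfold_locales
    have "emeasure (\<Omega> n) (E i) = emeasure (distr (\<Omega> n) \<rho> (\<lambda>z. z i)) S"
      unfolding E_def using that S by (intro emeasure_distr[symmetric] measurable_component_singleton) auto
    also have "distr (\<Omega> n) \<rho> (\<lambda>z. z i) = \<rho>" using rn.PiM_component[of i] that by simp
    finally show ?thesis using small by (simp add: S_def)
  qed
  have "emeasure (\<Omega> n) (\<Union>i\<in>{..<n}. E i) \<le> ennreal (card {..<n} * (2 * exp (- real (card J))))"
    by (intro emeasure_UN_le E prob) auto
  moreover have "\<delta> * card J \<le> (\<Sum>j\<in>J. (z i j)\<^sup>2)" if "z \<in> space (\<Omega> n) - (\<Union>i\<in>{..<n}. E i)" "i < n" for z i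
  proof -
    have "z i \<notin> S" using that by (auto simp: E_def)
    moreover have "z i \<in> space \<rho>" using that by (auto simp: space_PiM)
    ultimately show ?thesis by (simp add: S_def)
  qed
  ultimately show ?thesis using E by (intro bexI[of _ "\<Union>i\<in>{..<n}. E i"]) auto
qed

section \<open>The cross term of the squared norm\<close>

definition row_sum :: "(nat \<Rightarrow> real) \<Rightarrow> nat \<Rightarrow> (nat \<Rightarrow> 'j \<Rightarrow> real) \<Rightarrow> 'j \<Rightarrow> real" where
  "row_sum a i z j = (\<Sum>l<i. a l * z l j)"

text \<open>The compensator contains the cap \<open>C\<close> and not the random squared norm, so it
  is deterministic; the indicator annihilates the factor where \<open>C\<close> would be too small.
  The current row is a separate argument so that it can be integrated with the earlier rows held
  fixed.\<close>

definition truncated_factor :: "(nat \<Rightarrow> real) \<Rightarrow> real \<Rightarrow> real \<Rightarrow> nat \<Rightarrow> (nat \<Rightarrow> 'j \<Rightarrow> real) \<Rightarrow> ('j \<Rightarrow> real) \<Rightarrow> ennreal" where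
  "truncated_factor a C s i z y = indicator {..C} (\<Sum>j\<in>J. (row_sum a i z j)\<^sup>2) *
     ennreal (exp ((\<Sum>j\<in>J. (s * a i * row_sum a i z j) * y j) - (s * a i)\<^sup>2 * C / (2 * \<kappa>)))"

lemma row_sum_measurable: "i \<le> n \<Longrightarrow> j \<in> J \<Longrightarrow> (\<lambda>z. row_sum a i z j) \<in> borel_measurable (\<Omega> n)"
  unfolding row_sum_def using entry_measurable by (intro borel_measurable_sum borel_measurable_times) auto

lemma truncated_factor_measurable:
  assumes "i < n"
  shows "(\<lambda>z. truncated_factor a C s i z (z i)) \<in> borel_measurable (\<Omega> n)"
proof -
  have [measurable]: "(\<lambda>z. z i j) \<in> borel_measurable (\<Omega> n)" "(\<lambda>z. row_sum a i z j) \<in> borel_measurable (\<Omega> n)"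
    if "j \<in> J" for j using that assms entry_measurable row_sum_measurable by auto
  show ?thesis unfolding truncated_factor_def by measurable
qed

text \<open>Given the earlier rows, the cross term of the \<open>k\<close>-th row with their weighted sum is
  subgaussian, with a variance proxy controlled once that sum is truncated; hence the
  products below form a supermartingale in \<open>k\<close>.\<close>

lemma truncated_supermartingale:
  "(\<integral>\<^sup>+z. (\<Prod>i<k. truncated_factor a C s i z (z i)) \<partial>\<Omega> k) \<le> 1"
proof (induction k)
  case 0
  show ?case by (simp add: prob_space.emeasure_space_1 prob_space_PiM prob_space_axioms)
next
  case (Suc k)
  let ?G = "truncated_factor a C s" and ?S = "row_sum a"
  \<comment> \<open>\<open>row_sum\<close> stops before its index, so replacing row \<open>k\<close>
    affects no sum up to and including the one with index \<open>k\<close>.\<close>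
  have updS: "?S i (z(k := y)) = ?S i z" if "i \<le> k" for i z y
    using that by (auto simp: row_sum_def fun_eq_iff intro!: sum.cong)
  have inner: "(\<integral>\<^sup>+y. ?G k z y \<partial>\<rho>) \<le> 1" for z
  proof (cases "(\<Sum>j\<in>J. (?S k z j)\<^sup>2) \<le> C")
    case True
    define v where "v = (s * a k)\<^sup>2 * C / (2 * \<kappa>)"
    have "(\<integral>\<^sup>+y. ?G k z y \<partial>\<rho>) = (\<integral>\<^sup>+y. ennreal (exp (\<Sum>j\<in>J. (s * a k * ?S k z j) * y j)) * ennreal (exp (- v)) \<partial>\<rho>)"
      using True unfolding truncated_factor_def v_def[symmetric] by (simp add: ennreal_mult[symmetric] exp_add[symmetric])
    also have "\<dots> = (\<integral>\<^sup>+y. ennreal (exp (\<Sum>j\<in>J. (s * a k * ?S k z j) * y j)) \<partial>\<rho>) * ennreal (exp (- v))"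
      using coord by (intro nn_integral_multc) measurable
    also have "\<dots> \<le> ennreal (exp ((L2_set (\<lambda>j. s * a k * ?S k z j) J)\<^sup>2 / (2 * \<kappa>))) * ennreal (exp (- v))"
      by (intro mult_right_mono mgf) auto
    also have "(L2_set (\<lambda>j. s * a k * ?S k z j) J)\<^sup>2 = (s * a k)\<^sup>2 * (\<Sum>j\<in>J. (?S k z j)\<^sup>2)"
      by (simp add: L2_set_sq power_mult_distrib sum_distrib_left)
    also have "ennreal (exp ((s * a k)\<^sup>2 * (\<Sum>j\<in>J. (?S k z j)\<^sup>2) / (2 * \<kappa>))) * ennreal (exp (- v))
       = ennreal (exp ((s * a k)\<^sup>2 * (\<Sum>j\<in>J. (?S k z j)\<^sup>2) / (2 * \<kappa>) - v))"
      by (simp add: ennreal_mult[symmetric] exp_add[symmetric])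
    also have "\<dots> \<le> ennreal 1"
    proof (intro ennreal_leI)
      have "(s * a k)\<^sup>2 * (\<Sum>j\<in>J. (?S k z j)\<^sup>2) / (2 * \<kappa>) \<le> v"
        unfolding v_def using True \<kappa> by (intro divide_right_mono mult_left_mono) auto
      thus "exp ((s * a k)\<^sup>2 * (\<Sum>j\<in>J. (?S k z j)\<^sup>2) / (2 * \<kappa>) - v) \<le> 1" by simp
    qed
    finally show ?thesis by simp
  qed (simp add: truncated_factor_def)
  have meas: "(\<lambda>z. \<Prod>i<Suc k. ?G i z (z i)) \<in> borel_measurable (\<Omega> (Suc k))"
    by (intro borel_measurable_prod_ennreal truncated_factor_measurable) auto
  have "(\<integral>\<^sup>+z. (\<Prod>i<Suc k. ?G i z (z i)) \<partial>\<Omega> (Suc k)) =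
     (\<integral>\<^sup>+z. \<integral>\<^sup>+y. (\<Prod>i<Suc k. ?G i (z(k := y)) ((z(k := y)) i)) \<partial>\<rho> \<partial>\<Omega> k)"
    using rows.product_nn_integral_insert[of "{..<k}" k "\<lambda>z. \<Prod>i<Suc k. ?G i z (z i)"] meas
    by (simp add: lessThan_Suc[symmetric] del: prod.lessThan_Suc fun_upd_apply)
  also have "\<dots> = (\<integral>\<^sup>+z. (\<Prod>i<k. ?G i z (z i)) * (\<integral>\<^sup>+y. ?G k z y \<partial>\<rho>) \<partial>\<Omega> k)"
  proof (rule nn_integral_cong)
    fix z
    have "(\<Prod>i<k. ?G i (z(k := y)) ((z(k := y)) i)) = (\<Prod>i<k. ?G i z (z i))" for y
      by (intro prod.cong) (simp_all add: truncated_factor_def updS)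
    moreover have "?G k (z(k := y)) ((z(k := y)) k) = ?G k z y" for y
      by (simp add: truncated_factor_def updS)
    ultimately have "(\<integral>\<^sup>+y. (\<Prod>i<Suc k. ?G i (z(k := y)) ((z(k := y)) i)) \<partial>\<rho>) =
       (\<integral>\<^sup>+y. (\<Prod>i<k. ?G i z (z i)) * ?G k z y \<partial>\<rho>)" by (simp only: prod.lessThan_Suc)
    also have "\<dots> = (\<Prod>i<k. ?G i z (z i)) * (\<integral>\<^sup>+y. ?G k z y \<partial>\<rho>)"
    proof (rule nn_integral_cmult)
      have [measurable]: "(\<lambda>y. y j) \<in> borel_measurable \<rho>" if "j \<in> J" for j using that by (rule coord)
      show "?G k z \<in> borel_measurable \<rho>" unfolding truncated_factor_def[abs_def] by measurable
    qed
    finally show "(\<integral>\<^sup>+y. (\<Prod>i<Suc k. ?G i (z(k := y)) ((z(k := y)) i)) \<partial>\<rho>) =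
       (\<Prod>i<k. ?G i z (z i)) * (\<integral>\<^sup>+y. ?G k z y \<partial>\<rho>)" .
  qed
  also have "\<dots> \<le> (\<integral>\<^sup>+z. (\<Prod>i<k. ?G i z (z i)) * 1 \<partial>\<Omega> k)"
    by (intro nn_integral_mono mult_left_mono inner) auto
  also have "\<dots> \<le> 1" using Suc by simp
  finally show ?case .
qed

text \<open>With the cap inside the event, its probability can be bounded by the supermartingale
  alone; the cap is verified later, outside the exceptional set of
  \<open>upper_event\<close>.\<close>

definition cross_event :: "nat \<Rightarrow> (nat \<Rightarrow> real) \<Rightarrow> real \<Rightarrow> real \<Rightarrow> (nat \<Rightarrow> 'j \<Rightarrow> real) set" where
  "cross_event n a C \<tau> = {z \<in> space (\<Omega> n). (\<forall>i<n. (\<Sum>j\<in>J. (row_sum a i z j)\<^sup>2) \<le> C) \<and>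
      (\<Sum>i<n. \<Sum>j\<in>J. a i * row_sum a i z j * z i j) \<le> - \<tau>}"

lemma cross_event_sets: "cross_event n a C \<tau> \<in> sets (\<Omega> n)"
proof -
  have [measurable]: "(\<lambda>z. z i j) \<in> borel_measurable (\<Omega> n)" "(\<lambda>z. row_sum a i z j) \<in> borel_measurable (\<Omega> n)"
    if "i \<in> {..<n}" "j \<in> J" for i j using that entry_measurable row_sum_measurable by auto
  have "{z \<in> space (\<Omega> n). (\<forall>i\<in>{..<n}. (\<Sum>j\<in>J. (row_sum a i z j)\<^sup>2) \<le> C) \<and>
      (\<Sum>i\<in>{..<n}. \<Sum>j\<in>J. a i * row_sum a i z j * z i j) \<le> - \<tau>} \<in> sets (\<Omega> n)"
    by measurable
  thus ?thesis by (simp add: cross_event_def)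
qed

text \<open>Markov's inequality for the truncated product with tilt \<open>- s\<close>. On the event
  all indicators equal 1, and since the squares of the coefficients sum to at most 4, the total
  compensator is at most 2 * s^2 * C / \<kappa>.\<close>

lemma cross_event_le:
  assumes a: "L2_set a {..<n} \<le> 2" and C: "0 \<le> C" and s: "0 \<le> s"
  shows "emeasure (\<Omega> n) (cross_event n a C \<tau>) \<le> ennreal (exp (2 * s\<^sup>2 * C / \<kappa> - s * \<tau>))"
proof -
  let ?G = "truncated_factor a C (- s)" and ?c = "exp (2 * s\<^sup>2 * C / \<kappa> - s * \<tau>)"
  have "(L2_set a {..<n})\<^sup>2 \<le> 2\<^sup>2" using a by (intro power_mono) auto
  hence a2: "(\<Sum>i<n. (a i)\<^sup>2) \<le> 4" by (simp add: L2_set_sq)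
  have meas: "(\<lambda>z. \<Prod>i<n. ?G i z (z i)) \<in> borel_measurable (\<Omega> n)"
    by (intro borel_measurable_prod_ennreal truncated_factor_measurable) auto
  have "emeasure (\<Omega> n) (cross_event n a C \<tau>) = (\<integral>\<^sup>+z. indicator (cross_event n a C \<tau>) z \<partial>\<Omega> n)"
    by (intro nn_integral_indicator[symmetric] cross_event_sets)
  also have "\<dots> \<le> (\<integral>\<^sup>+z. (\<Prod>i<n. ?G i z (z i)) * ennreal ?c \<partial>\<Omega> n)"
  proof (intro nn_integral_mono)
    fix z
    show "indicator (cross_event n a C \<tau>) z \<le> (\<Prod>i<n. ?G i z (z i)) * ennreal ?c"
    proof (cases "z \<in> cross_event n a C \<tau>")
      case True
      hence cap: "\<forall>i<n. (\<Sum>j\<in>J. (row_sum a i z j)\<^sup>2) \<le> C"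
        and T: "(\<Sum>i<n. \<Sum>j\<in>J. a i * row_sum a i z j * z i j) \<le> - \<tau>"
        by (auto simp: cross_event_def)
      have "(\<Prod>i<n. ?G i z (z i)) = (\<Prod>i<n. ennreal (exp ((\<Sum>j\<in>J. (- s * a i * row_sum a i z j) * z i j)
          - (- s * a i)\<^sup>2 * C / (2 * \<kappa>))))"
        by (intro prod.cong) (use cap in \<open>auto simp: truncated_factor_def\<close>)
      also have "\<dots> = ennreal (exp (\<Sum>i<n. (\<Sum>j\<in>J. (- s * a i * row_sum a i z j) * z i j)
          - (- s * a i)\<^sup>2 * C / (2 * \<kappa>)))" by (simp add: exp_sum prod_ennreal)
      also have "(\<Sum>i<n. (\<Sum>j\<in>J. (- s * a i * row_sum a i z j) * z i j) - (- s * a i)\<^sup>2 * C / (2 * \<kappa>))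
         = - s * (\<Sum>i<n. \<Sum>j\<in>J. a i * row_sum a i z j * z i j) - s\<^sup>2 * C / (2 * \<kappa>) * (\<Sum>i<n. (a i)\<^sup>2)"
        by (simp add: sum_subtractf sum_distrib_left sum_distrib_right sum_divide_distrib sum_negf power_mult_distrib mult_ac)
      finally have eq: "(\<Prod>i<n. ?G i z (z i)) * ennreal ?c = ennreal (exp (- s * (\<Sum>i<n. \<Sum>j\<in>J. a i * row_sum a i z j * z i j)
          - s\<^sup>2 * C / (2 * \<kappa>) * (\<Sum>i<n. (a i)\<^sup>2) + (2 * s\<^sup>2 * C / \<kappa> - s * \<tau>)))"
        by (simp only: ennreal_mult[symmetric] exp_ge_zero exp_add)
      have b1: "s * \<tau> \<le> s * (- (\<Sum>i<n. \<Sum>j\<in>J. a i * row_sum a i z j * z i j))"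
        using T s by (intro mult_left_mono) auto
      have b2: "s\<^sup>2 * C / (2 * \<kappa>) * (\<Sum>i<n. (a i)\<^sup>2) \<le> s\<^sup>2 * C / (2 * \<kappa>) * 4"
        using C \<kappa> by (intro mult_left_mono a2) auto
      have b3: "s\<^sup>2 * C / (2 * \<kappa>) * 4 = 2 * s\<^sup>2 * C / \<kappa>" by simp
      have "0 \<le> - s * (\<Sum>i<n. \<Sum>j\<in>J. a i * row_sum a i z j * z i j)
          - s\<^sup>2 * C / (2 * \<kappa>) * (\<Sum>i<n. (a i)\<^sup>2) + (2 * s\<^sup>2 * C / \<kappa> - s * \<tau>)"
      proof -
        have "0 \<le> - s * X - q * w + (r - t)" if "t \<le> s * (- X)" "q * w \<le> q * 4" "q * 4 = r" for X q w r t :: real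
          using that by simp
        from this[OF b1 b2 b3] show ?thesis .
      qed
      hence "1 \<le> (\<Prod>i<n. ?G i z (z i)) * ennreal ?c"
        unfolding eq by (subst ennreal_ge_1) (simp only: one_le_exp_iff)
      thus ?thesis using True by simp
    qed simp
  qed
  also have "\<dots> = (\<integral>\<^sup>+z. (\<Prod>i<n. ?G i z (z i)) \<partial>\<Omega> n) * ennreal ?c"
    by (rule nn_integral_multc) (rule meas)
  also have "\<dots> \<le> 1 * ennreal ?c" by (intro mult_right_mono truncated_supermartingale) auto
  finally show ?thesis by simp
qed

text \<open>At net points of norm at least 1/2 the diagonal part is at least \<delta> * m / 4 and
  twice the cross term exceeds - \<delta> * m / 8, so the image has norm at least sqrt (\<delta> * m
  / 8). Passing to all unit vectors costs half of this, whence \<delta> / 32.\<close>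

lemma extreme_singular_values:
  assumes n: "0 < n" and large: "aspect_const \<kappa> \<delta> * n < card J"
  shows "\<exists>B\<in>sets (\<Omega> n). emeasure (\<Omega> n) B \<le> ennreal (exp (- real n)) \<and>
    (\<forall>z\<in>space (\<Omega> n) - B. \<forall>a. sqrt (\<delta> / 32 * card J) * L2_set a {..<n} \<le> L2_set (\<lambda>j. \<Sum>i<n. a i * z i j) J \<and>
      L2_set (\<lambda>j. \<Sum>i<n. a i * z i j) J \<le> upper_const \<kappa> * sqrt (card J) * L2_set a {..<n})"
proof -
  define m \<beta> \<epsilon> K r where "m = real (card J)" and "\<beta> = upper_const \<kappa>" and "\<epsilon> = net_scale \<kappa> \<delta>"
    and "K = net_const \<kappa> \<delta>" and "r = rate_const \<kappa> \<delta>"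
  have \<beta>: "\<beta> > 0" using upper_const_pos by (simp add: \<beta>_def)
  have \<epsilon>: "0 < \<epsilon>" "\<epsilon> \<le> 1/2" "\<epsilon> \<le> sqrt (\<delta> / 8) / (2 * \<beta>)"
    using \<delta> \<beta> by (auto simp: \<epsilon>_def net_scale_def \<beta>_def)
  have r: "r > 0" using \<delta> \<kappa> \<beta> by (simp add: r_def rate_const_def \<beta>_def)
  have K: "K > 1"
  proof -
    have "1 \<le> 2 powr ((1 + \<epsilon>) / \<epsilon>)" using \<epsilon> by (intro ge_one_powr_ge_zero) auto
    thus ?thesis by (simp add: K_def net_const_def \<epsilon>_def)
  qed
  have "4 * real n \<le> aspect_const \<kappa> \<delta> * n" "((ln K + 2) / r) * n \<le> aspect_const \<kappa> \<delta> * n"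
    unfolding aspect_const_def K_def r_def by (rule mult_right_mono; simp)+
  hence m4: "4 * real n \<le> m" and mr: "((ln K + 2) / r) * n \<le> m" using large by (auto simp: m_def)
  hence nm: "n \<le> card J" and m: "m > 0" using n by (auto simp: m_def)
  obtain B1 where B1: "B1 \<in> sets (\<Omega> n)" "emeasure (\<Omega> n) B1 \<le> ennreal (exp (- m))"
    and up: "\<And>z a. z \<in> space (\<Omega> n) - B1 \<Longrightarrow> L2_set (\<lambda>j. \<Sum>i<n. a i * z i j) J \<le> \<beta> * sqrt m * L2_set a {..<n}"
    using upper_event[OF n nm] unfolding m_def \<beta>_def by blast
  obtain B2 where B2: "B2 \<in> sets (\<Omega> n)" "emeasure (\<Omega> n) B2 \<le> ennreal (n * (2 * exp (- m)))"
    and rowlen: "\<And>z i. z \<in> space (\<Omega> n) - B2 \<Longrightarrow> i < n \<Longrightarrow> \<delta> * m \<le> (\<Sum>j\<in>J. (z i j)\<^sup>2)"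
    using short_row_event[of n] unfolding m_def by blast
  obtain N where N: "is_net \<epsilon> {..<n} N" "real (card N) \<le> K ^ n"
    using net_exists[of "{..<n}" \<epsilon>] n \<epsilon> by (auto simp: K_def net_const_def \<epsilon>_def)
  have finN: "finite N" using N by (simp add: is_net_def)
  \<comment> \<open>Net points have norm at most 2, so partial sums of rows have norm at most 2 *
    \<beta> * sqrt m.\<close>
  define C where "C = 4 * \<beta>\<^sup>2 * m"
  have "0 \<le> C" using m by (simp add: C_def)
  \<comment> \<open>The minimizer \<tau> * \<kappa> / (4 * C) of the Chernoff exponent.\<close>
  define s where "s = \<delta> / 16 * \<kappa> / (16 * \<beta>\<^sup>2)"
  have s: "s \<ge> 0" using \<delta> \<kappa> by (simp add: s_def)
  define \<tau> where "\<tau> = \<delta> / 16 * m"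
  have expo: "2 * s\<^sup>2 * C / \<kappa> - s * \<tau> = - (r * m)"
    using \<beta> \<kappa> by (simp add: s_def C_def \<tau>_def r_def rate_const_def \<beta>_def[symmetric] field_simps power2_eq_square)
  define B3 where "B3 = (\<Union>x\<in>N. cross_event n x C \<tau>)"
  have B3: "B3 \<in> sets (\<Omega> n)" unfolding B3_def using finN cross_event_sets by auto
  have normN: "L2_set x {..<n} \<le> 2" if "x \<in> N" for x
    using N(1) that \<epsilon> by (fastforce simp: is_net_def)
  have "emeasure (\<Omega> n) B3 \<le> ennreal (card N * exp (- (r * m)))"
    unfolding B3_def expo[symmetric]
    by (intro emeasure_UN_le finN cross_event_sets cross_event_le normN s \<open>0 \<le> C\<close>) auto
  also have "\<dots> \<le> ennreal (exp (- (2 * real n)))"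
  proof (intro ennreal_leI)
    \<comment> \<open>The term ln K pays for the net; the summand 2 leaves room for adding the other
      exceptional probabilities.\<close>
    have "(ln K + 2) * n \<le> r * m" using mr r by (simp add: field_simps)
    hence "exp (- (r * m)) \<le> exp (- ((ln K + 2) * n))" by simp
    hence "real (card N) * exp (- (r * m)) \<le> K ^ n * exp (- ((ln K + 2) * n))"
      using K N(2) by (intro mult_mono) auto
    also have "K ^ n = exp (n * ln K)" using K by (simp add: exp_of_nat_mult)
    also have "exp (n * ln K) * exp (- ((ln K + 2) * n)) = exp (- (2 * real n))"
      unfolding exp_add[symmetric] by (simp add: algebra_simps)
    finally show "real (card N) * exp (- (r * m)) \<le> exp (- (2 * real n))" .
  qed
  finally have pB3: "emeasure (\<Omega> n) B3 \<le> ennreal (exp (- (2 * real n)))" .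
  define B where "B = B1 \<union> B2 \<union> B3"
  have B: "B \<in> sets (\<Omega> n)" using B1 B2 B3 by (simp add: B_def)
  have "emeasure (\<Omega> n) B \<le> emeasure (\<Omega> n) B1 + emeasure (\<Omega> n) B2 + emeasure (\<Omega> n) B3"
    unfolding B_def using B1 B2 B3
    by (intro order_trans[OF emeasure_subadditive] add_mono emeasure_subadditive order_refl) auto
  also have "\<dots> \<le> ennreal (exp (- m)) + ennreal (n * (2 * exp (- m))) + ennreal (exp (- (2 * real n)))"
    by (intro add_mono B1 B2 pB3)
  also have "\<dots> = ennreal (exp (- m) * (1 + 2 * real n) + exp (- (2 * real n)))"
    by (simp add: ennreal_plus[symmetric] algebra_simps del: ennreal_plus)
  also have "\<dots> \<le> ennreal (exp (- real n))"
  proof (intro ennreal_leI)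
    \<comment> \<open>The entry 4 of \<open>aspect_const\<close> acts here: half of the exponent 4 *
      n absorbs the union over the rows.\<close>
    have "exp (- m) * (1 + 2 * real n) \<le> exp (- (4 * real n)) * exp (2 * real n)"
      using m4 exp_ge_add_one_self[of "2 * real n"] by (intro mult_mono) auto
    also have "\<dots> = exp (- (2 * real n))" by (simp add: exp_add[symmetric])
    finally have "exp (- m) * (1 + 2 * real n) + exp (- (2 * real n)) \<le> 2 * exp (- (2 * real n))" by simp
    also have "\<dots> \<le> exp n * exp (- (2 * real n))"
    proof (intro mult_right_mono)
      have "1 \<le> real n" using n by simp
      thus "2 \<le> exp (real n)" using exp_ge_add_one_self[of "real n"] by linarith
    qed simp
    also have "\<dots> = exp (- real n)" by (simp add: exp_add[symmetric])
    finally show "exp (- m) * (1 + 2 * real n) + exp (- (2 * real n)) \<le> exp (- real n)" .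
  qed
  finally have pB: "emeasure (\<Omega> n) B \<le> ennreal (exp (- real n))" .
  have low: "sqrt (\<delta> / 32 * m) * L2_set a {..<n} \<le> L2_set (\<lambda>j. \<Sum>i<n. a i * z i j) J"
    if z: "z \<in> space (\<Omega> n) - B" for z a
  proof -
    let ?Z = "\<lambda>a. L2_set (\<lambda>j. \<Sum>i<n. a i * z i j) J"
    have zB: "z \<in> space (\<Omega> n) - B1" "z \<in> space (\<Omega> n) - B2" "z \<in> space (\<Omega> n)" "z \<notin> B3"
      using z by (auto simp: B_def)
    have sq: "sqrt (\<delta> / 32 * m) = sqrt (\<delta> / 8) * sqrt m / 2"
    proof -
      have "\<delta> / 32 * m = \<delta> / 8 * m / 2\<^sup>2" by simp
      thus ?thesis by (simp only: real_sqrt_divide real_sqrt_mult real_sqrt_abs abs_numeral)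
    qed
    have net: "sqrt (\<delta> / 8) * sqrt m \<le> ?Z x" if x: "x \<in> N" "1/2 \<le> L2_set x {..<n}" for x
    proof -
      have cap: "(\<Sum>j\<in>J. (row_sum x k z j)\<^sup>2) \<le> C" if "k < n" for k
      proof -
        \<comment> \<open>A partial sum of rows is the image of the coefficients cut off at
          \<open>k\<close>, so the single operator norm bound controls all partial sums at
          once.\<close>
        define y where "y i = (if i < k then x i else 0)" for i
        have "L2_set y {..<n} \<le> L2_set x {..<n}"
          by (auto simp: L2_set_def y_def intro!: sum_mono)
        also have "\<dots> \<le> 2" by (rule normN) fact
        finally have y2: "L2_set y {..<n} \<le> 2" .
        have "row_sum x k z j = (\<Sum>i<n. y i * z i j)" for j
        proof -
          have "(\<Sum>i<n. y i * z i j) = (\<Sum>i<k. y i * z i j)"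
            using that by (intro sum.mono_neutral_right) (auto simp: y_def)
          also have "\<dots> = row_sum x k z j" unfolding row_sum_def by (intro sum.cong) (auto simp: y_def)
          finally show ?thesis ..
        qed
        hence "L2_set (row_sum x k z) J = ?Z y" by (simp add: L2_set_def)
        also have "\<dots> \<le> \<beta> * sqrt m * L2_set y {..<n}" by (rule up) fact
        also have "\<dots> \<le> \<beta> * sqrt m * 2" using \<beta> m y2 by (intro mult_left_mono) auto
        finally have "(L2_set (row_sum x k z) J)\<^sup>2 \<le> (\<beta> * sqrt m * 2)\<^sup>2" by (intro power_mono) auto
        thus ?thesis using m by (simp add: L2_set_sq C_def power_mult_distrib mult_ac)
      qed
      have "z \<notin> cross_event n x C \<tau>" using zB x by (auto simp: B3_def)
      hence T: "- \<tau> < (\<Sum>i<n. \<Sum>j\<in>J. x i * row_sum x i z j * z i j)"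
        using cap zB by (auto simp: cross_event_def not_le)
      have "(?Z x)\<^sup>2 = (\<Sum>j\<in>J. (\<Sum>i<n. (x i * z i j)\<^sup>2) + 2 * (\<Sum>i<n. (\<Sum>l<i. x l * z l j) * (x i * z i j)))"
        unfolding L2_set_sq by (intro sum.cong refl sum_square_partial_sums)
      also have "\<dots> = (\<Sum>j\<in>J. \<Sum>i<n. (x i * z i j)\<^sup>2) + 2 * (\<Sum>j\<in>J. \<Sum>i<n. x i * row_sum x i z j * z i j)"
        by (simp add: sum.distrib sum_distrib_left row_sum_def mult_ac)
      also have "(\<Sum>j\<in>J. \<Sum>i<n. (x i * z i j)\<^sup>2) = (\<Sum>i<n. (x i)\<^sup>2 * (\<Sum>j\<in>J. (z i j)\<^sup>2))"
        by (subst sum.swap) (simp add: sum_distrib_left power_mult_distrib)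
      also have "(\<Sum>j\<in>J. \<Sum>i<n. x i * row_sum x i z j * z i j) = (\<Sum>i<n. \<Sum>j\<in>J. x i * row_sum x i z j * z i j)"
        by (rule sum.swap)
      finally have Zx: "(?Z x)\<^sup>2 = (\<Sum>i<n. (x i)\<^sup>2 * (\<Sum>j\<in>J. (z i j)\<^sup>2)) +
          2 * (\<Sum>i<n. \<Sum>j\<in>J. x i * row_sum x i z j * z i j)" .
      have "(1/2)\<^sup>2 \<le> (L2_set x {..<n})\<^sup>2" using x by (intro power_mono) auto
      hence "1/4 \<le> (\<Sum>i<n. (x i)\<^sup>2)" by (simp add: L2_set_sq power_divide)
      hence "\<delta> * m * (1/4) \<le> \<delta> * m * (\<Sum>i<n. (x i)\<^sup>2)" using \<delta> m by (intro mult_left_mono) auto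
      also have "\<dots> = (\<Sum>i<n. (x i)\<^sup>2 * (\<delta> * m))" by (simp add: sum_distrib_left mult_ac)
      also have "\<dots> \<le> (\<Sum>i<n. (x i)\<^sup>2 * (\<Sum>j\<in>J. (z i j)\<^sup>2))"
        using rowlen[OF zB(2)] by (intro sum_mono mult_left_mono) auto
      finally have "\<delta> / 8 * m \<le> (?Z x)\<^sup>2" using T unfolding Zx \<tau>_def by simp
      hence "sqrt (\<delta> / 8 * m) \<le> ?Z x" by (intro real_le_lsqrt) auto
      thus ?thesis by (simp only: real_sqrt_mult)
    qed
    have unit: "sqrt (\<delta> / 32 * m) \<le> ?Z a" if a: "L2_set a {..<n} = 1" for a
    proof -
      have "L2_set a {..<n} \<le> 1" using a by simp
      then obtain x where x: "x \<in> N" "L2_set (\<lambda>i. a i - x i) {..<n} \<le> \<epsilon>"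
        using N(1) unfolding is_net_def by blast
      have "L2_set (\<lambda>i. (a i - x i) + x i) {..<n} \<le> L2_set (\<lambda>i. a i - x i) {..<n} + L2_set x {..<n}"
        by (rule L2_set_triangle_ineq)
      hence "1/2 \<le> L2_set x {..<n}" using x a \<epsilon> by simp
      hence "sqrt (\<delta> / 8) * sqrt m \<le> ?Z x" by (intro net x)
      also have "?Z x = L2_set (\<lambda>j. (\<Sum>i<n. a i * z i j) + (\<Sum>i<n. (x i - a i) * z i j)) J"
        by (simp add: sum.distrib[symmetric] algebra_simps)
      also have "\<dots> \<le> ?Z a + ?Z (\<lambda>i. x i - a i)" by (rule L2_set_triangle_ineq)
      also have "?Z (\<lambda>i. x i - a i) \<le> \<beta> * sqrt m * L2_set (\<lambda>i. x i - a i) {..<n}" by (rule up) fact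
      also have "L2_set (\<lambda>i. x i - a i) {..<n} = L2_set (\<lambda>i. a i - x i) {..<n}"
        by (simp add: L2_set_def power2_commute)
      also have "\<beta> * sqrt m * \<dots> \<le> \<beta> * sqrt m * (sqrt (\<delta> / 8) / (2 * \<beta>))"
        using x \<epsilon> \<beta> m by (intro mult_left_mono) auto
      also have "\<dots> = sqrt (\<delta> / 8) * sqrt m / 2" using \<beta> by simp
      finally show ?thesis unfolding sq by simp
    qed
    show ?thesis
    proof (cases "L2_set a {..<n} = 0")
      case False
      define q where "q = L2_set a {..<n}"
      have q: "q > 0" using False L2_set_nonneg[of a "{..<n}"] unfolding q_def by linarith
      have "L2_set (\<lambda>i. (1/q) * a i) {..<n} = 1" unfolding L2_set_scale using q by (simp add: q_def)
      from unit[OF this] have "sqrt (\<delta> / 32 * m) \<le> L2_set (\<lambda>j. (1/q) * (\<Sum>i<n. a i * z i j)) J"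
        by (simp add: sum_distrib_left mult_ac)
      also have "\<dots> = (1/q) * ?Z a" unfolding L2_set_scale using q by simp
      finally show ?thesis using q by (simp add: field_simps q_def[symmetric])
    qed simp
  qed
  show ?thesis
    using B pB low up unfolding m_def[symmetric] \<beta>_def[symmetric]
    by (intro bexI[of _ B]) (auto simp: B_def)
qed

end

section \<open>Orthogonal matrices and eigenvalues of Gram matrices\<close>

lemma scalar_prod_self_pos:
  assumes "v \<in> carrier_vec n" "v \<noteq> 0\<^sub>v n"
  shows "0 < v \<bullet> (v :: real vec)"
proof -
  obtain i where i: "i < n" "v $ i \<noteq> 0" using assms by (metis eq_vecI carrier_vecD index_zero_vec)
  have "0 < (v $ i)\<^sup>2" using i by simp
  also have "\<dots> \<le> (\<Sum>i\<in>{0..<n}. (v $ i)\<^sup>2)" using i by (intro member_le_sum) auto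
  finally show ?thesis using assms(1) by (simp add: scalar_prod_def power2_eq_square)
qed

text \<open>The witness is the Householder reflection along \<open>x - y\<close>.\<close>

lemma orthogonal_mats_transitive:
  assumes x: "x \<in> carrier_vec p" and y: "y \<in> carrier_vec p" and eq: "x \<bullet> x = y \<bullet> y"
  shows "\<exists>Q\<in>orthogonal_mats p. Q *\<^sub>v x = y"
proof (cases "x = y")
  case True
  thus ?thesis using x by (intro bexI[of _ "1\<^sub>m p"]) (auto simp: orthogonal_mats_def)
next
  case False
  define w where "w = x - y"
  have w: "w \<in> carrier_vec p" using x y by (simp add: w_def)
  have w0: "w \<noteq> 0\<^sub>v p"
  proof
    assume "w = 0\<^sub>v p"
    have "x = y"
    proof (rule eq_vecI)
      fix i assume i: "i < dim_vec y"
      hence "w $ i = x $ i - y $ i" using x y by (simp add: w_def)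
      thus "x $ i = y $ i" using \<open>w = 0\<^sub>v p\<close> i y by simp
    qed (use x y in auto)
    with False show False ..
  qed
  define q where "q = w \<bullet> w"
  have q: "q > 0" unfolding q_def by (rule scalar_prod_self_pos[OF w w0])
  define Q where "Q = mat p p (\<lambda>(i,j). (if i = j then 1 else 0) - 2 / q * w $ i * w $ j)"
  have Q: "Q \<in> carrier_mat p p" by (simp add: Q_def)
  have qs: "(\<Sum>k\<in>{0..<p}. w $ k * w $ k) = q" using w by (simp add: q_def scalar_prod_def)
  have "transpose_mat Q * Q = 1\<^sub>m p"
  proof (rule eq_matI)
    fix i j assume ij: "i < dim_row (1\<^sub>m p)" "j < dim_col (1\<^sub>m p)"
    hence ij: "i < p" "j < p" by auto
    have "(transpose_mat Q * Q) $$ (i, j) = (\<Sum>k\<in>{0..<p}. Q $$ (k, i) * Q $$ (k, j))"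
      using ij Q by (simp add: scalar_prod_def)
    also have "\<dots> = (\<Sum>k\<in>{0..<p}. (if k = i then (if i = j then 1 else 0) else 0)
        - (if k = i then 2 / q * w $ i * w $ j else 0) - (if k = j then 2 / q * w $ i * w $ j else 0)
        + (2 / q)\<^sup>2 * w $ i * w $ j * (w $ k * w $ k))"
      using ij by (intro sum.cong) (auto simp: Q_def power2_eq_square algebra_simps)
    also have "\<dots> = (if i = j then 1 else 0) - 2 / q * w $ i * w $ j - 2 / q * w $ i * w $ j
        + (2 / q)\<^sup>2 * w $ i * w $ j * q"
      using ij by (simp add: sum.distrib sum_subtractf sum_distrib_left[symmetric] qs)
    also have "\<dots> = 1\<^sub>m p $$ (i, j)" using q ij by (simp add: power2_eq_square)
    finally show "(transpose_mat Q * Q) $$ (i, j) = 1\<^sub>m p $$ (i, j)" .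
  qed (use Q in auto)
  moreover have "Q *\<^sub>v x = y"
  proof (rule eq_vecI)
    fix i assume "i < dim_vec y"
    hence i: "i < p" using y by auto
    have xx: "(\<Sum>k\<in>{0..<p}. x $ k * x $ k) = (\<Sum>k\<in>{0..<p}. y $ k * y $ k)"
      using eq x y by (simp add: scalar_prod_def)
    have "q = (\<Sum>k\<in>{0..<p}. x $ k * x $ k) - 2 * (\<Sum>k\<in>{0..<p}. x $ k * y $ k) + (\<Sum>k\<in>{0..<p}. y $ k * y $ k)"
      unfolding qs[symmetric] sum_distrib_left sum_subtractf[symmetric] sum.distrib[symmetric]
      using x y by (intro sum.cong) (auto simp: w_def algebra_simps)
    moreover have "(\<Sum>k\<in>{0..<p}. w $ k * x $ k) = (\<Sum>k\<in>{0..<p}. x $ k * x $ k) - (\<Sum>k\<in>{0..<p}. x $ k * y $ k)"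
      unfolding sum_subtractf[symmetric] using x y by (intro sum.cong) (auto simp: w_def algebra_simps)
    \<comment> \<open>Equal norms enter here: the reflection subtracts exactly one copy of
      \<open>w = x - y\<close> from \<open>x\<close>.\<close>
    ultimately have wx: "2 * (\<Sum>k\<in>{0..<p}. w $ k * x $ k) = q" using xx by simp
    have "(Q *\<^sub>v x) $ i = (\<Sum>k\<in>{0..<p}. Q $$ (i, k) * x $ k)"
      using i x Q by (simp add: scalar_prod_def)
    also have "\<dots> = (\<Sum>k\<in>{0..<p}. (if k = i then x $ i else 0) - 2 / q * w $ i * (w $ k * x $ k))"
      using i by (intro sum.cong) (auto simp: Q_def algebra_simps)
    also have "\<dots> = x $ i - 2 / q * w $ i * (\<Sum>k\<in>{0..<p}. w $ k * x $ k)"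
      using i by (simp add: sum_subtractf sum_distrib_left)
    also have "\<dots> = x $ i - w $ i / q * (2 * (\<Sum>k\<in>{0..<p}. w $ k * x $ k))" by simp
    also have "\<dots> = y $ i" unfolding wx using q i x y by (simp add: w_def)
    finally show "(Q *\<^sub>v x) $ i = y $ i" .
  qed (use Q y in auto)
  ultimately show ?thesis using Q by (auto simp: orthogonal_mats_def)
qed

lemma orthogonal_mats_scalar_prod:
  assumes Q: "Q \<in> orthogonal_mats p" and v: "v \<in> carrier_vec p" and w: "w \<in> carrier_vec p"
  shows "(Q *\<^sub>v v) \<bullet> (Q *\<^sub>v w) = v \<bullet> w"
proof -
  have Qc: "Q \<in> carrier_mat p p" and QQ: "transpose_mat Q * Q = 1\<^sub>m p"
    using Q by (auto simp: orthogonal_mats_def)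
  have "(Q *\<^sub>v v) \<bullet> (Q *\<^sub>v w) = (transpose_mat Q *\<^sub>v (Q *\<^sub>v v)) \<bullet> w"
    using Qc v w by (intro transpose_vec_mult_scalar[symmetric]) auto
  also have "transpose_mat Q *\<^sub>v (Q *\<^sub>v v) = (transpose_mat Q * Q) *\<^sub>v v"
    using Qc v by (intro assoc_mult_mat_vec[symmetric]) auto
  also have "\<dots> = v" unfolding QQ using v by simp
  finally show ?thesis .
qed

text \<open>Eigenvalues of a real matrix are real by type, so the sets behind
  \<open>lambda_max\<close> and \<open>lambda_min\<close> might be empty. Over the complex numbers
  an eigenvalue exists, symmetry makes it equal to its conjugate, and as a root of the
  characteristic polynomial it returns to the reals.\<close>

lemma real_symmetric_eigenvalue_exists:
  fixes A :: "real mat"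
  assumes A: "A \<in> carrier_mat n n" and sym: "transpose_mat A = A" and n: "0 < n"
  shows "\<exists>k. eigenvalue A k"
proof -
  define B where "B = map_mat complex_of_real A"
  have B: "B \<in> carrier_mat n n" using A by (simp add: B_def)
  have symB: "transpose_mat B = B" unfolding B_def by (subst sym[symmetric]) auto
  obtain k where k: "eigenvalue B k" using spectrum_non_empty[OF B n] by (auto simp: spectrum_def)
  then obtain v where v: "v \<in> carrier_vec n" "v \<noteq> 0\<^sub>v n" "B *\<^sub>v v = k \<cdot>\<^sub>v v"
    using B by (auto simp: eigenvalue_def eigenvector_def)
  have conjB: "conjugate (B *\<^sub>v v) = B *\<^sub>v conjugate v"
  proof (rule eq_vecI)
    fix i assume "i < dim_vec (B *\<^sub>v conjugate v)"
    hence i: "i < n" using B by auto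
    thus "conjugate (B *\<^sub>v v) $ i = (B *\<^sub>v conjugate v) $ i"
      using A v(1) by (simp add: B_def scalar_prod_def)
  qed (use B in auto)
  have "k * (v \<bullet>c v) = (B *\<^sub>v v) \<bullet>c v" using v by simp
  also have "\<dots> = (transpose_mat B *\<^sub>v v) \<bullet> conjugate v" by (simp only: symB)
  also have "\<dots> = v \<bullet> (B *\<^sub>v conjugate v)"
    by (rule transpose_vec_mult_scalar[OF B]) (use v in auto)
  also have "\<dots> = v \<bullet>c (k \<cdot>\<^sub>v v)" unfolding conjB[symmetric] v(3) ..
  also have "\<dots> = cnj k * (v \<bullet>c v)" using v(1) by (simp add: conjugate_smult_vec)
  finally have "k = cnj k" using v by simp
  hence "k = complex_of_real (Re k)" by (simp add: complex_eq_iff)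
  moreover have "poly (char_poly B) k = 0" using k eigenvalue_root_char_poly[OF B] by simp
  moreover have "char_poly B = map_poly complex_of_real (char_poly A)"
    unfolding B_def by (rule of_real_hom.char_poly_hom[OF A])
  ultimately have "poly (char_poly A) (Re k) = 0"
    by (metis of_real_hom.poly_map_poly of_real_eq_0_iff)
  thus ?thesis using eigenvalue_root_char_poly[OF A] by blast
qed

text \<open>At an eigenvector the quadratic form is the eigenvalue times the squared length, so
  bounds on the form transfer to every eigenvalue and then to the extremes of a finite, non-empty
  set.\<close>

lemma gram_eigenvalue_bounds:
  fixes Z :: "real mat"
  assumes Z: "Z \<in> carrier_mat n m" and n: "0 < n" and m: "0 < m"
    and bounds: "\<And>v. v \<in> carrier_vec n \<Longrightarrow>
      \<alpha> * m * (\<Sum>i<n. (v $ i)\<^sup>2) \<le> (\<Sum>j<m. (\<Sum>i<n. v $ i * Z $$ (i, j))\<^sup>2) \<and>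
      (\<Sum>j<m. (\<Sum>i<n. v $ i * Z $$ (i, j))\<^sup>2) \<le> \<beta> * m * (\<Sum>i<n. (v $ i)\<^sup>2)"
  defines "W \<equiv> (1 / real m) \<cdot>\<^sub>m (Z * transpose_mat Z)"
  shows "lambda_max W \<le> \<beta>" "\<alpha> \<le> lambda_min W"
proof -
  have W: "W \<in> carrier_mat n n" using Z by (simp add: W_def)
  have sym: "transpose_mat W = W"
  proof -
    have "transpose_mat (Z * transpose_mat Z) = Z * transpose_mat Z"
      using Z by (subst transpose_mult[of _ n m _ n]) auto
    moreover have "transpose_mat (c \<cdot>\<^sub>m B) = c \<cdot>\<^sub>m transpose_mat B" for c and B :: "real mat" by auto
    ultimately show ?thesis unfolding W_def by simp
  qed
  have fin: "finite {k. eigenvalue W k}"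
    using card_finite_spectrum(1)[OF W] by (simp add: spectrum_def)
  have ne: "{k. eigenvalue W k} \<noteq> {}"
    using real_symmetric_eigenvalue_exists[OF W sym n] by auto
  have k: "\<alpha> \<le> k \<and> k \<le> \<beta>" if ev: "eigenvalue W k" for k
  proof -
    obtain v where v: "v \<in> carrier_vec n" "v \<noteq> 0\<^sub>v n" "W *\<^sub>v v = k \<cdot>\<^sub>v v"
      using ev W by (auto simp: eigenvalue_def eigenvector_def)
    have vv: "v \<bullet> v = (\<Sum>i<n. (v $ i)\<^sup>2)"
      using v(1) by (simp add: scalar_prod_def power2_eq_square lessThan_atLeast0)
    have pos: "0 < m * (\<Sum>i<n. (v $ i)\<^sup>2)" using scalar_prod_self_pos[OF v(1,2)] m unfolding vv by simp
    let ?y = "transpose_mat Z *\<^sub>v v"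
    have y: "?y \<in> carrier_vec m" using Z v(1) by (intro mult_mat_vec_carrier[of _ m n]) auto
    have "k * (v \<bullet> v) = v \<bullet> (W *\<^sub>v v)" unfolding v(3) using v(1) by simp
    also have "W *\<^sub>v v = (1 / real m) \<cdot>\<^sub>v ((Z * transpose_mat Z) *\<^sub>v v)"
    proof -
      have "(c \<cdot>\<^sub>m B) *\<^sub>v v = c \<cdot>\<^sub>v (B *\<^sub>v v)" if "B \<in> carrier_mat n n" for c B
        using that v(1) by (intro eq_vecI) (auto simp: scalar_prod_def sum_distrib_left mult.assoc)
      thus ?thesis unfolding W_def using Z by (simp add: mult_carrier_mat[of _ n m])
    qed
    also have "(Z * transpose_mat Z) *\<^sub>v v = Z *\<^sub>v ?y"
      using Z v(1) by (intro assoc_mult_mat_vec[of Z n m _ n]) auto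
    also have "v \<bullet> ((1 / real m) \<cdot>\<^sub>v (Z *\<^sub>v ?y)) = (1 / real m) * (v \<bullet> (Z *\<^sub>v ?y))"
      using Z v(1) by (subst scalar_prod_smult_distrib[of _ n]) auto
    also have "v \<bullet> (Z *\<^sub>v ?y) = ?y \<bullet> ?y"
      by (rule transpose_vec_mult_scalar[symmetric, OF Z y v(1)])
    also have "?y \<bullet> ?y = (\<Sum>j<m. (\<Sum>i<n. v $ i * Z $$ (i, j))\<^sup>2)"
      using Z v(1) by (simp add: scalar_prod_def power2_eq_square lessThan_atLeast0 mult.commute)
    finally have "(\<Sum>j<m. (\<Sum>i<n. v $ i * Z $$ (i, j))\<^sup>2) = k * (m * (\<Sum>i<n. (v $ i)\<^sup>2))"
      using m by (simp add: vv field_simps)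
    with bounds[OF v(1)] have "\<alpha> * (m * (\<Sum>i<n. (v $ i)\<^sup>2)) \<le> k * (m * (\<Sum>i<n. (v $ i)\<^sup>2))"
      "k * (m * (\<Sum>i<n. (v $ i)\<^sup>2)) \<le> \<beta> * (m * (\<Sum>i<n. (v $ i)\<^sup>2))" by (simp_all add: mult.assoc)
    thus ?thesis using pos by (simp add: mult_le_cancel_right)
  qed
  show "lambda_max W \<le> \<beta>" "\<alpha> \<le> lambda_min W"
    unfolding lambda_max_def lambda_min_def using fin ne k by (auto simp: Max_le_iff Min_ge_iff)
qed

section \<open>Column submatrices\<close>

lemma bij_betw_pick:
  assumes "finite J"
  shows "bij_betw (pick J) {..<card J} J"
proof -
  have inj: "inj_on (pick J) {..<card J}"
    using pick_mono_le[of _ J] by (intro linorder_inj_onI) (auto, metis less_irrefl)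
  moreover have "pick J ` {..<card J} \<subseteq> J" using pick_in_set_le[of _ J] by auto
  ultimately have "pick J ` {..<card J} = J"
    using assms by (intro card_subset_eq) (auto simp: card_image)
  thus ?thesis using inj by (simp add: bij_betw_def)
qed

lemma pick_lessThan:
  assumes "i < n"
  shows "pick {..<n} i = i"
proof -
  have "{a \<in> {..<n}. a < i} = {..<i}" using assms by auto
  thus ?thesis using pick_card_in_set[of i "{..<n}"] assms by simp
qed

text \<open>\<open>submatrix\<close> renumbers the chosen columns in increasing order via
  \<open>pick\<close>; reindexing along this bijection restores the original labels under the
  sum.\<close>

lemma submatrix_columns:
  assumes A: "A \<in> carrier_mat n p" and J: "J \<subseteq> {..<p}"
  shows "submatrix A {..<n} J \<in> carrier_mat n (card J)"
    and "(\<Sum>j<card J. (\<Sum>i<n. a i * submatrix A {..<n} J $$ (i, j))\<^sup>2) = (\<Sum>j\<in>J. (\<Sum>i<n. a i * A $$ (i, j))\<^sup>2 :: real)"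
proof -
  have cn: "card {i. i < dim_row A \<and> i \<in> {..<n}} = n" and cJ: "{j. j < dim_col A \<and> j \<in> J} = J"
    using A J by auto
  show "submatrix A {..<n} J \<in> carrier_mat n (card J)"
    by (intro carrier_matI) (simp_all only: dim_submatrix cn cJ)
  have "(\<Sum>j<card J. (\<Sum>i<n. a i * submatrix A {..<n} J $$ (i, j))\<^sup>2) =
     (\<Sum>j<card J. (\<Sum>i<n. a i * A $$ (i, pick J j))\<^sup>2)"
    by (intro sum.cong arg_cong[where f="\<lambda>x. x\<^sup>2"] refl)
      (simp add: submatrix_index[of _ A "{..<n}" _ J, unfolded cn cJ] pick_lessThan)
  also have "\<dots> = (\<Sum>j\<in>J. (\<Sum>i<n. a i * A $$ (i, j))\<^sup>2)"
    using bij_betw_pick[of J] J finite_subset[OF J] by (intro sum.reindex_bij_betw) auto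
  finally show "(\<Sum>j<card J. (\<Sum>i<n. a i * submatrix A {..<n} J $$ (i, j))\<^sup>2) = (\<Sum>j\<in>J. (\<Sum>i<n. a i * A $$ (i, j))\<^sup>2)" .
qed

section \<open>Spherical laws and the random design\<close>

text \<open>The restriction makes this the inverse of \<open>vec p\<close> on the space of the
  product measure.\<close>

definition vec_coords :: "nat \<Rightarrow> real vec \<Rightarrow> nat \<Rightarrow> real" where
  "vec_coords p v = (\<lambda>i\<in>{..<p}. v $ i)"

lemma space_borel_vec [simp]: "space (borel_vec p) = carrier_vec p"
  by (simp add: borel_vec_def)

lemma sets_PiM_lborel: "sets (Pi\<^sub>M I (\<lambda>_. lborel :: real measure)) = sets (Pi\<^sub>M I (\<lambda>_. borel))"
  by (intro sets_PiM_cong) auto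

lemma vec_coords_measurable: "vec_coords p \<in> borel_vec p \<rightarrow>\<^sub>M Pi\<^sub>M {..<p} (\<lambda>_. lborel)"
proof -
  have "vec_coords p \<in> borel_vec p \<rightarrow>\<^sub>M Pi\<^sub>M {..<p} (\<lambda>_. borel)"
    unfolding borel_vec_def vec_coords_def[abs_def]
    by (rule measurable_vimage_algebra1) (auto simp: space_PiM)
  thus ?thesis using measurable_cong_sets[OF refl sets_PiM_lborel] by blast
qed

lemma vec_index_measurable: "i < p \<Longrightarrow> (\<lambda>v. v $ i) \<in> borel_measurable (borel_vec p)"
  using measurable_compose[OF vec_coords_measurable[of p] measurable_component_singleton[of i "{..<p}" "\<lambda>_. lborel"]]
  by (simp add: vec_coords_def)

lemma measurable_borel_vecI:
  assumes "\<And>x. x \<in> space M \<Longrightarrow> f x \<in> carrier_vec p"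
    and "\<And>i. i < p \<Longrightarrow> (\<lambda>x. f x $ i) \<in> borel_measurable M"
  shows "f \<in> M \<rightarrow>\<^sub>M borel_vec p"
  unfolding borel_vec_def
  by (rule measurable_vimage_algebra2) (use assms in \<open>auto intro!: measurable_restrict\<close>)

lemma vec_measurable: "vec p \<in> Pi\<^sub>M {..<p} (\<lambda>_. lborel :: real measure) \<rightarrow>\<^sub>M borel_vec p"
proof (rule measurable_borel_vecI)
  fix i assume "i < p"
  hence "(\<lambda>x. x i) \<in> Pi\<^sub>M {..<p} (\<lambda>_. lborel :: real measure) \<rightarrow>\<^sub>M lborel"
    by (intro measurable_component_singleton) auto
  thus "(\<lambda>x. vec p x $ i :: real) \<in> borel_measurable (Pi\<^sub>M {..<p} (\<lambda>_. lborel))" using \<open>i < p\<close> by simp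
qed auto

lemma mult_mat_vec_measurable:
  assumes A: "A \<in> carrier_mat p p"
  shows "(\<lambda>v. A *\<^sub>v v) \<in> borel_vec p \<rightarrow>\<^sub>M borel_vec p"
proof (rule measurable_borel_vecI)
  fix i assume i: "i < p"
  have "(\<lambda>v. \<Sum>k\<in>{0..<p}. A $$ (i, k) * v $ k) \<in> borel_measurable (borel_vec p)"
    using vec_index_measurable by (intro borel_measurable_sum borel_measurable_times) auto
  thus "(\<lambda>v. (A *\<^sub>v v) $ i) \<in> borel_measurable (borel_vec p)"
    by (rule measurable_cong[THEN iffD1, rotated]) (use A i in \<open>auto simp: scalar_prod_def\<close>)
qed (use A in auto)

text \<open>\<open>lborel_vec\<close> is the image of product Lebesgue measure under
  \<open>vec p\<close>, so taking coordinates undoes this map and leaves the density composed with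
  it.\<close>

lemma distr_density_lborel_vec:
  assumes U: "U \<in> borel_measurable (borel_vec p)"
    and \<mu>: "\<mu> = density (lborel_vec p) (\<lambda>v. ennreal (exp (- U v)))"
  shows "distr \<mu> (Pi\<^sub>M {..<p} (\<lambda>_. lborel)) (vec_coords p) =
     density (Pi\<^sub>M {..<p} (\<lambda>_. lborel)) (\<lambda>x. ennreal (exp (- U (vec p x))))"
proof -
  let ?L = "Pi\<^sub>M {..<p} (\<lambda>_. lborel :: real measure)"
  let ?D = "density ?L (\<lambda>x. ennreal (exp (- U (vec p x))))"
  have "\<mu> = distr ?D (borel_vec p) (vec p)"
    unfolding \<mu> lborel_vec_def by (rule density_distr[OF _ vec_measurable]) (use U in measurable)
  hence "distr \<mu> ?L (vec_coords p) = distr (distr ?D (borel_vec p) (vec p)) ?L (vec_coords p)" by simp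
  also have "\<dots> = distr ?D ?L (vec_coords p \<circ> vec p)"
    by (rule distr_distr[OF vec_coords_measurable]) (use vec_measurable in simp)
  also have "\<dots> = distr ?D ?L (\<lambda>x. x)"
    by (intro distr_cong) (auto simp: vec_coords_def space_PiM PiE_def extensional_def fun_eq_iff)
  also have "\<dots> = ?D" by (rule distr_id2) simp
  finally show ?thesis .
qed

text \<open>Serves twice: for \<open>U\<close>, and for the first component of its gradient, whose
  derivative along the axis is the corner entry of the Hessian.\<close>

lemma has_gradient_imp_DERIV:
  assumes p: "0 < p" and g: "has_gradient p f (s \<cdot>\<^sub>v unit_vec p 0) g"
  shows "((\<lambda>s. f (s \<cdot>\<^sub>v unit_vec p 0)) has_real_derivative g $ 0) (at s)"
  unfolding has_field_derivative_def has_derivative_at_alt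
proof (intro conjI allI impI)
  show "bounded_linear ((*) (g $ 0))" by (rule bounded_linear_mult_right)
  fix e :: real assume "0 < e"
  have gc: "g \<in> carrier_vec p" using g by (simp add: has_gradient_def)
  obtain d where d: "d > 0" "\<And>h. h \<in> carrier_vec p \<Longrightarrow> vec_len h < d \<Longrightarrow>
      \<bar>f (s \<cdot>\<^sub>v unit_vec p 0 + h) - f (s \<cdot>\<^sub>v unit_vec p 0) - g \<bullet> h\<bar> \<le> e * vec_len h"
    using g \<open>0 < e\<close> unfolding has_gradient_def by blast
  have len: "vec_len (t \<cdot>\<^sub>v unit_vec p 0) = \<bar>t\<bar>" for t
    using p by (simp add: vec_len_def power2_eq_square[symmetric])
  have "norm (f (y \<cdot>\<^sub>v unit_vec p 0) - f (s \<cdot>\<^sub>v unit_vec p 0) - g $ 0 * (y - s)) \<le> e * norm (y - s)"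
    if y: "norm (y - s) < d" for y
  proof -
    have "s \<cdot>\<^sub>v unit_vec p 0 + (y - s) \<cdot>\<^sub>v unit_vec p 0 = y \<cdot>\<^sub>v (unit_vec p 0 :: real vec)"
      by (simp add: add_smult_distrib_vec[symmetric])
    thus ?thesis using d(2)[of "(y - s) \<cdot>\<^sub>v unit_vec p 0"] y p gc by (simp add: len mult.commute)
  qed
  thus "\<exists>d>0. \<forall>y. norm (y - s) < d \<longrightarrow> norm (f (y \<cdot>\<^sub>v unit_vec p 0) - f (s \<cdot>\<^sub>v unit_vec p 0) - g $ 0 * (y - s)) \<le> e * norm (y - s)"
    using d(1) by blast
qed

text \<open>If \<open>Q\<close> is orthogonal and carries the unit vector of index \<open>j\<close>
  to that of index 0, the first coordinate of \<open>Q *\<^sub>v v\<close> is coordinate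
  \<open>j\<close> of \<open>v\<close>. This extends the moment hypothesis to all coordinates, over
  which the small ball estimate sums.\<close>

lemma spherical_law_nn_integral_coord:
  assumes \<mu>: "spherical_law p \<mu>" and j: "j < p"
  shows "(\<integral>\<^sup>+v. ennreal \<bar>v $ j\<bar> \<partial>\<mu>) = (\<integral>\<^sup>+v. ennreal \<bar>v $ 0\<bar> \<partial>\<mu>)"
proof -
  have p: "0 < p" using j by simp
  have sets: "sets \<mu> = sets (borel_vec p)" using \<mu> by (simp add: spherical_law_def vec_law_def)
  have space: "space \<mu> = carrier_vec p" using sets_eq_imp_space_eq[OF sets] by simp
  obtain Q where Q: "Q \<in> orthogonal_mats p" "Q *\<^sub>v unit_vec p j = unit_vec p 0"
    using orthogonal_mats_transitive[of "unit_vec p j" p "unit_vec p 0"] j p by auto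
  have Qc: "Q \<in> carrier_mat p p" using Q by (simp add: orthogonal_mats_def)
  have "(\<integral>\<^sup>+v. ennreal \<bar>v $ 0\<bar> \<partial>\<mu>) = (\<integral>\<^sup>+v. ennreal \<bar>v $ 0\<bar> \<partial>distr \<mu> (borel_vec p) (\<lambda>v. Q *\<^sub>v v))"
    using \<mu> Q(1) by (simp add: spherical_law_def)
  also have "\<dots> = (\<integral>\<^sup>+v. ennreal \<bar>(Q *\<^sub>v v) $ 0\<bar> \<partial>\<mu>)"
    using vec_index_measurable[OF p] mult_mat_vec_measurable[OF Qc]
    by (subst nn_integral_distr) (auto simp: measurable_cong_sets[OF sets refl])
  also have "\<dots> = (\<integral>\<^sup>+v. ennreal \<bar>v $ j\<bar> \<partial>\<mu>)"
  proof (rule nn_integral_cong)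
    fix v assume "v \<in> space \<mu>"
    hence v: "v \<in> carrier_vec p" by (simp add: space)
    have "(Q *\<^sub>v v) $ 0 = (Q *\<^sub>v v) \<bullet> unit_vec p 0"
      using Qc v p by (subst scalar_prod_right_unit[of _ p]) auto
    also have "\<dots> = v \<bullet> unit_vec p j" using orthogonal_mats_scalar_prod[OF Q(1) v, of "unit_vec p j"] by (simp add: Q(2))
    also have "\<dots> = v $ j" using v j by (simp add: scalar_prod_right_unit[of _ p])
    finally show "ennreal \<bar>(Q *\<^sub>v v) $ 0\<bar> = ennreal \<bar>v $ j\<bar>" by simp
  qed
  finally show ?thesis ..
qed

text \<open>The profile is \<open>U\<close> along the first axis. Its second derivative is the
  corner entry of the Hessian, and testing the Loewner bound with the first unit vector yields
  \<open>strong\<close>.\<close>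

lemma spherical_density_strongly_log_concave:
  assumes p: "0 < p" and \<mu>: "spherical_law p \<mu>" and U: "U \<in> borel_measurable (borel_vec p)"
    and dens: "\<mu> = density (lborel_vec p) (\<lambda>v. ennreal (exp (- U v)))"
    and sym: "spherically_symmetric p (\<lambda>v. exp (- U v))"
    and hess: "has_hessian p U H"
    and convex: "\<forall>v\<in>carrier_vec p. loewner_ge p (H v) (c2 \<cdot>\<^sub>m 1\<^sub>m p)"
    and c: "0 < c2" "0 < c3" and first: "c3 \<le> (LINT v|\<mu>. \<bar>v $ 0\<bar>)"
  shows "\<exists>u u'. strongly_log_concave_radial {..<p} u u' c2 c3 (distr \<mu> (Pi\<^sub>M {..<p} (\<lambda>_. lborel)) (vec_coords p))"
proof -
  let ?e = "unit_vec p 0 :: real vec" and ?L = "Pi\<^sub>M {..<p} (\<lambda>_. lborel :: real measure)"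
  let ?\<rho> = "distr \<mu> ?L (vec_coords p)"
  have sets: "sets \<mu> = sets (borel_vec p)" and prob: "prob_space \<mu>"
    using \<mu> by (auto simp: spherical_law_def vec_law_def)
  have coords: "vec_coords p \<in> \<mu> \<rightarrow>\<^sub>M ?L"
    using vec_coords_measurable measurable_cong_sets[OF sets refl] by blast
  have radial: "U x = U y" if xy: "x \<in> carrier_vec p" "y \<in> carrier_vec p" "x \<bullet> x = y \<bullet> y" for x y
  proof -
    obtain Q where "Q \<in> orthogonal_mats p" "Q *\<^sub>v x = y" using orthogonal_mats_transitive[OF xy] by blast
    hence "exp (- U y) = exp (- U x)" using sym xy by (auto simp: spherically_symmetric_def)
    thus ?thesis by simp
  qed
  obtain g where g: "\<And>v. v \<in> carrier_vec p \<Longrightarrow> has_gradient p U v (g v)"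
    and Hc: "\<And>v. v \<in> carrier_vec p \<Longrightarrow> H v \<in> carrier_mat p p"
    and gH: "\<And>v. v \<in> carrier_vec p \<Longrightarrow> has_gradient p (\<lambda>u. g u $ 0) v (row (H v) 0)"
    using hess p unfolding has_hessian_def by blast
  define u where "u s = U (s \<cdot>\<^sub>v ?e)" for s
  define u' where "u' s = g (s \<cdot>\<^sub>v ?e) $ 0" for s
  have der: "(u has_real_derivative u' s) (at s)" for s
    unfolding u_def u'_def by (rule has_gradient_imp_DERIV[OF p]) (auto intro: g)
  have der2: "(u' has_real_derivative H (s \<cdot>\<^sub>v ?e) $$ (0, 0)) (at s)" for s
    using has_gradient_imp_DERIV[OF p gH, of s] Hc[of "s \<cdot>\<^sub>v ?e"] p unfolding u'_def by simp
  have H00: "c2 \<le> H v $$ (0, 0)" if v: "v \<in> carrier_vec p" for v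
  proof -
    let ?A = "H v - c2 \<cdot>\<^sub>m 1\<^sub>m p"
    have A: "?A \<in> carrier_mat p p" using Hc[OF v] by auto
    have "0 \<le> ?e \<bullet> (?A *\<^sub>v ?e)" using convex v by (auto simp: loewner_ge_def pos_semidef_def)
    also have "\<dots> = ?A $$ (0, 0)"
      using A p by (subst scalar_prod_left_unit[of _ p]) (auto simp: scalar_prod_right_unit[of _ p])
    also have "\<dots> = H v $$ (0, 0) - c2" using Hc[OF v] p by simp
    finally show ?thesis by simp
  qed
  have strong: "u' s + c2 * (t - s) \<le> u' t" if "s \<le> t" for s t
  proof -
    have "u' s - c2 * s \<le> u' t - c2 * t"
    proof (rule DERIV_nonneg_imp_nondecreasing[OF that])
      fix x
      show "\<exists>y. ((\<lambda>s. u' s - c2 * s) has_real_derivative y) (at x) \<and> 0 \<le> y"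
        using H00[of "x \<cdot>\<^sub>v ?e"]
        by (intro exI[of _ "H (x \<cdot>\<^sub>v ?e) $$ (0, 0) - c2"]) (auto intro!: derivative_eq_intros der2)
    qed
    thus ?thesis by (simp add: algebra_simps)
  qed
  \<comment> \<open>The profile is even, so its derivative at 0 equals its own negative.\<close>
  have "u (- s) = u s" for s unfolding u_def by (rule radial) auto
  hence "(u has_real_derivative - u' 0) (at 0)"
    using DERIV_mirror[of u "u' 0" 0] der[of 0] by simp
  with der[of 0] have "u' 0 = - u' 0" by (rule DERIV_unique)
  hence der0: "u' 0 = 0" by simp
  have Uu: "U (vec p x) = u (sqrt (\<Sum>i\<in>{..<p}. (x i)\<^sup>2))" for x
  proof -
    define r where "r = (\<Sum>i\<in>{..<p}. (x i)\<^sup>2)"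
    have "vec p x \<bullet> vec p x = r"
      by (simp add: r_def scalar_prod_def power2_eq_square lessThan_atLeast0)
    moreover have "0 \<le> r" by (simp add: r_def sum_nonneg)
    hence "(sqrt r \<cdot>\<^sub>v ?e) \<bullet> (sqrt r \<cdot>\<^sub>v ?e) = r"
      using p by (simp add: mult.assoc[symmetric])
    ultimately have "U (vec p x) = U (sqrt r \<cdot>\<^sub>v ?e)" by (intro radial) auto
    thus ?thesis by (simp only: u_def r_def)
  qed
  have \<rho>: "?\<rho> = density ?L (\<lambda>x. ennreal (exp (- u (sqrt (\<Sum>i\<in>{..<p}. (x i)\<^sup>2)))))"
    unfolding distr_density_lborel_vec[OF U dens] Uu ..
  \<comment> \<open>The Bochner integral of a non-integrable function is 0, so the positive lower
    bound \<open>c3\<close> forces integrability.\<close>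
  have "integrable \<mu> (\<lambda>v. \<bar>v $ 0\<bar>)"
  proof (rule ccontr)
    assume "\<not> ?thesis"
    hence "(LINT v|\<mu>. \<bar>v $ 0\<bar>) = 0" by (rule not_integrable_integral_eq)
    thus False using first c by simp
  qed
  hence "(\<integral>\<^sup>+v. ennreal \<bar>v $ 0\<bar> \<partial>\<mu>) = ennreal (LINT v|\<mu>. \<bar>v $ 0\<bar>)"
    by (intro nn_integral_eq_integral) auto
  hence c3: "ennreal c3 \<le> (\<integral>\<^sup>+v. ennreal \<bar>v $ 0\<bar> \<partial>\<mu>)" using first by (simp add: ennreal_leI)
  have first': "ennreal c3 \<le> (\<integral>\<^sup>+x. ennreal \<bar>x j\<bar> \<partial>?\<rho>)" if j: "j \<in> {..<p}" for j
  proof -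
    have "(\<lambda>x. x j) \<in> ?L \<rightarrow>\<^sub>M lborel" using j by (intro measurable_component_singleton) auto
    hence [measurable]: "(\<lambda>x. x j) \<in> borel_measurable ?L" by simp
    have "(\<integral>\<^sup>+x. ennreal \<bar>x j\<bar> \<partial>?\<rho>) = (\<integral>\<^sup>+v. ennreal \<bar>v $ j\<bar> \<partial>\<mu>)"
      using j by (subst nn_integral_distr[OF coords]) (measurable, simp add: vec_coords_def)
    thus ?thesis using c3 spherical_law_nn_integral_coord[OF \<mu>, of j] j by simp
  qed
  have "strongly_log_concave_radial {..<p} u u' c2 c3 ?\<rho>"
  proof (rule strongly_log_concave_radial.intro)
    show "emeasure ?\<rho> (space ?\<rho>) = 1"
      using prob_space.emeasure_space_1[OF prob_space.prob_space_distr[OF prob coords]] .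
  qed (use p c der strong der0 \<rho> first' in auto)
  thus ?thesis by blast
qed

lemma strongly_log_concave_radial_imp_subgaussian:
  fixes \<rho> :: "('i \<Rightarrow> real) measure"
  assumes "strongly_log_concave_radial P u u' \<kappa> b \<rho>" and J: "J \<subseteq> P" "J \<noteq> {}"
  shows "subgaussian_vector \<rho> J \<kappa> (exp (-9) * b\<^sup>2 / 16)"
proof -
  interpret strongly_log_concave_radial P u u' \<kappa> b \<rho> by fact
  interpret prob_space \<rho> by (rule prob_spaceI) (rule total)
  show ?thesis
  proof
    show "finite J" using J P(1) finite_subset by blast
    show "J \<noteq> {}" by fact
    show "0 < \<kappa>" by (rule \<kappa>)
    show "0 < exp (- 9) * b\<^sup>2 / 16" using b by simp
    show "(\<lambda>x. x j) \<in> borel_measurable \<rho>" if "j \<in> J" for j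
    proof -
      have "(\<lambda>x. x j) \<in> Pi\<^sub>M P (\<lambda>_. lborel :: real measure) \<rightarrow>\<^sub>M lborel"
        using that J by (intro measurable_component_singleton) auto
      thus ?thesis by (simp add: \<rho>)
    qed
    show "(\<integral>\<^sup>+x. ennreal (exp (\<Sum>j\<in>J. t j * x j)) \<partial>\<rho>) \<le> ennreal (exp ((L2_set t J)\<^sup>2 / (2 * \<kappa>)))" for t
    proof -
      \<comment> \<open>A direction on \<open>J\<close> becomes one on \<open>P\<close> by filling
        in zeros, which preserves its norm.\<close>
      define t' where "t' i = (if i \<in> J then t i else 0)" for i
      have 1: "(\<Sum>i\<in>P. t' i * x i) = (\<Sum>j\<in>J. t j * x j)" for x
        using J P(1) by (intro sum.mono_neutral_cong_right) (auto simp: t'_def)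
      have 2: "(\<Sum>i\<in>P. (t' i)\<^sup>2) = (\<Sum>j\<in>J. (t j)\<^sup>2)"
        using J P(1) by (intro sum.mono_neutral_cong_right) (auto simp: t'_def)
      show ?thesis using exponential_moment[of t'] by (simp only: 1 2 L2_set_sq)
    qed
    show "emeasure \<rho> {x \<in> space \<rho>. (\<Sum>j\<in>J. (x j)\<^sup>2) < exp (- 9) * b\<^sup>2 / 16 * card J}
      \<le> ennreal (2 * exp (- real (card J)))" by (rule small_ball) fact
  qed
qed

section \<open>Concentration for the standardized design\<close>

context random_design
begin

definition std_row :: "nat \<Rightarrow> 'w \<Rightarrow> nat \<Rightarrow> real" where
  "std_row i \<omega> = vec_coords p (R *\<^sub>v row (X \<omega>) i)"

lemma R_symmetric: "R \<in> carrier_mat p p" "transpose_mat R = R"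
  using root by (auto simp: is_inv_sqrt_def pos_semidef_def)

text \<open>Standardization multiplies a row, seen as a column vector, by \<open>R\<close> from the
  left, but the design by \<open>R\<close> from the right; symmetry of \<open>R\<close> reconciles
  the two.\<close>

lemma std_row_eq:
  assumes "\<omega> \<in> space M" "i < n" "j < p"
  shows "std_row i \<omega> j = (X \<omega> * R) $$ (i, j)"
proof -
  have x: "row (X \<omega>) i \<in> carrier_vec p" using X_dim[OF assms(1)] assms(2) by auto
  have "std_row i \<omega> j = row R j \<bullet> row (X \<omega>) i" using assms R_symmetric(1) by (simp add: std_row_def vec_coords_def)
  also have "row R j = col R j" using R_symmetric assms(3) by (metis carrier_matD(2) row_transpose)
  also have "col R j \<bullet> row (X \<omega>) i = row (X \<omega>) i \<bullet> col R j" using x R_symmetric(1) by (intro comm_scalar_prod[of _ p]) auto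
  finally show ?thesis using assms X_dim[OF assms(1)] R_symmetric(1) by simp
qed

lemma rows_measurable: "i < n \<Longrightarrow> (\<lambda>\<omega>. row (X \<omega>) i) \<in> M \<rightarrow>\<^sub>M borel_vec p"
  using rows_indep by (auto simp: indep_vars_def)

lemma std_map_measurable: "(\<lambda>v. vec_coords p (R *\<^sub>v v)) \<in> borel_vec p \<rightarrow>\<^sub>M Pi\<^sub>M {..<p} (\<lambda>_. lborel)"
  by (rule measurable_compose[OF mult_mat_vec_measurable[OF R_symmetric(1)] vec_coords_measurable])

text \<open>Moves the problem from the abstract probability space to a power of a single law, where
  the singular value bounds are available.\<close>

lemma distr_std_rows:
  "distr M (Pi\<^sub>M {..<n} (\<lambda>_. Pi\<^sub>M {..<p} (\<lambda>_. lborel))) (\<lambda>\<omega>. \<lambda>i\<in>{..<n}. std_row i \<omega>) =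
     Pi\<^sub>M {..<n} (\<lambda>_. distr \<mu> (Pi\<^sub>M {..<p} (\<lambda>_. lborel)) (vec_coords p))"
proof -
  let ?L = "Pi\<^sub>M {..<p} (\<lambda>_. lborel :: real measure)"
  have indep: "indep_vars (\<lambda>_. ?L) std_row {..<n}"
    unfolding std_row_def[abs_def] by (rule indep_vars_compose2[OF rows_indep std_map_measurable])
  have meas: "std_row i \<in> M \<rightarrow>\<^sub>M ?L" if "i < n" for i
    unfolding std_row_def[abs_def] using measurable_compose[OF rows_measurable[OF that] std_map_measurable] .
  have "distr M ?L (std_row i) = distr \<mu> ?L (vec_coords p)" if "i < n" for i
  proof -
    have "distr M ?L (std_row i) = distr (distr M (borel_vec p) (\<lambda>\<omega>. row (X \<omega>) i)) ?L (\<lambda>v. vec_coords p (R *\<^sub>v v))"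
      unfolding std_row_def[abs_def]
      by (subst distr_distr[OF std_map_measurable rows_measurable[OF that]]) (simp add: comp_def)
    also have "\<dots> = distr \<nu> ?L (\<lambda>v. vec_coords p (R *\<^sub>v v))" using rows_law[OF that] by simp
    also have "\<dots> = distr \<mu> ?L (vec_coords p)"
    proof -
      have "sets \<nu> = sets (borel_vec p)" using rows_law[OF that] by (metis sets_distr)
      hence "(\<lambda>v. R *\<^sub>v v) \<in> \<nu> \<rightarrow>\<^sub>M borel_vec p"
        using mult_mat_vec_measurable[OF R_symmetric(1)] measurable_cong_sets by blast
      thus ?thesis unfolding standardized
        by (subst distr_distr[OF vec_coords_measurable]) (simp_all add: comp_def)
    qed
    finally show ?thesis .
  qed
  hence "Pi\<^sub>M {..<n} (\<lambda>i. distr M ?L (std_row i)) = Pi\<^sub>M {..<n} (\<lambda>_. distr \<mu> ?L (vec_coords p))"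
    by (intro PiM_cong) auto
  moreover have "distr M (Pi\<^sub>M {..<n} (\<lambda>_. ?L)) (\<lambda>\<omega>. \<lambda>i\<in>{..<n}. std_row i \<omega>) = Pi\<^sub>M {..<n} (\<lambda>i. distr M ?L (std_row i))"
    using indep n_pos meas by (subst (asm) indep_vars_iff_distr_eq_PiM') auto
  ultimately show ?thesis by simp
qed

lemma concentration:
  assumes c: "0 < c2" "0 < c3" and hess: "has_hessian p U H"
    and convex: "\<forall>v\<in>carrier_vec p. loewner_ge p (H v) (c2 \<cdot>\<^sub>m 1\<^sub>m p)"
    and first: "c3 \<le> (LINT v|\<mu>. \<bar>v $ 0\<bar>)"
    and J: "J \<subseteq> {..<p}"
  defines "\<delta> \<equiv> exp (-9) * c3\<^sup>2 / 16"
  assumes large: "aspect_const c2 \<delta> * n < card J"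
    and c1: "(upper_const c2)\<^sup>2 \<le> c1" "inverse c1 \<le> \<delta> / 32"
  shows "prob {\<omega> \<in> space M. let Zt = submatrix (X \<omega> * R) {..<n} J;
                W = (1 / real (card J)) \<cdot>\<^sub>m (Zt * transpose_mat Zt)
            in lambda_max W > c1 \<or> lambda_min W < inverse c1} \<le> exp (- real n)"
proof -
  let ?L = "Pi\<^sub>M {..<p} (\<lambda>_. lborel :: real measure)"
  define \<rho> where "\<rho> = distr \<mu> ?L (vec_coords p)"
  let ?\<Omega> = "Pi\<^sub>M {..<n} (\<lambda>_. \<rho>)"
  have \<delta>: "0 < \<delta>" using c by (simp add: \<delta>_def)
  define Bad where "Bad = {\<omega> \<in> space M. let Zt = submatrix (X \<omega> * R) {..<n} J;
                W = (1 / real (card J)) \<cdot>\<^sub>m (Zt * transpose_mat Zt)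
            in lambda_max W > c1 \<or> lambda_min W < inverse c1}"
  have "0 \<le> aspect_const c2 \<delta> * n" by (simp add: aspect_const_def)
  hence cJ: "0 < card J" using large by linarith
  have "\<exists>u u'. strongly_log_concave_radial {..<p} u u' c2 c3 \<rho>"
    unfolding \<rho>_def using p_pos spherical U_measurable density density_symmetric hess convex c first
    by (rule spherical_density_strongly_log_concave)
  then have sg: "subgaussian_vector \<rho> J c2 \<delta>"
    unfolding \<delta>_def using J cJ by (metis strongly_log_concave_radial_imp_subgaussian card.empty less_irrefl)
  obtain B where B: "B \<in> sets ?\<Omega>" "emeasure ?\<Omega> B \<le> ennreal (exp (- real n))"
    and sv: "\<And>z a. z \<in> space ?\<Omega> - B \<Longrightarrow>
       sqrt (\<delta> / 32 * card J) * L2_set a {..<n} \<le> L2_set (\<lambda>j. \<Sum>i<n. a i * z i j) J \<and>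
       L2_set (\<lambda>j. \<Sum>i<n. a i * z i j) J \<le> upper_const c2 * sqrt (card J) * L2_set a {..<n}"
    using subgaussian_vector.extreme_singular_values[OF sg n_pos large] by blast
  define F where "F \<omega> = (\<lambda>i\<in>{..<n}. std_row i \<omega>)" for \<omega>
  have law: "distr M (Pi\<^sub>M {..<n} (\<lambda>_. ?L)) F = ?\<Omega>"
    unfolding F_def[abs_def] \<rho>_def by (rule distr_std_rows)
  have F: "F \<in> M \<rightarrow>\<^sub>M Pi\<^sub>M {..<n} (\<lambda>_. ?L)"
    unfolding F_def[abs_def] std_row_def[abs_def]
    by (intro measurable_restrict measurable_compose[OF rows_measurable std_map_measurable]) auto
  have sets\<Omega>: "sets ?\<Omega> = sets (Pi\<^sub>M {..<n} (\<lambda>_. ?L))" by (intro sets_PiM_cong) (auto simp: \<rho>_def)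
  have B': "B \<in> sets (Pi\<^sub>M {..<n} (\<lambda>_. ?L))" using B sets\<Omega> by simp
  have "Bad \<subseteq> F -` B \<inter> space M"
  proof
    fix \<omega> assume bad: "\<omega> \<in> Bad"
    hence \<omega>: "\<omega> \<in> space M" by (simp add: Bad_def)
    have "F \<omega> \<in> B"
    proof (rule ccontr)
      assume "F \<omega> \<notin> B"
      moreover have "F \<omega> \<in> space ?\<Omega>"
        using measurable_space[OF F \<omega>] sets_eq_imp_space_eq[OF sets\<Omega>] by simp
      ultimately have z: "F \<omega> \<in> space ?\<Omega> - B" by simp
      define Z where "Z = submatrix (X \<omega> * R) {..<n} J"
      have XR: "X \<omega> * R \<in> carrier_mat n p" using X_dim[OF \<omega>] R_symmetric(1) by auto
      have Z: "Z \<in> carrier_mat n (card J)" unfolding Z_def by (rule submatrix_columns(1)[OF XR J])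
      have bounds: "\<delta> / 32 * card J * (\<Sum>i<n. (v $ i)\<^sup>2) \<le> (\<Sum>j<card J. (\<Sum>i<n. v $ i * Z $$ (i, j))\<^sup>2) \<and>
        (\<Sum>j<card J. (\<Sum>i<n. v $ i * Z $$ (i, j))\<^sup>2) \<le> (upper_const c2)\<^sup>2 * card J * (\<Sum>i<n. (v $ i)\<^sup>2)"
        for v :: "real vec"
      proof -
        have eq: "(\<Sum>j<card J. (\<Sum>i<n. v $ i * Z $$ (i, j))\<^sup>2) = (L2_set (\<lambda>j. \<Sum>i<n. v $ i * F \<omega> i j) J)\<^sup>2"
          unfolding Z_def submatrix_columns(2)[OF XR J] L2_set_sq
          using J by (intro sum.cong arg_cong[where f="\<lambda>x. x\<^sup>2"] refl) (auto simp: F_def std_row_eq[OF \<omega>])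
        have "(sqrt (\<delta> / 32 * card J) * L2_set (\<lambda>i. v $ i) {..<n})\<^sup>2 \<le> (L2_set (\<lambda>j. \<Sum>i<n. v $ i * F \<omega> i j) J)\<^sup>2"
          using sv[OF z, of "\<lambda>i. v $ i"] \<delta> by (intro power_mono) auto
        moreover have "(L2_set (\<lambda>j. \<Sum>i<n. v $ i * F \<omega> i j) J)\<^sup>2 \<le> (upper_const c2 * sqrt (card J) * L2_set (\<lambda>i. v $ i) {..<n})\<^sup>2"
          using sv[OF z, of "\<lambda>i. v $ i"] by (intro power_mono) auto
        ultimately show ?thesis unfolding eq using \<delta> by (simp add: power_mult_distrib L2_set_sq)
      qed
      from gram_eigenvalue_bounds[OF Z n_pos cJ bounds]
      have "lambda_max ((1 / real (card J)) \<cdot>\<^sub>m (Z * transpose_mat Z)) \<le> (upper_const c2)\<^sup>2"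
        "\<delta> / 32 \<le> lambda_min ((1 / real (card J)) \<cdot>\<^sub>m (Z * transpose_mat Z))" by auto
      with bad c1 show False by (auto simp: Bad_def Let_def Z_def)
    qed
    thus "\<omega> \<in> F -` B \<inter> space M" using \<omega> by simp
  qed
  \<comment> \<open>Monotonicity asks for measurability of the larger set, the preimage of
    \<open>B\<close>; the eigenvalue event enters only through the inclusion.\<close>
  hence "prob Bad \<le> prob (F -` B \<inter> space M)"
    by (rule finite_measure_mono) (rule measurable_sets[OF F B'])
  also have "\<dots> \<le> exp (- real n)"
  proof -
    have "emeasure M (F -` B \<inter> space M) = emeasure ?\<Omega> B"
      unfolding law[symmetric] by (rule emeasure_distr[OF F B', symmetric])
    hence "ennreal (prob (F -` B \<inter> space M)) \<le> ennreal (exp (- real n))"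
      using B(2) by (simp add: emeasure_eq_measure)
    thus ?thesis by simp
  qed
  finally show ?thesis unfolding Bad_def .
qed

end

theorem theorem1:
  fixes c2 c3 :: real
  assumes "0 < c2" and "0 < c3" and "c3 \<le> 1"
  shows "\<exists>c c1 C1 :: real. 1 < c \<and> 0 < c1 \<and> 0 < C1 \<and>
    (\<forall>(M :: 'w measure) n p X \<nu> \<Sigma> R \<mu> U H.
       random_design M n p X \<nu> \<Sigma> R \<mu> U \<longrightarrow>
       has_hessian p U H \<longrightarrow>
       (\<forall>v\<in>carrier_vec p. loewner_ge p (H v) (c2 \<cdot>\<^sub>m 1\<^sub>m p)) \<longrightarrow>
       c3 \<le> (LINT v|\<mu>. \<bar>v $ 0\<bar>) \<longrightarrow>
       (\<forall>J pt. J \<subseteq> {..<p} \<longrightarrow> card J = pt \<longrightarrow> c * real n < real pt \<longrightarrow> pt \<le> p \<longrightarrow>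
          measure M {\<omega> \<in> space M.
            let Zt = submatrix (X \<omega> * R) {..<n} J;
                W = (1 / real pt) \<cdot>\<^sub>m (Zt * transpose_mat Zt)
            in lambda_max W > c1 \<or> lambda_min W < inverse c1}
          \<le> exp (- C1 * real n)))"
proof -
  define \<delta> where "\<delta> = exp (-9) * c3\<^sup>2 / 16"
  have \<delta>: "\<delta> > 0" using assms by (simp add: \<delta>_def)
  \<comment> \<open>One constant controls the spectrum on both sides, so it must dominate the upper
    bound as well as the reciprocal of the lower bound \<delta> / 32.\<close>
  define c1 where "c1 = max ((upper_const c2)\<^sup>2) (32 / \<delta>)"
  have c1: "(upper_const c2)\<^sup>2 \<le> c1" "32 / \<delta> \<le> c1" by (auto simp: c1_def)
  moreover have "0 < 32 / \<delta>" using \<delta> by simp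
  ultimately have c1_pos: "0 < c1" by linarith
  have inv: "inverse c1 \<le> \<delta> / 32" using c1(2) c1_pos \<delta> by (simp add: field_simps)
  have "1 < aspect_const c2 \<delta>" by (simp add: aspect_const_def)
  thus ?thesis
    using c1_pos random_design.concentration[OF _ assms(1,2) _ _ _ _ _ c1(1) inv[unfolded \<delta>_def]]
    by (intro exI[of _ "aspect_const c2 \<delta>"] exI[of _ c1] exI[of _ 1]) (auto simp: \<delta>_def)
qed

end
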